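(* Let $(X_t)_{t\ge 0}$ be a continuous-time Markov process on a measurable space $(\mathbb X,\mathcal E)$, with generator $L$, semigroup $(P_t)_{t\ge 0}$, invariant law $\pi$ and algebra $\mathcal A$, satisfying the standing assumptions listed in the context. Let $\mu_t=\mathrm{law}(X_t)$, let $\gamma_\star$ be the local Poincaré constant of the process and let $\kappa\in\mathbb R$ be its Bakry–Émery curvature. Assume that $$\forall f\in\mathcal A,\qquad \mathrm{Var}_{\mu_t}(f)\xrightarrow[t\to0^+]{}0 .$$ Then $$\gamma_\star\;\ge\;\kappa .$$ In particular, when $\kappa>0$, $$\forall\varepsilon\in(0,1/2),\qquad \mathrm w_{\mathrm{mix}}(\varepsilon)\;\le\;\frac{3}{2\kappa}\log\frac1\varepsilon .$$
   Context: Standing setting. $(X_t)_{t\ge0}$ is a continuous-time Markov process with values in a measurable space $(\mathbb X,\mathcal E)$, with generator $L$ (with domain in $L^2(\pi)$), semigroup $(P_t)_{t\ge0}$ and invariant law $\pi\in\mathcal P(\mathbb X)$, where $\mathcal P(\mathbb X)$ is the set of probability measures on $(\mathbb X,\mathcal E)$. No reversibility is assumed. Write $\mu_t:=\mathrm{law}(X_t)=\mu_0P_t$. It is assumed that $\mu_t\ll\pi$ for every $t>0$, and that $\mathrm d_{\mathrm{TV}}(\mu_t,\pi)\to0$ as $t\to\infty$, where $\mathrm d_{\mathrm{TV}}(\mu,\nu):=\sup_{A\in\mathcal E}|\mu(A)-\nu(A)|$. One is also given an algebra $\mathcal A\subset L^\infty(\pi)$ of real functions that contains the constants, is contained in the domain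 of $L$, is stable under $(P_t)_{t\ge0}$, and is dense in $L^2(\pi)$. The carré du champ operator $\Gamma:\mathcal A\to L^2(\pi)$ is $\Gamma f:=\tfrac12 L(f^2)-fLf$, with associated symmetric bilinear form $\Gamma(f,g):=\tfrac12\big(L(fg)-fLg-gLf\big)$, so $\Gamma f=\Gamma(f,f)$. Poincaré constants. For a probability measure $\mu\ll\pi$, $\gamma(\mu)\in[0,\infty]$ is the largest constant such that $\gamma(\mu)\,\mathrm{Var}_\mu(f)\le\int\Gamma f\,\mathrm d\mu$ for all $f\in\mathcal A$ (i.e. the supremum of all finite constants with this property). The local Poincaré constant of the process is $\gamma_\star:=\inf_{t>0}\gamma(\mu_t)$. Curvature. The iterated carré du champ is $\Gamma_2f:=\tfrac12L\Gamma f-\Gamma(f,Lf)$. The Bakry–Émery curvature $\kappa\in\mathbb R$ is the optimal (largest) constant such that the condition $\mathrm{CD}(\kappa,\infty)$ holds: $\Gamma_2f\ge\kappa\,\Gamma f$ for all $f\in\mathcal A$. As usual in Bakry–Émery theory, it is understood that $\mathcal A$ is regular enough for $\Gamma_2$ to make sense and for the following standard equivalence to hold: $\mathrm{CD}(\kappa,\infty)$ holds if and only if $\Gamma P_tf\le e^{-2\kappa t}P_t\Gamma f$ ($\pi$-a.e.) for all $f\in\mathcal A$ and all $t\ge0$. Mixing times. For $\varepsilon\in(0,1)$, $\mathrm t_{\mathrm{mix}}(\varepsilon):=\inf\{t\ge0:\mathrm d_{\mathrm{TV}}(\mu_t,\pi)\le\varepsilon\}$, and for $0<\varepsilon<1/2$,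 $\mathrm w_{\mathrm{mix}}(\varepsilon):=\mathrm t_{\mathrm{mix}}(\varepsilon)-\mathrm t_{\mathrm{mix}}(1-\varepsilon)$. *)

theory Defs
  imports "HOL-Probability.Probability"
begin

definition natural_filtration ::
    "'w measure \<Rightarrow> 'a measure \<Rightarrow> (real \<Rightarrow> 'w \<Rightarrow> 'a) \<Rightarrow> real \<Rightarrow> 'w measure" where
  "natural_filtration M E X s =
     sigma (space M) (\<Union>u\<in>{0..s}. {X u -` B \<inter> space M | B. B \<in> sets E})"

locale markov_process = prob_space M for M :: "'w measure" +
  fixes E :: "'a measure"
    and X :: "real \<Rightarrow> 'w \<Rightarrow> 'a"
    and K :: "real \<Rightarrow> 'a \<Rightarrow> 'a measure"
  assumes kernel: "0 \<le> t \<Longrightarrow> K t \<in> E \<rightarrow>\<^sub>M prob_algebra E"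
    and kernel_0: "x \<in> space E \<Longrightarrow> K 0 x = return E x"
    and chapman_kolmogorov:
      "0 \<le> s \<Longrightarrow> 0 \<le> t \<Longrightarrow> x \<in> space E \<Longrightarrow> K (s + t) x = K s x \<bind> K t"
    and random_variable_X: "0 \<le> t \<Longrightarrow> X t \<in> M \<rightarrow>\<^sub>M E"
    and markov_property:
      "0 \<le> s \<Longrightarrow> 0 \<le> t \<Longrightarrow> A \<in> sets E \<Longrightarrow>
        AE \<omega> in M. real_cond_exp M (natural_filtration M E X s) (\<lambda>\<omega>. indicator A (X (s + t) \<omega>)) \<omega>
          = measure (K t (X s \<omega>)) A"

definition law :: "'w measure \<Rightarrow> 'a measure \<Rightarrow> (real \<Rightarrow> 'w \<Rightarrow> 'a) \<Rightarrow> real \<Rightarrow> 'a measure" where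
  "law M E X t = distr M E (X t)"

definition semigroup_op :: "(real \<Rightarrow> 'a \<Rightarrow> 'a measure) \<Rightarrow> real \<Rightarrow> ('a \<Rightarrow> real) \<Rightarrow> 'a \<Rightarrow> real" where
  "semigroup_op K t f = (\<lambda>x. \<integral>y. f y \<partial>K t x)"

text \<open>Elements of \<open>L\<^sup>2(\<pi>)\<close> and \<open>L\<^sup>\<infinity>(\<pi>)\<close> are handled through representatives; identities and
  inequalities between them are stated \<open>\<pi>\<close>-almost everywhere.\<close>

definition L2 :: "'a measure \<Rightarrow> ('a \<Rightarrow> real) set" where
  "L2 \<pi> = {f \<in> borel_measurable \<pi>. integrable \<pi> (\<lambda>x. (f x)\<^sup>2)}"

definition L_infty :: "'a measure \<Rightarrow> ('a \<Rightarrow> real) set" where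
  "L_infty \<pi> = {f \<in> borel_measurable \<pi>. \<exists>C. AE x in \<pi>. \<bar>f x\<bar> \<le> C}"

definition has_generator ::
    "(real \<Rightarrow> 'a \<Rightarrow> 'a measure) \<Rightarrow> 'a measure \<Rightarrow> ('a \<Rightarrow> real) \<Rightarrow> ('a \<Rightarrow> real) \<Rightarrow> bool" where
  "has_generator K \<pi> f g \<longleftrightarrow> f \<in> L2 \<pi> \<and> g \<in> L2 \<pi> \<and>
     ((\<lambda>t. \<integral>x. ((semigroup_op K t f x - f x) / t - g x)\<^sup>2 \<partial>\<pi>) \<longlongrightarrow> 0) (at_right 0)"

definition gen_dom :: "(real \<Rightarrow> 'a \<Rightarrow> 'a measure) \<Rightarrow> 'a measure \<Rightarrow> ('a \<Rightarrow> real) set" where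
  "gen_dom K \<pi> = {f. \<exists>g. has_generator K \<pi> f g}"

text \<open>A representative of \<open>L f\<close>, meaningful for \<open>f \<in> gen_dom K \<pi>\<close> only and then unique up to
  \<open>\<pi>\<close>-null sets.\<close>

definition gen ::
    "(real \<Rightarrow> 'a \<Rightarrow> 'a measure) \<Rightarrow> 'a measure \<Rightarrow> ('a \<Rightarrow> real) \<Rightarrow> 'a \<Rightarrow> real" where
  "gen K \<pi> f = (SOME g. has_generator K \<pi> f g)"

definition Gamma_bil ::
    "(real \<Rightarrow> 'a \<Rightarrow> 'a measure) \<Rightarrow> 'a measure \<Rightarrow> ('a \<Rightarrow> real) \<Rightarrow> ('a \<Rightarrow> real) \<Rightarrow> 'a \<Rightarrow> real" where
  "Gamma_bil K \<pi> f g =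
     (\<lambda>x. (gen K \<pi> (\<lambda>y. f y * g y) x - f x * gen K \<pi> g x - g x * gen K \<pi> f x) / 2)"

definition Gamma ::
    "(real \<Rightarrow> 'a \<Rightarrow> 'a measure) \<Rightarrow> 'a measure \<Rightarrow> ('a \<Rightarrow> real) \<Rightarrow> 'a \<Rightarrow> real" where
  "Gamma K \<pi> f = (\<lambda>x. gen K \<pi> (\<lambda>y. (f y)\<^sup>2) x / 2 - f x * gen K \<pi> f x)"

definition Gamma2 ::
    "(real \<Rightarrow> 'a \<Rightarrow> 'a measure) \<Rightarrow> 'a measure \<Rightarrow> ('a \<Rightarrow> real) \<Rightarrow> 'a \<Rightarrow> real" where
  "Gamma2 K \<pi> f = (\<lambda>x. gen K \<pi> (Gamma K \<pi> f) x / 2 - Gamma_bil K \<pi> f (gen K \<pi> f) x)"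

definition CD ::
    "(real \<Rightarrow> 'a \<Rightarrow> 'a measure) \<Rightarrow> 'a measure \<Rightarrow> ('a \<Rightarrow> real) set \<Rightarrow> real \<Rightarrow> bool" where
  "CD K \<pi> \<A> \<kappa> \<longleftrightarrow> (\<forall>f\<in>\<A>. AE x in \<pi>. Gamma2 K \<pi> f x \<ge> \<kappa> * Gamma K \<pi> f x)"

definition is_curvature ::
    "(real \<Rightarrow> 'a \<Rightarrow> 'a measure) \<Rightarrow> 'a measure \<Rightarrow> ('a \<Rightarrow> real) set \<Rightarrow> real \<Rightarrow> bool" where
  "is_curvature K \<pi> \<A> \<kappa> \<longleftrightarrow> CD K \<pi> \<A> \<kappa> \<and> (\<forall>k. CD K \<pi> \<A> k \<longrightarrow> k \<le> \<kappa>)"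

definition sub_commutation ::
    "(real \<Rightarrow> 'a \<Rightarrow> 'a measure) \<Rightarrow> 'a measure \<Rightarrow> ('a \<Rightarrow> real) set \<Rightarrow> real \<Rightarrow> bool" where
  "sub_commutation K \<pi> \<A> \<kappa> \<longleftrightarrow> (\<forall>f\<in>\<A>. \<forall>t\<ge>0. AE x in \<pi>.
     Gamma K \<pi> (semigroup_op K t f) x \<le> exp (- 2 * \<kappa> * t) * semigroup_op K t (Gamma K \<pi> f) x)"

text \<open>For \<open>f \<in> \<A>\<close> one has \<open>\<Gamma> f \<ge> 0\<close> \<open>\<pi>\<close>-almost everywhere, hence \<open>\<mu>\<close>-almost everywhere when
  \<open>\<mu> \<lless> \<pi>\<close>, but \<open>\<Gamma> f\<close> need not be \<open>\<mu>\<close>-integrable. Its integral is therefore taken in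
  \<open>[0,\<infinity>]\<close>, as a Bochner integral would silently be \<open>0\<close> instead of \<open>\<infinity>\<close>.\<close>

definition poincare_const ::
    "(real \<Rightarrow> 'a \<Rightarrow> 'a measure) \<Rightarrow> 'a measure \<Rightarrow> ('a \<Rightarrow> real) set \<Rightarrow> 'a measure \<Rightarrow> ereal" where
  "poincare_const K \<pi> \<A> \<mu> = Sup {ereal c | c.
     \<forall>f\<in>\<A>. ereal (c * prob_space.variance \<mu> f) \<le> enn2ereal (\<integral>\<^sup>+x. ennreal (Gamma K \<pi> f x) \<partial>\<mu>)}"

definition local_poincare_const ::
    "'w measure \<Rightarrow> 'a measure \<Rightarrow> (real \<Rightarrow> 'w \<Rightarrow> 'a) \<Rightarrow> (real \<Rightarrow> 'a \<Rightarrow> 'a measure) \<Rightarrow> 'a measure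
      \<Rightarrow> ('a \<Rightarrow> real) set \<Rightarrow> ereal" where
  "local_poincare_const M E X K \<pi> \<A> = (INF t\<in>{0<..}. poincare_const K \<pi> \<A> (law M E X t))"

definition tv_dist :: "'a measure \<Rightarrow> 'a measure \<Rightarrow> real" where
  "tv_dist \<mu> \<nu> = (SUP A\<in>sets \<mu>. \<bar>measure \<mu> A - measure \<nu> A\<bar>)"

definition t_mix ::
    "'w measure \<Rightarrow> 'a measure \<Rightarrow> (real \<Rightarrow> 'w \<Rightarrow> 'a) \<Rightarrow> 'a measure \<Rightarrow> real \<Rightarrow> real" where
  "t_mix M E X \<pi> \<epsilon> = Inf {t. 0 \<le> t \<and> tv_dist (law M E X t) \<pi> \<le> \<epsilon>}"

definition w_mix ::
    "'w measure \<Rightarrow> 'a measure \<Rightarrow> (real \<Rightarrow> 'w \<Rightarrow> 'a) \<Rightarrow> 'a measure \<Rightarrow> real \<Rightarrow> real" where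
  "w_mix M E X \<pi> \<epsilon> = t_mix M E X \<pi> \<epsilon> - t_mix M E X \<pi> (1 - \<epsilon>)"

locale markov_algebra_setting = markov_process M E X K
  for M :: "'w measure" and E :: "'a measure" and X K +
  fixes \<pi> :: "'a measure" and \<A> :: "('a \<Rightarrow> real) set"
  assumes prob_space_invariant: "prob_space \<pi>"
    and sets_invariant: "sets \<pi> = sets E"
    and invariant: "0 \<le> t \<Longrightarrow> \<pi> \<bind> K t = \<pi>"
    and law_absolutely_continuous: "0 < t \<Longrightarrow> absolutely_continuous \<pi> (law M E X t)"
    and law_tendsto_invariant: "((\<lambda>t. tv_dist (law M E X t) \<pi>) \<longlongrightarrow> 0) at_top"
    and algebra_bounded: "\<A> \<subseteq> L_infty \<pi>"
    \<comment> \<open>\<open>\<A>\<close> is the set of all representatives of a set of classes in \<open>L\<^sup>\<infinity>(\<pi>)\<close>\<close>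
    and algebra_saturated:
      "f \<in> \<A> \<Longrightarrow> g \<in> borel_measurable \<pi> \<Longrightarrow> (AE x in \<pi>. f x = g x) \<Longrightarrow> g \<in> \<A>"
    and algebra_const: "(\<lambda>x. c) \<in> \<A>"
    and algebra_add: "f \<in> \<A> \<Longrightarrow> g \<in> \<A> \<Longrightarrow> (\<lambda>x. f x + g x) \<in> \<A>"
    and algebra_mult: "f \<in> \<A> \<Longrightarrow> g \<in> \<A> \<Longrightarrow> (\<lambda>x. f x * g x) \<in> \<A>"
    and algebra_domain: "\<A> \<subseteq> gen_dom K \<pi>"
    and algebra_stable: "0 \<le> t \<Longrightarrow> f \<in> \<A> \<Longrightarrow> semigroup_op K t f \<in> \<A>"
    and algebra_dense:
      "g \<in> L2 \<pi> \<Longrightarrow> 0 < e \<Longrightarrow> \<exists>f\<in>\<A>. (\<integral>x. (f x - g x)\<^sup>2 \<partial>\<pi>) < e"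

text \<open>The first three assumptions say exactly that every application of \<open>L\<close> in
  \<open>\<Gamma>\<^sub>2 f = L (\<Gamma> f) / 2 - \<Gamma>(f, L f)\<close> is to an element of its domain (\<open>f\<close> itself lies in \<open>\<A>\<close>).\<close>

locale bakry_emery_setting = markov_algebra_setting M E X K \<pi> \<A>
  for M :: "'w measure" and E :: "'a measure" and X K \<pi> \<A> +
  assumes Gamma_domain: "f \<in> \<A> \<Longrightarrow> Gamma K \<pi> f \<in> gen_dom K \<pi>"
    and gen_domain: "f \<in> \<A> \<Longrightarrow> gen K \<pi> f \<in> gen_dom K \<pi>"
    and mult_gen_domain: "f \<in> \<A> \<Longrightarrow> (\<lambda>x. f x * gen K \<pi> f x) \<in> gen_dom K \<pi>"
    and CD_iff_sub_commutation: "CD K \<pi> \<A> k \<longleftrightarrow> sub_commutation K \<pi> \<A> k"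

end

theory Submission
  imports Defs
begin

text \<open>Let \<open>\<kappa> > 0\<close>, the bound on \<open>\<gamma>\<^sub>\<star>\<close> being trivial otherwise. For a measure \<open>\<nu> \<le> \<pi>\<close> and \<open>f \<in> \<A>\<close>, the interpolation
  \<open>u \<mapsto> \<integral> (P\<^bsub>s-u\<^esub> f)\<^sup>2 d(\<nu> P\<^sub>u)\<close> is continuous with left derivative
  \<open>2 \<integral> \<Gamma> P\<^bsub>s-u\<^esub> f d(\<nu> P\<^sub>u)\<close>. Sub-commutation bounds this derivative from above and below,
  which gives, \<open>\<pi>\<close>-almost everywhere, the local Poincare inequality
  \<open>P\<^sub>s(f\<^sup>2) - (P\<^sub>s f)\<^sup>2 \<le> P\<^sub>s \<Gamma> f / \<kappa>\<close> and its reverse \<open>P\<^sub>s(f\<^sup>2) - (P\<^sub>s f)\<^sup>2 \<ge> 2 s \<Gamma> P\<^sub>s f\<close>.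
  Integrating the first against \<open>\<mu>\<^sub>r\<close> with \<open>s = t - r\<close> and letting \<open>r \<rightarrow> 0\<close> yields the Poincare
  inequality for \<open>\<mu>\<^sub>t\<close>. Combined with the reverse one, it gives
  \<open>(1 + 2 \<kappa> h) Var[\<mu>\<^sub>r](P\<^sub>h f) \<le> Var[\<mu>\<^bsub>r+h\<^esub>](f)\<close>, hence by iteration
  \<open>Var[\<mu>\<^sub>r](P\<^sub>s f) \<le> exp (-2 \<kappa> s) Var[\<mu>\<^bsub>r+s\<^esub>](f)\<close>, first on \<open>\<A>\<close>, then for indicators, and for
  \<open>\<pi>\<close> in place of the laws as \<open>r \<rightarrow> \<infinity>\<close>. If \<open>\<mu>\<^sub>t\<close> and \<open>\<pi>\<close> overlap with mass at least \<open>\<epsilon>\<close>, then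
  \<open>P\<^sub>s 1\<^sub>B\<close>, being concentrated around \<open>\<mu>\<^bsub>t+s\<^esub>(B)\<close> under the former and around \<open>\<pi>(B)\<close> under the
  latter, forces \<open>\<epsilon> (\<mu>\<^bsub>t+s\<^esub>(B) - \<pi>(B))\<^sup>2 \<le> exp (-2 \<kappa> s)\<close>, which is \<open>\<epsilon>\<^sup>3\<close> for
  \<open>s = 3 / (2 \<kappa>) ln (1 / \<epsilon>)\<close>.\<close>

section \<open>Monotonicity from left difference quotients\<close>

lemma le_of_left_lower_slope:
  fixes G :: "real \<Rightarrow> real"
  assumes "0 \<le> s" and cont: "continuous_on {0..s} G"
    and slope: "\<And>u e. 0 < u \<Longrightarrow> u \<le> s \<Longrightarrow> 0 < e \<Longrightarrow> \<forall>\<^sub>F h in at_right 0. - e * h \<le> G u - G (u - h)"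
  shows "G 0 \<le> G s"
proof -
  \<comment> \<open>The slope bound lets \<open>G\<close> lose at most \<open>e * h\<close> over a
    short step ending at \<open>u > 0\<close>, while the tilt \<open>2 * e * u\<close> gains
    \<open>2 * e * h\<close>. So the tilted function cannot attain its minimum over the compact
    interval at a positive point; its minimum at 0 is compared with its value at
    \<open>s\<close>.\<close>
  have *: "G 0 \<le> G s + 2 * e * s" if "0 < e" for e
  proof -
    have "continuous_on {0..s} (\<lambda>u. G u + 2 * e * u)"
      by (intro continuous_intros cont)
    then obtain u where u: "u \<in> {0..s}" and min: "\<And>y. y \<in> {0..s} \<Longrightarrow> G u + 2 * e * u \<le> G y + 2 * e * y"
      using continuous_attains_inf[of "{0..s}" "\<lambda>u. G u + 2 * e * u"] \<open>0 \<le> s\<close> by auto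
    have "u = 0"
    proof (rule ccontr)
      assume "u \<noteq> 0"
      with u have "0 < u" "u \<le> s" by auto
      have "\<forall>\<^sub>F h in at_right 0. h < u" "\<forall>\<^sub>F h in at_right (0::real). 0 < h"
        using \<open>0 < u\<close> by (auto simp: eventually_at_right_field)
      with slope[OF \<open>0 < u\<close> \<open>u \<le> s\<close> \<open>0 < e\<close>]
      have "\<forall>\<^sub>F h in at_right 0. h < u \<and> 0 < h \<and> - e * h \<le> G u - G (u - h)"
        by eventually_elim auto
      then obtain h where h: "h < u" "0 < h" "- e * h \<le> G u - G (u - h)"
        using eventually_happens[of _ "at_right (0::real)"] by (auto simp: trivial_limit_at_right_real)
      have "G u + 2 * e * u \<le> G (u - h) + 2 * e * (u - h)"
        using h u by (intro min) auto
      moreover have "e * h > 0" using h \<open>0 < e\<close> by simp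
      ultimately show False using h by (simp add: algebra_simps)
    qed
    then show ?thesis using min[of s] \<open>0 \<le> s\<close> by simp
  qed
  show ?thesis
  proof (rule field_le_epsilon)
    fix d :: real assume "0 < d"
    \<comment> \<open>The summand 1 in \<open>s + 1\<close> keeps this choice of \<open>e\<close>
      legitimate when \<open>s = 0\<close>.\<close>
    have "2 * (d / (2 * (s + 1))) * s \<le> d"
      using \<open>0 \<le> s\<close> \<open>0 < d\<close> by (simp add: field_simps)
    then show "G 0 \<le> G s + d"
      using *[of "d / (2 * (s + 1))"] \<open>0 \<le> s\<close> \<open>0 < d\<close> by simp
  qed
qed

text \<open>Takes the place of the mean value theorem for functions whose derivative is known from
  the left only: if the left quotients tend to \<open>l \<ge> 0\<close>, they exceed
  \<open>-e\<close> for short steps.\<close>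

lemma le_of_left_derivative_nonneg:
  fixes G :: "real \<Rightarrow> real"
  assumes "0 \<le> s" and cont: "continuous_on {0..s} G"
    and lim: "\<And>u. 0 < u \<Longrightarrow> u \<le> s \<Longrightarrow> \<exists>l\<ge>0. ((\<lambda>h. (G u - G (u - h)) / h) \<longlongrightarrow> l) (at_right 0)"
  shows "G 0 \<le> G s"
proof (rule le_of_left_lower_slope[OF assms(1) cont])
  fix u e :: real assume "0 < u" "u \<le> s" "0 < e"
  obtain l where l: "0 \<le> l" "((\<lambda>h. (G u - G (u - h)) / h) \<longlongrightarrow> l) (at_right 0)"
    using lim[OF \<open>0 < u\<close> \<open>u \<le> s\<close>] by blast
  have "\<forall>\<^sub>F h in at_right 0. - e < (G u - G (u - h)) / h"
    using l \<open>0 < e\<close> by (intro order_tendstoD(1)[OF l(2)]) auto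
  moreover have "\<forall>\<^sub>F h in at_right (0::real). 0 < h" by (rule eventually_at_right_less)
  ultimately show "\<forall>\<^sub>F h in at_right 0. - e * h \<le> G u - G (u - h)"
    by eventually_elim (simp add: pos_less_divide_eq)
qed

lemma left_difference_quotient_tendsto:
  fixes A :: "real \<Rightarrow> real"
  assumes "(A has_real_derivative D) (at u)"
  shows "((\<lambda>h. (A u - A (u - h)) / h) \<longlongrightarrow> D) (at_right 0)"
proof -
  have lim: "((\<lambda>h. (A (u + h) - A u) / h) \<longlongrightarrow> D) (at 0)"
    using assms by (simp add: DERIV_def)
  have "filterlim (\<lambda>h::real. - h) (at 0) (at_right 0)"
    by (rule filterlim_atI) (auto intro!: tendsto_eq_intros eventually_mono[OF eventually_at_right_less[of "0::real"]])
  from filterlim_compose[OF lim this] show ?thesis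
    by (rule filterlim_cong[OF refl refl, THEN iffD1, rotated])
       (auto simp: divide_simps intro!: always_eventually)
qed

lemma difference_quotient_diff:
  fixes a b c d h :: real
  shows "(a - b) / h - (c - d) / h = (a - c - (b - d)) / h"
  by (simp add: diff_divide_distrib)

subsection \<open>Integrals under comparable measures\<close>

lemma integrable_le_measure:
  fixes g :: "'a \<Rightarrow> real"
  assumes "sets \<nu> = sets \<mu>" "\<nu> \<le> \<mu>" "integrable \<mu> g"
  shows "integrable \<nu> g"
proof (rule integrableI_bounded)
  show "g \<in> borel_measurable \<nu>"
    using assms(3) by (simp add: measurable_cong_sets[OF assms(1) refl])
  have "(\<integral>\<^sup>+x. ennreal (norm (g x)) \<partial>\<nu>) \<le> (\<integral>\<^sup>+x. ennreal (norm (g x)) \<partial>\<mu>)"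
    by (rule nn_integral_mono_measure[OF assms(1,2)])
  also have "\<dots> < \<infinity>" using assms(3) by (simp add: integrable_iff_bounded)
  finally show "(\<integral>\<^sup>+x. ennreal (norm (g x)) \<partial>\<nu>) < \<infinity>" .
qed

lemma integral_le_measure:
  fixes g :: "'a \<Rightarrow> real"
  assumes "sets \<nu> = sets \<mu>" "\<nu> \<le> \<mu>" "integrable \<mu> g" "\<And>x. 0 \<le> g x"
  shows "(\<integral>x. g x \<partial>\<nu>) \<le> (\<integral>x. g x \<partial>\<mu>)"
proof -
  have "ennreal (\<integral>x. g x \<partial>\<nu>) = (\<integral>\<^sup>+x. ennreal (g x) \<partial>\<nu>)"
    using assms by (intro nn_integral_eq_integral[symmetric] integrable_le_measure[OF assms(1-3)]) auto
  also have "\<dots> \<le> (\<integral>\<^sup>+x. ennreal (g x) \<partial>\<mu>)"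
    by (rule nn_integral_mono_measure[OF assms(1,2)])
  also have "\<dots> = ennreal (\<integral>x. g x \<partial>\<mu>)"
    using assms by (intro nn_integral_eq_integral) auto
  finally show ?thesis using assms(4) by (simp add: ennreal_le_iff integral_nonneg)
qed

lemma AE_le_measure:
  assumes "sets \<nu> = sets \<mu>" "\<nu> \<le> \<mu>" "AE x in \<mu>. P x"
  shows "AE x in \<nu>. P x"
proof (rule absolutely_continuous_AE[OF assms(1) _ assms(3)])
  show "absolutely_continuous \<mu> \<nu>"
    unfolding absolutely_continuous_def null_sets_def
    using assms le_measureD3[OF assms(2) assms(1)] by (auto simp: le_zero_eq) (metis le_zero_eq)
qed

lemma density_indicator_le_measure:
  assumes "B \<in> sets \<mu>"
  shows "density \<mu> (indicator B) \<le> \<mu>"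
proof -
  have "emeasure (density \<mu> (indicator B)) A \<le> emeasure \<mu> A" if "A \<in> sets \<mu>" for A
    using that assms by (simp add: emeasure_density nn_integral_set_ennreal[symmetric] indicator_inter_arith[symmetric] emeasure_mono)
  then show ?thesis by (subst le_measure) auto
qed

text \<open>The restriction of \<open>\<mu>\<close> to the set where the inequality fails is itself
  an admissible \<open>\<nu>\<close>. This turns estimates integrated against every measure below
  \<open>\<pi>\<close> into pointwise ones, which can then be integrated against the laws.\<close>

lemma AE_le_if_integral_le_le_measure:
  fixes a b :: "'a \<Rightarrow> real"
  assumes [measurable]: "integrable \<mu> a" "integrable \<mu> b"
    and le: "\<And>\<nu>. sets \<nu> = sets \<mu> \<Longrightarrow> \<nu> \<le> \<mu> \<Longrightarrow> (\<integral>x. a x \<partial>\<nu>) \<le> (\<integral>x. b x \<partial>\<nu>)"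
  shows "AE x in \<mu>. a x \<le> b x"
proof -
  define B where "B = {x\<in>space \<mu>. b x < a x}"
  have B[measurable]: "B \<in> sets \<mu>" unfolding B_def by measurable
  let ?\<nu> = "density \<mu> (indicator B)"
  have D: "(\<integral>x. g x \<partial>?\<nu>) = (\<integral>x. indicator B x * g x \<partial>\<mu>)" if [measurable]: "g \<in> borel_measurable \<mu>" for g :: "'a \<Rightarrow> real"
    using integral_density[of g \<mu> "indicator B"] by (simp add: ennreal_indicator)
  have int: "integrable \<mu> (\<lambda>x. indicator B x * (a x - b x))"
    using integrable_mult_indicator[OF B, of "\<lambda>x. a x - b x"] assms(1,2) by simp
  have i2: "integrable \<mu> (\<lambda>x. indicator B x * a x)" "integrable \<mu> (\<lambda>x. indicator B x * b x)"
    using integrable_mult_indicator[OF B, of a] integrable_mult_indicator[OF B, of b] assms(1,2) by simp_all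
  have "(\<integral>x. a x \<partial>?\<nu>) \<le> (\<integral>x. b x \<partial>?\<nu>)"
    using density_indicator_le_measure[OF B] by (intro le) auto
  then have "(\<integral>x. indicator B x * (a x - b x) \<partial>\<mu>) \<le> 0"
    using i2 by (simp add: D right_diff_distrib)
  moreover have "0 \<le> (\<integral>x. indicator B x * (a x - b x) \<partial>\<mu>)"
    by (intro integral_nonneg_AE) (auto simp: B_def indicator_def)
  ultimately have "(\<integral>x. indicator B x * (a x - b x) \<partial>\<mu>) = 0" by simp
  then have "AE x in \<mu>. indicator B x * (a x - b x) = 0"
    using int by (subst (asm) integral_nonneg_eq_0_iff_AE) (auto simp: B_def indicator_def)
  then show ?thesis
    by (rule AE_mp) (auto simp: B_def indicator_def split: if_splits)
qed

subsection \<open>Bounded functions under a probability measure\<close>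

lemma (in prob_space) integrable_bounded:
  fixes f :: "'a \<Rightarrow> real"
  assumes "f \<in> borel_measurable M" "\<And>x. x \<in> space M \<Longrightarrow> \<bar>f x\<bar> \<le> C"
  shows "integrable M f"
  using assms by (intro integrable_const_bound[of _ C]) auto

text \<open>The square has Lipschitz constant \<open>2 * C\<close> on \<open>[-C, C]\<close>; this
  is spent once on the second moments and once on the squared means. Variances of uniformly bounded
  functions are thereby continuous for L1 convergence.\<close>

lemma (in prob_space) variance_diff_le:
  fixes f g :: "'a \<Rightarrow> real"
  assumes [measurable]: "f \<in> borel_measurable M" "g \<in> borel_measurable M"
    and f: "\<And>x. x \<in> space M \<Longrightarrow> \<bar>f x\<bar> \<le> C" and g: "\<And>x. x \<in> space M \<Longrightarrow> \<bar>g x\<bar> \<le> C"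
  shows "\<bar>variance f - variance g\<bar> \<le> 4 * C * expectation (\<lambda>x. \<bar>f x - g x\<bar>)"
proof -
  obtain x0 where x0: "x0 \<in> space M" using not_empty by auto
  have C: "0 \<le> C" using f[OF x0] by linarith
  have if1: "integrable M f" "integrable M g" using integrable_bounded[OF assms(1) f, simplified] integrable_bounded[OF assms(2) g, simplified] .
  have sq: "\<bar>(f x)\<^sup>2\<bar> \<le> C\<^sup>2" "\<bar>(g x)\<^sup>2\<bar> \<le> C\<^sup>2" if "x \<in> space M" for x
    using f[OF that] g[OF that] C by (auto simp: abs_le_square_iff[symmetric])
  have if2: "integrable M (\<lambda>x. (f x)\<^sup>2)" "integrable M (\<lambda>x. (g x)\<^sup>2)"
    using sq by (auto intro!: integrable_bounded)
  have id: "integrable M (\<lambda>x. \<bar>f x - g x\<bar>)" using if1 by auto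
  have bf: "\<bar>expectation f\<bar> \<le> C" "\<bar>expectation g\<bar> \<le> C"
  proof -
    have *: "\<bar>expectation h\<bar> \<le> C" if "integrable M h" "\<And>x. x \<in> space M \<Longrightarrow> \<bar>h x\<bar> \<le> C" for h
    proof -
      have "\<bar>expectation h\<bar> \<le> expectation (\<lambda>x. \<bar>h x\<bar>)" by (rule integral_abs_bound)
      also have "\<dots> \<le> C" using that by (intro integral_le_const) auto
      finally show ?thesis .
    qed
    show "\<bar>expectation f\<bar> \<le> C" "\<bar>expectation g\<bar> \<le> C" using *[OF if1(1) f] *[OF if1(2) g] by auto
  qed
  have aux: "\<bar>p\<^sup>2 - q\<^sup>2\<bar> \<le> 2 * C * \<bar>p - q\<bar>" if "\<bar>p\<bar> \<le> C" "\<bar>q\<bar> \<le> C" for p q :: real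
  proof -
    have "\<bar>p\<^sup>2 - q\<^sup>2\<bar> = \<bar>p + q\<bar> * \<bar>p - q\<bar>" by (simp add: power2_eq_square square_diff_square_factored abs_mult[symmetric])
    also have "\<dots> \<le> (2 * C) * \<bar>p - q\<bar>" using that by (intro mult_right_mono) auto
    finally show ?thesis .
  qed
  have d: "\<bar>expectation f - expectation g\<bar> \<le> expectation (\<lambda>x. \<bar>f x - g x\<bar>)"
    using if1 integral_abs_bound[of M "\<lambda>x. f x - g x"] by simp
  have "\<bar>expectation (\<lambda>x. (f x)\<^sup>2) - expectation (\<lambda>x. (g x)\<^sup>2)\<bar> \<le> expectation (\<lambda>x. \<bar>(f x)\<^sup>2 - (g x)\<^sup>2\<bar>)"
    using if2 integral_abs_bound[of M "\<lambda>x. (f x)\<^sup>2 - (g x)\<^sup>2"] by simp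
  also have "\<dots> \<le> expectation (\<lambda>x. 2 * C * \<bar>f x - g x\<bar>)"
    using if2 id f g aux by (intro integral_mono) auto
  finally have "\<bar>expectation (\<lambda>x. (f x)\<^sup>2) - expectation (\<lambda>x. (g x)\<^sup>2)\<bar> \<le> 2 * C * expectation (\<lambda>x. \<bar>f x - g x\<bar>)" by simp
  moreover have "\<bar>(expectation f)\<^sup>2 - (expectation g)\<^sup>2\<bar> \<le> 2 * C * expectation (\<lambda>x. \<bar>f x - g x\<bar>)"
    using aux[OF bf] mult_left_mono[OF d, of "2 * C"] C by linarith
  moreover have "variance f = expectation (\<lambda>x. (f x)\<^sup>2) - (expectation f)\<^sup>2"
      "variance g = expectation (\<lambda>x. (g x)\<^sup>2) - (expectation g)\<^sup>2"
    using f g by (auto intro!: variance_eq if1 if2)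
  ultimately show ?thesis by linarith
qed

lemma (in prob_space) integral_abs_le_sqrt:
  fixes z :: "'a \<Rightarrow> real"
  assumes "z \<in> borel_measurable M" and i: "integrable M (\<lambda>x. (z x)\<^sup>2)"
  shows "expectation (\<lambda>x. \<bar>z x\<bar>) \<le> sqrt (expectation (\<lambda>x. (z x)\<^sup>2))"
proof -
  have "integrable M z" by (rule square_integrable_imp_integrable) fact+
  then have j: "integrable M (\<lambda>x. \<bar>z x\<bar>)" by simp
  have "0 \<le> variance (\<lambda>x. \<bar>z x\<bar>)" by (rule Bochner_Integration.integral_nonneg_AE) simp
  then have "(expectation (\<lambda>x. \<bar>z x\<bar>))\<^sup>2 \<le> expectation (\<lambda>x. (z x)\<^sup>2)"
    using i variance_eq[OF j] by simp
  then show ?thesis by (rule real_le_rsqrt)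
qed

text \<open>The density of \<open>\<mu>\<close> may be unbounded, so it is cut at level
  \<open>n\<close>. Below the level the integral costs at most \<open>n\<close> times that under
  \<open>\<pi>\<close>; above it, at most \<open>C * measure \<mu> (T n)\<close>. The sets
  \<open>T n\<close> decrease to the null set where the density is infinite.\<close>

lemma tendsto_integral_absolutely_continuous:
  fixes w :: "'i \<Rightarrow> 'a \<Rightarrow> real"
  assumes "prob_space \<pi>" "prob_space \<mu>" and sets: "sets \<mu> = sets \<pi>" and ac: "absolutely_continuous \<pi> \<mu>"
    and meas: "\<And>i. w i \<in> borel_measurable \<pi>"
    and bound: "\<And>i x. x \<in> space \<pi> \<Longrightarrow> 0 \<le> w i x \<and> w i x \<le> C"
    and lim: "((\<lambda>i. \<integral>x. w i x \<partial>\<pi>) \<longlongrightarrow> 0) F"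
  shows "((\<lambda>i. \<integral>x. w i x \<partial>\<mu>) \<longlongrightarrow> 0) F"
proof -
  interpret pi: prob_space \<pi> by fact
  interpret mu: prob_space \<mu> by fact
  have [measurable_cong]: "sets \<mu> = sets \<pi>" by fact
  note [measurable] = meas
  have sp: "space \<mu> = space \<pi>" using sets by (rule sets_eq_imp_space_eq)
  define \<rho> where "\<rho> = RN_deriv \<pi> \<mu>"
  have [measurable]: "\<rho> \<in> borel_measurable \<pi>" unfolding \<rho>_def by simp
  have dens: "density \<pi> \<rho> = \<mu>" unfolding \<rho>_def by (rule pi.density_RN_deriv[OF ac sets])
  define T where "T n = {x\<in>space \<mu>. ennreal (real n) \<le> \<rho> x}" for n
  have [measurable]: "T n \<in> sets \<mu>" for n unfolding T_def by measurable
  have "(\<Inter>n. T n) = {x\<in>space \<mu>. \<rho> x = \<infinity>}"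
  proof -
    have "\<rho> x = \<infinity>" if "\<forall>n. ennreal (real n) \<le> \<rho> x" for x
    proof (rule ccontr)
      assume "\<rho> x \<noteq> \<infinity>"
      then obtain r where r: "\<rho> x = ennreal r" "0 \<le> r" by (cases "\<rho> x") auto
      obtain n where "r < real n" using reals_Archimedean2 by blast
      then show False using that[rule_format, of n] r by (simp add: ennreal_le_iff)
    qed
    then show ?thesis by (auto simp: T_def)
  qed
  moreover have "AE x in \<mu>. \<rho> x \<noteq> \<infinity>"
  proof (rule absolutely_continuous_AE[OF sets ac])
    show "AE x in \<pi>. \<rho> x \<noteq> \<infinity>"
      unfolding \<rho>_def by (rule pi.RN_deriv_finite[OF mu.sigma_finite_measure_axioms ac sets])
  qed
  ultimately have T0: "measure \<mu> (\<Inter>n. T n) = 0"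
    by (subst mu.prob_eq_0) (auto simp: sp)
  have "(\<lambda>n. measure \<mu> (T n)) \<longlonglongrightarrow> measure \<mu> (\<Inter>n. T n)"
    by (rule mu.finite_Lim_measure_decseq)
       (auto simp: decseq_def T_def elim!: order_trans[rotated] intro!: ennreal_leI)
  then have Tlim: "(\<lambda>n. measure \<mu> (T n)) \<longlonglongrightarrow> 0" using T0 by simp
  have C: "0 \<le> C"
  proof -
    obtain x0 where "x0 \<in> space \<pi>" using pi.not_empty by auto
    then show ?thesis using bound[of x0] by (meson order_trans)
  qed
  have intw: "integrable \<pi> (w i)" "integrable \<mu> (w i)" for i
    using bound by (auto intro!: pi.integrable_bounded[where C=C] mu.integrable_bounded[where C=C] simp: sp abs_of_nonneg)
  have key: "(\<integral>x. w i x \<partial>\<mu>) \<le> real n * (\<integral>x. w i x \<partial>\<pi>) + C * measure \<mu> (T n)" for i n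
  proof -
    have "ennreal (\<integral>x. w i x \<partial>\<mu>) = (\<integral>\<^sup>+x. ennreal (w i x) \<partial>\<mu>)"
      using bound by (intro nn_integral_eq_integral[symmetric] intw) (auto simp: sp)
    also have "\<dots> = (\<integral>\<^sup>+x. ennreal (w i x) * indicator (space \<mu> - T n) x + ennreal (w i x) * indicator (T n) x \<partial>\<mu>)"
      by (intro nn_integral_cong) (auto simp: indicator_def)
    also have "\<dots> = (\<integral>\<^sup>+x. ennreal (w i x) * indicator (space \<mu> - T n) x \<partial>\<mu>) + (\<integral>\<^sup>+x. ennreal (w i x) * indicator (T n) x \<partial>\<mu>)"
      by (intro nn_integral_add) auto
    also have "(\<integral>\<^sup>+x. ennreal (w i x) * indicator (space \<mu> - T n) x \<partial>\<mu>)
        = (\<integral>\<^sup>+x. \<rho> x * (ennreal (w i x) * indicator (space \<mu> - T n) x) \<partial>\<pi>)"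
      by (subst (1) dens[symmetric], subst nn_integral_density) auto
    also have "\<dots> \<le> (\<integral>\<^sup>+x. ennreal (real n) * ennreal (w i x) \<partial>\<pi>)"
      by (intro nn_integral_mono) (auto simp: T_def indicator_def sp intro!: mult_right_mono)
    also have "\<dots> = ennreal (real n * (\<integral>x. w i x \<partial>\<pi>))"
      using bound intw(1)[of i]
      by (subst nn_integral_cmult) (auto simp: nn_integral_eq_integral ennreal_mult integral_nonneg_AE)
    also have "(\<integral>\<^sup>+x. ennreal (w i x) * indicator (T n) x \<partial>\<mu>) \<le> (\<integral>\<^sup>+x. ennreal C * indicator (T n) x \<partial>\<mu>)"
      using bound by (intro nn_integral_mono mult_right_mono) (auto simp: sp intro!: ennreal_leI)
    also have "\<dots> = ennreal (C * measure \<mu> (T n))"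
      using C by (subst nn_integral_cmult_indicator) (auto simp: mu.emeasure_eq_measure ennreal_mult)
    finally have "ennreal (\<integral>x. w i x \<partial>\<mu>) \<le> ennreal (real n * (\<integral>x. w i x \<partial>\<pi>)) + ennreal (C * measure \<mu> (T n))"
      by (simp add: add_mono)
    also have "\<dots> = ennreal (real n * (\<integral>x. w i x \<partial>\<pi>) + C * measure \<mu> (T n))"
      using C bound by (intro ennreal_plus[symmetric]) (auto intro!: mult_nonneg_nonneg integral_nonneg_AE)
    finally show ?thesis
      using C bound by (subst (asm) ennreal_le_iff) (auto intro!: add_nonneg_nonneg mult_nonneg_nonneg integral_nonneg_AE)
  qed
  show ?thesis
  proof (rule tendstoI)
    fix e :: real assume e: "0 < e"
    have "(\<lambda>n. C * measure \<mu> (T n)) \<longlonglongrightarrow> 0" using tendsto_mult_left[OF Tlim, of C] by simp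
    then have "\<forall>\<^sub>F n in sequentially. C * measure \<mu> (T n) < e / 2"
      using e by (intro order_tendstoD) auto
    \<comment> \<open>The level is fixed first, which makes the tail small for all \<open>i\<close>
      at once; only then does \<open>i\<close> run along \<open>F\<close>.\<close>
    then obtain n where n: "C * measure \<mu> (T n) < e / 2" by (auto simp: eventually_sequentially)
    have "((\<lambda>i. real n * (\<integral>x. w i x \<partial>\<pi>)) \<longlongrightarrow> 0) F" using tendsto_mult_left[OF lim, of "real n"] by simp
    then have "\<forall>\<^sub>F i in F. real n * (\<integral>x. w i x \<partial>\<pi>) < e / 2"
      using e by (intro order_tendstoD) auto
    then show "\<forall>\<^sub>F i in F. dist (\<integral>x. w i x \<partial>\<mu>) 0 < e"
    proof eventually_elim
      case (elim i)
      have "0 \<le> (\<integral>x. w i x \<partial>\<mu>)" using bound by (intro integral_nonneg_AE) (auto simp: sp)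
      then show ?case using key[of i n] elim n by simp
    qed
  qed
qed

subsection \<open>Total variation distance\<close>

lemma tv_dist_bdd_above:
  assumes "prob_space \<mu>" "prob_space \<nu>"
  shows "bdd_above ((\<lambda>A. \<bar>measure \<mu> A - measure \<nu> A\<bar>) ` sets \<mu>)"
proof (rule bdd_aboveI2)
  fix A
  have "0 \<le> measure \<mu> A" "measure \<mu> A \<le> 1" "0 \<le> measure \<nu> A" "measure \<nu> A \<le> 1"
    using assms by (auto simp: prob_space.prob_le_1)
  then show "\<bar>measure \<mu> A - measure \<nu> A\<bar> \<le> 1" by linarith
qed

lemma measure_diff_le_tv_dist:
  assumes "prob_space \<mu>" "prob_space \<nu>" "A \<in> sets \<mu>"
  shows "\<bar>measure \<mu> A - measure \<nu> A\<bar> \<le> tv_dist \<mu> \<nu>"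
  unfolding tv_dist_def by (rule cSUP_upper[OF assms(3) tv_dist_bdd_above[OF assms(1,2)]])

lemma tv_dist_le_iff:
  assumes "prob_space \<mu>" "prob_space \<nu>"
  shows "tv_dist \<mu> \<nu> \<le> c \<longleftrightarrow> (\<forall>A\<in>sets \<mu>. \<bar>measure \<mu> A - measure \<nu> A\<bar> \<le> c)"
  unfolding tv_dist_def using tv_dist_bdd_above[OF assms] sets.empty_sets[of \<mu>]
  by (subst cSUP_le_iff) auto

text \<open>The setwise comparison on either side of the decomposition is an order between
  restricted measures, and integrals of nonnegative functions respect it. Writing the complement as
  \<open>1 - indicator Y\<close> lets the two sides be recombined by linearity alone.\<close>

lemma Hahn_decomposition_integral:
  assumes "finite_measure \<mu>" "finite_measure \<nu>" and sets: "sets \<nu> = sets \<mu>"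
  obtains Y where "Y \<in> sets \<mu>"
    "\<And>w::'a \<Rightarrow> real. integrable \<mu> w \<Longrightarrow> integrable \<nu> w \<Longrightarrow> (\<And>x. 0 \<le> w x) \<Longrightarrow>
        (\<integral>x. indicator Y x * w x \<partial>\<nu>) \<le> (\<integral>x. indicator Y x * w x \<partial>\<mu>)"
    "\<And>w::'a \<Rightarrow> real. integrable \<mu> w \<Longrightarrow> integrable \<nu> w \<Longrightarrow> (\<And>x. 0 \<le> w x) \<Longrightarrow>
        (\<integral>x. (1 - indicator Y x) * w x \<partial>\<mu>) \<le> (\<integral>x. (1 - indicator Y x) * w x \<partial>\<nu>)"
proof -
  obtain Y where Y: "Y \<in> sets \<mu>" and le: "\<And>X. X \<in> sets \<mu> \<Longrightarrow> X \<subseteq> Y \<Longrightarrow> emeasure \<nu> X \<le> emeasure \<mu> X"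
      and ge: "\<And>X. X \<in> sets \<mu> \<Longrightarrow> X \<inter> Y = {} \<Longrightarrow> emeasure \<mu> X \<le> emeasure \<nu> X"
    using finite_unsigned_Hahn_decomposition[OF assms] by metis
  have Y': "Y \<in> sets \<nu>" using Y sets by simp
  have sp: "space \<nu> = space \<mu>" using sets by (rule sets_eq_imp_space_eq)
  \<comment> \<open>Stated for a generic pair, since it serves for \<open>\<nu>\<close>,
    \<open>\<mu>\<close> on \<open>Y\<close> and then for \<open>\<mu>\<close>, \<open>\<nu>\<close>
    on the complement.\<close>
  have main: "(\<integral>x. indicator Z x * w x \<partial>\<alpha>) \<le> (\<integral>x. indicator Z x * w x \<partial>\<beta>)"
    if s: "sets \<alpha> = sets \<beta>" and Z: "Z \<in> sets \<beta>" and c: "\<And>X. X \<in> sets \<beta> \<Longrightarrow> X \<subseteq> Z \<Longrightarrow> emeasure \<alpha> X \<le> emeasure \<beta> X"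
      and w: "integrable \<alpha> w" "integrable \<beta> w" "\<And>x. 0 \<le> w x" for \<alpha> \<beta> Z and w :: "'a \<Rightarrow> real"
  proof -
    have Z': "Z \<in> sets \<alpha>" using Z s by simp
    have D: "(\<integral>x. w x \<partial>density \<gamma> (indicator Z)) = (\<integral>x. indicator Z x * w x \<partial>\<gamma>)"
      if "integrable \<gamma> w" "Z \<in> sets \<gamma>" for \<gamma>
      using integral_density[of w \<gamma> "indicator Z"] that by (simp add: ennreal_indicator)
    have I: "integrable (density \<beta> (indicator Z)) w"
      using w(2) Z integrable_density[of w \<beta> "indicator Z"] integrable_mult_indicator[OF Z w(2)] by (simp add: ennreal_indicator)
    have "emeasure (density \<alpha> (indicator Z)) A \<le> emeasure (density \<beta> (indicator Z)) A" if "A \<in> sets \<alpha>" for A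
      using that c[of "Z \<inter> A"] Z Z' s
      by (simp add: emeasure_density indicator_inter_arith[symmetric])
    then have "density \<alpha> (indicator Z) \<le> density \<beta> (indicator Z)"
      by (subst le_measure) (auto simp: s)
    then have "(\<integral>x. w x \<partial>density \<alpha> (indicator Z)) \<le> (\<integral>x. w x \<partial>density \<beta> (indicator Z))"
      using w by (intro integral_le_measure I) (auto simp: s)
    then show ?thesis using D w Z Z' by simp
  qed
  have cmp: "(\<integral>x. (1 - indicator Y x) * w x \<partial>\<gamma>) = (\<integral>x. indicator (space \<mu> - Y) x * w x \<partial>\<gamma>)"
    if "space \<gamma> = space \<mu>" for \<gamma> and w :: "'a \<Rightarrow> real"
    by (rule Bochner_Integration.integral_cong) (auto simp: indicator_def that)
  show thesis
  proof (rule that[OF Y])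
    fix w :: "'a \<Rightarrow> real" assume w: "integrable \<mu> w" "integrable \<nu> w" "\<And>x. 0 \<le> w x"
    show "(\<integral>x. indicator Y x * w x \<partial>\<nu>) \<le> (\<integral>x. indicator Y x * w x \<partial>\<mu>)"
      using w le by (intro main) (auto simp: sets Y)
    show "(\<integral>x. (1 - indicator Y x) * w x \<partial>\<mu>) \<le> (\<integral>x. (1 - indicator Y x) * w x \<partial>\<nu>)"
      unfolding cmp[OF refl] cmp[OF sp]
      using w ge by (intro main) (auto simp: sets Y)
  qed
qed

text \<open>The Hahn set \<open>Y\<close> is extremal: comparing the integrals of
  \<open>1 - f\<close> on \<open>Y\<close> and of \<open>f\<close> off \<open>Y\<close> bounds the
  difference by \<open>measure \<mu> Y - measure \<nu> Y\<close>.\<close>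

lemma integral_diff_le_tv_dist:
  fixes g :: "'a \<Rightarrow> real"
  assumes "prob_space \<mu>" "prob_space \<nu>" and sets: "sets \<nu> = sets \<mu>"
    and [measurable]: "g \<in> borel_measurable \<mu>" and g: "\<And>x. x \<in> space \<mu> \<Longrightarrow> 0 \<le> g x \<and> g x \<le> 1"
  shows "(\<integral>x. g x \<partial>\<mu>) - (\<integral>x. g x \<partial>\<nu>) \<le> tv_dist \<mu> \<nu>"
proof -
  interpret mu: prob_space \<mu> by fact
  interpret nu: prob_space \<nu> by fact
  have [measurable_cong]: "sets \<nu> = sets \<mu>" by fact
  have sp: "space \<nu> = space \<mu>" using sets by (rule sets_eq_imp_space_eq)
  \<comment> \<open>Clipping gives bounds at every point, as the Hahn comparison asks for
    nonnegativity outside the space too.\<close>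
  define f where "f x = min 1 (max 0 (g x))" for x
  have [measurable]: "f \<in> borel_measurable \<mu>" unfolding f_def by measurable
  have f: "0 \<le> f x" "f x \<le> 1" for x unfolding f_def by auto
  have fg: "(\<integral>x. g x \<partial>\<mu>) = (\<integral>x. f x \<partial>\<mu>)" "(\<integral>x. g x \<partial>\<nu>) = (\<integral>x. f x \<partial>\<nu>)"
    using g by (auto intro!: Bochner_Integration.integral_cong simp: f_def sp)
  obtain Y where Y[measurable]: "Y \<in> sets \<mu>" and
    1: "\<And>w::'a \<Rightarrow> real. integrable \<mu> w \<Longrightarrow> integrable \<nu> w \<Longrightarrow> (\<And>x. 0 \<le> w x) \<Longrightarrow>
        (\<integral>x. indicator Y x * w x \<partial>\<nu>) \<le> (\<integral>x. indicator Y x * w x \<partial>\<mu>)" and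
    2: "\<And>w::'a \<Rightarrow> real. integrable \<mu> w \<Longrightarrow> integrable \<nu> w \<Longrightarrow> (\<And>x. 0 \<le> w x) \<Longrightarrow>
        (\<integral>x. (1 - indicator Y x) * w x \<partial>\<mu>) \<le> (\<integral>x. (1 - indicator Y x) * w x \<partial>\<nu>)"
    using Hahn_decomposition_integral[OF mu.finite_measure_axioms nu.finite_measure_axioms sets] by blast
  have int: "integrable \<gamma> f" "integrable \<gamma> (\<lambda>x. 1 - f x)" "integrable \<gamma> (\<lambda>x. indicator Y x * f x)"
      "integrable \<gamma> (\<lambda>x. indicator Y x :: real)" if "prob_space \<gamma>" "sets \<gamma> = sets \<mu>" for \<gamma>
  proof -
    interpret g: prob_space \<gamma> by fact
    have [measurable_cong]: "sets \<gamma> = sets \<mu>" by fact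
    show "integrable \<gamma> (\<lambda>x. indicator Y x :: real)"
      using Y that(2) by (intro integrable_real_indicator) (auto simp: g.emeasure_eq_measure)
    show "integrable \<gamma> f" "integrable \<gamma> (\<lambda>x. 1 - f x)" "integrable \<gamma> (\<lambda>x. indicator Y x * f x)"
      using f by (auto intro!: g.integrable_const_bound[where B=1] AE_I2 simp: abs_mult mult_le_one split: split_indicator)
  qed
  note imu = int[OF mu.prob_space_axioms refl] and inu = int[OF nu.prob_space_axioms sets]
  have "(\<integral>x. indicator Y x * (1 - f x) \<partial>\<nu>) \<le> (\<integral>x. indicator Y x * (1 - f x) \<partial>\<mu>)"
    using imu inu f by (intro 1) auto
  then have a: "measure \<nu> Y - (\<integral>x. indicator Y x * f x \<partial>\<nu>) \<le> measure \<mu> Y - (\<integral>x. indicator Y x * f x \<partial>\<mu>)"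
    using imu inu by (simp add: right_diff_distrib sets)
  have "(\<integral>x. (1 - indicator Y x) * f x \<partial>\<mu>) \<le> (\<integral>x. (1 - indicator Y x) * f x \<partial>\<nu>)"
    using imu inu f by (intro 2) auto
  then have "(\<integral>x. f x \<partial>\<mu>) - (\<integral>x. indicator Y x * f x \<partial>\<mu>) \<le> (\<integral>x. f x \<partial>\<nu>) - (\<integral>x. indicator Y x * f x \<partial>\<nu>)"
    using imu inu by (simp add: left_diff_distrib)
  with a have "(\<integral>x. f x \<partial>\<mu>) - (\<integral>x. f x \<partial>\<nu>) \<le> measure \<mu> Y - measure \<nu> Y" by linarith
  also have "\<dots> \<le> tv_dist \<mu> \<nu>"
    using measure_diff_le_tv_dist[OF assms(1,2) Y] by linarith
  finally show ?thesis unfolding fg .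
qed

lemma abs_integral_diff_le_tv_dist:
  fixes g :: "'a \<Rightarrow> real"
  assumes "prob_space \<mu>" "prob_space \<nu>" and sets: "sets \<nu> = sets \<mu>"
    and [measurable]: "g \<in> borel_measurable \<mu>" and g: "\<And>x. x \<in> space \<mu> \<Longrightarrow> 0 \<le> g x \<and> g x \<le> 1"
  shows "\<bar>(\<integral>x. g x \<partial>\<mu>) - (\<integral>x. g x \<partial>\<nu>)\<bar> \<le> tv_dist \<mu> \<nu>"
proof -
  interpret mu: prob_space \<mu> by fact
  interpret nu: prob_space \<nu> by fact
  have [measurable_cong]: "sets \<nu> = sets \<mu>" by fact
  have sp: "space \<nu> = space \<mu>" using sets by (rule sets_eq_imp_space_eq)
  have "integrable \<mu> g" "integrable \<nu> g"
    using g by (auto intro!: mu.integrable_bounded[where C=1] nu.integrable_bounded[where C=1] simp: sp)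
  moreover have "(\<integral>x. 1 - g x \<partial>\<mu>) - (\<integral>x. 1 - g x \<partial>\<nu>) \<le> tv_dist \<mu> \<nu>"
    using g by (intro integral_diff_le_tv_dist assms) auto
  ultimately show ?thesis
    using integral_diff_le_tv_dist[OF assms] by (simp add: mu.prob_space nu.prob_space)
qed

lemma abs_integral_diff_le_tv_dist_bounded:
  fixes g :: "'a \<Rightarrow> real"
  assumes "prob_space \<mu>" "prob_space \<nu>" and sets: "sets \<nu> = sets \<mu>"
    and [measurable]: "g \<in> borel_measurable \<mu>" and g: "\<And>x. x \<in> space \<mu> \<Longrightarrow> \<bar>g x\<bar> \<le> C" and C: "0 < C"
  shows "\<bar>(\<integral>x. g x \<partial>\<mu>) - (\<integral>x. g x \<partial>\<nu>)\<bar> \<le> 2 * C * tv_dist \<mu> \<nu>"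
proof -
  interpret mu: prob_space \<mu> by fact
  interpret nu: prob_space \<nu> by fact
  have [measurable_cong]: "sets \<nu> = sets \<mu>" by fact
  have sp: "space \<nu> = space \<mu>" using sets by (rule sets_eq_imp_space_eq)
  have int: "integrable \<mu> g" "integrable \<nu> g"
    using g by (auto intro!: mu.integrable_bounded[where C=C] nu.integrable_bounded[where C=C] simp: sp)
  have "\<bar>(\<integral>x. (g x + C) / (2 * C) \<partial>\<mu>) - (\<integral>x. (g x + C) / (2 * C) \<partial>\<nu>)\<bar> \<le> tv_dist \<mu> \<nu>"
  proof (rule abs_integral_diff_le_tv_dist[OF assms(1-3)])
    fix x assume "x \<in> space \<mu>"
    from g[OF this] C show "0 \<le> (g x + C) / (2 * C) \<and> (g x + C) / (2 * C) \<le> 1"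
      by (simp add: abs_le_iff divide_simps)
  qed measurable
  moreover have "(\<integral>x. (g x + C) / (2 * C) \<partial>\<mu>) - (\<integral>x. (g x + C) / (2 * C) \<partial>\<nu>) = ((\<integral>x. g x \<partial>\<mu>) - (\<integral>x. g x \<partial>\<nu>)) / (2 * C)"
    using int by (simp add: mu.prob_space nu.prob_space diff_divide_distrib[symmetric])
  ultimately show ?thesis using C by (simp add: abs_mult field_simps)
qed

text \<open>The measure equal to the smaller one of \<open>\<mu>\<close> and \<open>\<nu>\<close> on each side of a Hahn decomposition has
  mass at least \<open>1 - tv_dist \<mu> \<nu>\<close>, and \<open>g\<close> is close to both \<open>a\<close> and \<open>b\<close> in its \<open>L\<^sup>2\<close> norm.\<close>

lemma square_diff_le_of_overlap:
  fixes g :: "'a \<Rightarrow> real"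
  assumes "prob_space \<mu>" "prob_space \<nu>" and sets: "sets \<nu> = sets \<mu>"
    and [measurable]: "g \<in> borel_measurable \<mu>" and g: "\<And>x. x \<in> space \<mu> \<Longrightarrow> \<bar>g x\<bar> \<le> C"
    and tv: "tv_dist \<mu> \<nu> \<le> 1 - e"
  shows "e * (a - b)\<^sup>2 \<le> 2 * (\<integral>x. (g x - a)\<^sup>2 \<partial>\<mu>) + 2 * (\<integral>x. (g x - b)\<^sup>2 \<partial>\<nu>)"
proof -
  interpret mu: prob_space \<mu> by fact
  interpret nu: prob_space \<nu> by fact
  have [measurable_cong]: "sets \<nu> = sets \<mu>" by fact
  have sp: "space \<nu> = space \<mu>" using sets by (rule sets_eq_imp_space_eq)
  obtain Y where Y[measurable]: "Y \<in> sets \<mu>" and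
    1: "\<And>w::'a \<Rightarrow> real. integrable \<mu> w \<Longrightarrow> integrable \<nu> w \<Longrightarrow> (\<And>x. 0 \<le> w x) \<Longrightarrow>
        (\<integral>x. indicator Y x * w x \<partial>\<nu>) \<le> (\<integral>x. indicator Y x * w x \<partial>\<mu>)" and
    2: "\<And>w::'a \<Rightarrow> real. integrable \<mu> w \<Longrightarrow> integrable \<nu> w \<Longrightarrow> (\<And>x. 0 \<le> w x) \<Longrightarrow>
        (\<integral>x. (1 - indicator Y x) * w x \<partial>\<mu>) \<le> (\<integral>x. (1 - indicator Y x) * w x \<partial>\<nu>)"
    using Hahn_decomposition_integral[OF mu.finite_measure_axioms nu.finite_measure_axioms sets] by blast
  define u where "u x = (g x - a)\<^sup>2" for x
  define v where "v x = (g x - b)\<^sup>2" for x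
  have [measurable]: "u \<in> borel_measurable \<mu>" "v \<in> borel_measurable \<mu>" unfolding u_def v_def by measurable
  have uv: "0 \<le> u x" "0 \<le> v x" for x unfolding u_def v_def by auto
  have bd: "\<bar>(g x - c)\<^sup>2\<bar> \<le> (C + \<bar>c\<bar>)\<^sup>2" if "x \<in> space \<mu>" for x c
    using g[OF that] by (simp add: abs_le_square_iff[symmetric])
  have iu: "integrable \<mu> u" "integrable \<nu> u"
    using bd[of _ a] by (auto intro!: mu.integrable_bounded nu.integrable_bounded simp: sp u_def)
  have iv: "integrable \<mu> v" "integrable \<nu> v"
    using bd[of _ b] by (auto intro!: mu.integrable_bounded nu.integrable_bounded simp: sp v_def)
  have le: "(a - b)\<^sup>2 \<le> 2 * u x + 2 * v x" for x
  proof -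
    have "0 \<le> ((g x - a) + (g x - b))\<^sup>2" by simp
    then show ?thesis unfolding u_def v_def by (simp add: power2_eq_square algebra_simps)
  qed
  have Yn: "Y \<in> sets \<nu>" using Y sets by simp
  have I: "integrable \<gamma> (\<lambda>x. indicator Y x * w x)" "integrable \<gamma> (\<lambda>x. (1 - indicator Y x) * w x)"
    if "integrable \<gamma> w" "Y \<in> sets \<gamma>" for \<gamma> and w :: "'a \<Rightarrow> real"
    using integrable_mult_indicator[OF that(2,1)] that by (simp_all add: left_diff_distrib)
  \<comment> \<open>The right-hand side is the total mass of the smaller measure,
    \<open>\<nu>\<close> on \<open>Y\<close> and \<open>\<mu>\<close> off it.\<close>
  have "e \<le> measure \<nu> Y + (1 - measure \<mu> Y)"
    using measure_diff_le_tv_dist[OF assms(1,2) Y] tv by linarith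
  then have "e * (a - b)\<^sup>2 \<le> (measure \<nu> Y + (1 - measure \<mu> Y)) * (a - b)\<^sup>2"
    by (intro mult_right_mono) auto
  also have "\<dots> = (\<integral>x. indicator Y x * (a - b)\<^sup>2 \<partial>\<nu>) + (\<integral>x. (1 - indicator Y x) * (a - b)\<^sup>2 \<partial>\<mu>)"
  proof -
    have "(\<integral>x. 1 - indicator Y x \<partial>\<mu>) = 1 - measure \<mu> Y"
      using Y by (subst Bochner_Integration.integral_diff) (auto simp: mu.prob_space mu.emeasure_eq_measure)
    then show ?thesis by (simp add: Yn distrib_right)
  qed
  also have "\<dots> \<le> (\<integral>x. indicator Y x * (2 * u x + 2 * v x) \<partial>\<nu>) + (\<integral>x. (1 - indicator Y x) * (2 * u x + 2 * v x) \<partial>\<mu>)"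
    using iu iv le Y Yn
    by (intro add_mono integral_mono I) (auto intro!: mult_left_mono simp: indicator_def)
  also have "\<dots> = 2 * (\<integral>x. indicator Y x * u x \<partial>\<nu>) + 2 * (\<integral>x. indicator Y x * v x \<partial>\<nu>)
      + 2 * (\<integral>x. (1 - indicator Y x) * u x \<partial>\<mu>) + 2 * (\<integral>x. (1 - indicator Y x) * v x \<partial>\<mu>)"
    using I[OF iu(1) Y] I[OF iv(1) Y] I[OF iu(2) Yn] I[OF iv(2) Yn]
    by (simp add: distrib_left mult.left_commute[of _ 2])
  \<comment> \<open>Two of the four terms change measure, each towards the larger one:
    \<open>u\<close> on \<open>Y\<close> and \<open>v\<close> off \<open>Y\<close>. Afterwards
    \<open>u\<close> is integrated against \<open>\<mu>\<close> everywhere and \<open>v\<close>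
    against \<open>\<nu>\<close> everywhere.\<close>
  also have "\<dots> \<le> 2 * (\<integral>x. indicator Y x * u x \<partial>\<mu>) + 2 * (\<integral>x. indicator Y x * v x \<partial>\<nu>)
      + 2 * (\<integral>x. (1 - indicator Y x) * u x \<partial>\<mu>) + 2 * (\<integral>x. (1 - indicator Y x) * v x \<partial>\<nu>)"
    using 1[OF iu uv(1)] 2[OF iv uv(2)] by linarith
  also have "\<dots> = 2 * (\<integral>x. u x \<partial>\<mu>) + 2 * (\<integral>x. v x \<partial>\<nu>)"
    using I(1)[OF iu(1) Y] I(1)[OF iv(2) Yn] iu iv by (simp add: left_diff_distrib)
  finally show ?thesis unfolding u_def v_def .
qed

subsection \<open>The semigroup\<close>

context markov_process
begin

abbreviation sg :: "real \<Rightarrow> ('a \<Rightarrow> real) \<Rightarrow> 'a \<Rightarrow> real" where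
  "sg \<equiv> semigroup_op K"

lemma kernel_subprob [measurable]: "0 \<le> t \<Longrightarrow> K t \<in> E \<rightarrow>\<^sub>M subprob_algebra E"
  using kernel by (rule measurable_prob_algebraD)

lemma kernel_props:
  assumes "0 \<le> t" "x \<in> space E"
  shows "prob_space (K t x)" "sets (K t x) = sets E" "space (K t x) = space E"
  using measurable_space[OF kernel[OF assms(1)] assms(2)]
  by (auto simp: space_prob_algebra dest: sets_eq_imp_space_eq)

lemma sg_measurable [measurable]:
  assumes "0 \<le> t" and [measurable]: "f \<in> borel_measurable E"
  shows "sg t f \<in> borel_measurable E"
  unfolding semigroup_op_def
  by (rule measurable_compose[OF kernel_subprob[OF assms(1)] integral_measurable_subprob_algebra]) fact

lemma space_E_nonempty: "space E \<noteq> {}"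
  using measurable_space[OF random_variable_X[of 0]] not_empty by auto

section \<open>Measures transported by the kernels\<close>

context
  fixes \<nu> :: "'a measure"
  assumes sets_nu: "sets \<nu> = sets E"
begin

lemma space_nu: "space \<nu> = space E"
  using sets_nu by (rule sets_eq_imp_space_eq)

lemma kernel_nu: "0 \<le> t \<Longrightarrow> K t \<in> \<nu> \<rightarrow>\<^sub>M subprob_algebra E"
  using kernel_subprob by (simp add: measurable_cong_sets[OF sets_nu refl])

lemma sets_bind_kernel: "0 \<le> t \<Longrightarrow> sets (\<nu> \<bind> K t) = sets E"
  using sets_bind_measurable[OF kernel_nu] space_nu space_E_nonempty by auto

lemma bind_kernel_0: "\<nu> \<bind> K 0 = \<nu>"
proof -
  have "\<nu> \<bind> K 0 = \<nu> \<bind> return E"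
    by (rule bind_cong) (auto simp: space_nu kernel_0)
  also have "\<dots> = \<nu>" by (rule bind_return''[OF sets_nu])
  finally show ?thesis .
qed

lemma bind_kernel_bind:
  assumes "0 \<le> s" "0 \<le> t"
  shows "(\<nu> \<bind> K s) \<bind> K t = \<nu> \<bind> K (s + t)"
proof -
  have "(\<nu> \<bind> K s) \<bind> K t = \<nu> \<bind> (\<lambda>x. K s x \<bind> K t)"
    by (rule bind_assoc[OF kernel_nu kernel_subprob]) fact+
  also have "\<dots> = \<nu> \<bind> K (s + t)"
    by (rule bind_cong) (auto simp: space_nu chapman_kolmogorov assms)
  finally show ?thesis .
qed

lemma prob_space_bind_kernel:
  assumes "prob_space \<nu>" "0 \<le> t"
  shows "prob_space (\<nu> \<bind> K t)"
  using assms sets_nu by (intro prob_space_bind'[OF _ kernel]) (auto simp: space_prob_algebra)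

lemma nn_integral_bind_kernel:
  assumes "0 \<le> t" "f \<in> borel_measurable E"
  shows "(\<integral>\<^sup>+x. f x \<partial>(\<nu> \<bind> K t)) = (\<integral>\<^sup>+x. \<integral>\<^sup>+y. f y \<partial>K t x \<partial>\<nu>)"
  by (rule nn_integral_bind[OF assms(2) kernel_nu[OF assms(1)]])

text \<open>The formula for the bind is applied to the positive and negative parts in
  \<open>[0,\<infinity>]\<close>. Both inner integrals \<open>p\<close> and \<open>n\<close> are
  finite \<open>\<nu>\<close>-almost everywhere; at the remaining points \<open>f\<close> is not
  integrable for the kernel and \<open>sg t f\<close> takes the default value 0, hence the detour
  through \<open>eq\<close>. The generality matters for \<open>Gamma\<close>, which is known to be
  integrable but not bounded.\<close>

lemma integral_sg:
  assumes t: "0 \<le> t" and f: "integrable (\<nu> \<bind> K t) f"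
  shows "integrable \<nu> (sg t f)" "(\<integral>x. sg t f x \<partial>\<nu>) = (\<integral>x. f x \<partial>(\<nu> \<bind> K t))"
proof -
  have [measurable_cong]: "sets \<nu> = sets E" by (rule sets_nu)
  have [measurable]: "f \<in> borel_measurable E"
    using f measurable_cong_sets[OF sets_bind_kernel[OF t] refl] by auto
  note [measurable] = kernel_subprob[OF t]
  define p where "p x = (\<integral>\<^sup>+y. ennreal (f y) \<partial>K t x)" for x
  define n where "n x = (\<integral>\<^sup>+y. ennreal (- f y) \<partial>K t x)" for x
  have [measurable]: "p \<in> borel_measurable E" "n \<in> borel_measurable E"
    unfolding p_def n_def
    by (rule measurable_compose[OF kernel_subprob[OF t] nn_integral_measurable_subprob_algebra], simp)+
  have ip: "(\<integral>\<^sup>+x. p x \<partial>\<nu>) = (\<integral>\<^sup>+x. ennreal (f x) \<partial>(\<nu> \<bind> K t))"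
    unfolding p_def by (rule nn_integral_bind_kernel[symmetric, OF t]) simp
  have i_n: "(\<integral>\<^sup>+x. n x \<partial>\<nu>) = (\<integral>\<^sup>+x. ennreal (- f x) \<partial>(\<nu> \<bind> K t))"
    unfolding n_def by (rule nn_integral_bind_kernel[symmetric, OF t]) simp
  have fin: "(\<integral>\<^sup>+x. p x \<partial>\<nu>) \<noteq> \<infinity>" "(\<integral>\<^sup>+x. n x \<partial>\<nu>) \<noteq> \<infinity>"
    unfolding ip i_n using f by (auto simp: real_integrable_def)
  have "p \<in> borel_measurable \<nu>" "n \<in> borel_measurable \<nu>" by measurable
  then have AEfin: "AE x in \<nu>. p x \<noteq> \<infinity>" "AE x in \<nu>. n x \<noteq> \<infinity>"
    using nn_integral_PInf_AE fin by blast+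
  have eq: "AE x in \<nu>. sg t f x = enn2real (p x) - enn2real (n x)"
  proof (rule AE_mp[OF AEfin(1)], rule AE_mp[OF AEfin(2)], rule AE_I2, intro impI)
    fix x assume x: "x \<in> space \<nu>" "n x \<noteq> \<infinity>" "p x \<noteq> \<infinity>"
    have "integrable (K t x) f"
      using x measurable_cong_sets[OF kernel_props(2)[OF t] refl, of x borel] unfolding real_integrable_def p_def n_def
      by (auto simp: space_nu)
    then show "sg t f x = enn2real (p x) - enn2real (n x)"
      unfolding semigroup_op_def p_def n_def by (rule real_lebesgue_integral_def)
  qed
  have conv: "(\<integral>\<^sup>+x. ennreal (enn2real (h x)) \<partial>\<nu>) = (\<integral>\<^sup>+x. h x \<partial>\<nu>)" if "AE x in \<nu>. h x \<noteq> \<infinity>" for h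
    using that by (intro nn_integral_cong_AE) (auto simp: less_top)
  have ints: "integrable \<nu> (\<lambda>x. enn2real (p x))" "integrable \<nu> (\<lambda>x. enn2real (n x))"
    using conv[OF AEfin(1)] conv[OF AEfin(2)] fin by (auto simp: integrable_iff_bounded less_top)
  show "integrable \<nu> (sg t f)"
    by (subst integrable_cong_AE[OF _ _ eq]) (use ints t in auto)
  have "(\<integral>x. sg t f x \<partial>\<nu>) = (\<integral>x. enn2real (p x) - enn2real (n x) \<partial>\<nu>)"
    using t by (intro integral_cong_AE eq) auto
  also have "\<dots> = (\<integral>x. enn2real (p x) \<partial>\<nu>) - (\<integral>x. enn2real (n x) \<partial>\<nu>)" using ints by simp
  also have "\<dots> = enn2real (\<integral>\<^sup>+x. p x \<partial>\<nu>) - enn2real (\<integral>\<^sup>+x. n x \<partial>\<nu>)"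
    by (simp add: integral_eq_nn_integral conv[OF AEfin(1)] conv[OF AEfin(2)])
  also have "\<dots> = (\<integral>x. f x \<partial>(\<nu> \<bind> K t))"
    unfolding ip i_n by (rule real_lebesgue_integral_def[OF f, symmetric])
  finally show "(\<integral>x. sg t f x \<partial>\<nu>) = (\<integral>x. f x \<partial>(\<nu> \<bind> K t))" .
qed

lemma abs_sg_le: "\<bar>sg t f x\<bar> \<le> sg t (\<lambda>y. \<bar>f y\<bar>) x"
  unfolding semigroup_op_def by (rule integral_abs_bound)

lemma integral_abs_sg_le:
  assumes t: "0 \<le> t" and f: "integrable (\<nu> \<bind> K t) f"
  shows "(\<integral>x. \<bar>sg t f x\<bar> \<partial>\<nu>) \<le> (\<integral>x. \<bar>f x\<bar> \<partial>(\<nu> \<bind> K t))"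
proof -
  have "integrable (\<nu> \<bind> K t) (\<lambda>x. \<bar>f x\<bar>)" using f by simp
  note abs = integral_sg[OF t this]
  have "(\<integral>x. \<bar>sg t f x\<bar> \<partial>\<nu>) \<le> (\<integral>x. sg t (\<lambda>y. \<bar>f y\<bar>) x \<partial>\<nu>)"
    using abs(1) integral_sg(1)[OF t f] by (intro integral_mono abs_sg_le) auto
  then show ?thesis using abs(2) by simp
qed

end

lemma bind_kernel_mono:
  assumes "sets \<nu> = sets E" "sets \<mu> = sets E" "\<nu> \<le> \<mu>" "0 \<le> t"
  shows "\<nu> \<bind> K t \<le> \<mu> \<bind> K t"
proof -
  have "emeasure (\<nu> \<bind> K t) A \<le> emeasure (\<mu> \<bind> K t) A" if A: "A \<in> sets E" for A
  proof -
    have "emeasure (\<nu> \<bind> K t) A = (\<integral>\<^sup>+x. emeasure (K t x) A \<partial>\<nu>)"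
      using A assms(1,4) space_nu[OF assms(1)] space_E_nonempty by (intro emeasure_bind[of _ _ E] kernel_nu) auto
    also have "\<dots> \<le> (\<integral>\<^sup>+x. emeasure (K t x) A \<partial>\<mu>)"
      using assms by (intro nn_integral_mono_measure) auto
    also have "\<dots> = emeasure (\<mu> \<bind> K t) A"
      using A assms(2,4) space_nu[OF assms(2)] space_E_nonempty by (intro emeasure_bind[of _ _ E, symmetric] kernel_nu) auto
    finally show ?thesis .
  qed
  then show ?thesis using assms by (subst le_measure) (auto simp: sets_bind_kernel)
qed

text \<open>At a point where \<open>f\<close> is not integrable for the kernel, the default value 0
  on the left makes the bound trivial. It leads from the semigroup applied to \<open>Gamma\<close>
  back to integrals in \<open>[0,\<infinity>]\<close>.\<close>

lemma ennreal_sg_le: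
  "ennreal (sg t f x) \<le> (\<integral>\<^sup>+y. ennreal (f y) \<partial>K t x)"
proof (cases "integrable (K t x) f")
  case True
  have "ennreal (sg t f x) \<le> ennreal (enn2real (\<integral>\<^sup>+y. ennreal (f y) \<partial>K t x))"
    unfolding semigroup_op_def real_lebesgue_integral_def[OF True] by (intro ennreal_leI) simp
  also have "\<dots> \<le> (\<integral>\<^sup>+y. ennreal (f y) \<partial>K t x)"
    using True by (simp add: real_integrable_def less_top)
  finally show ?thesis .
qed (simp add: semigroup_op_def not_integrable_integral_eq)

lemma ennreal_sg_square_le:
  assumes "0 \<le> t" "x \<in> space E" and f: "f \<in> borel_measurable E"
  shows "ennreal ((sg t f x)\<^sup>2) \<le> (\<integral>\<^sup>+y. ennreal ((f y)\<^sup>2) \<partial>K t x)"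
proof -
  interpret k: prob_space "K t x" by (rule kernel_props) fact+
  have [measurable]: "f \<in> borel_measurable (K t x)"
    using f measurable_cong_sets[OF kernel_props(2)[OF assms(1,2)] refl] by auto
  show ?thesis
  proof (cases "integrable (K t x) (\<lambda>y. (f y)\<^sup>2)")
    case True
    have i: "integrable (K t x) f" by (rule k.square_integrable_imp_integrable[OF _ True]) simp
    have "0 \<le> k.variance f" by (rule Bochner_Integration.integral_nonneg_AE) simp
    then have "(sg t f x)\<^sup>2 \<le> (\<integral>y. (f y)\<^sup>2 \<partial>K t x)"
      unfolding k.variance_eq[OF i True] semigroup_op_def by simp
    then show ?thesis using True by (simp add: nn_integral_eq_integral)
  next
    case False
    then have "(\<integral>\<^sup>+y. ennreal ((f y)\<^sup>2) \<partial>K t x) = \<infinity>"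
      by (auto simp: integrable_iff_bounded less_top[symmetric])
    then show ?thesis by simp
  qed
qed

subsection \<open>Bounded functions\<close>

text \<open>The bound holds at every point of \<open>E\<close> rather than almost everywhere, so all
  kernel integrals exist and the semigroup identities hold pointwise, whatever the measure
  considered.\<close>

definition bounded_fun :: "real \<Rightarrow> ('a \<Rightarrow> real) \<Rightarrow> bool" where
  "bounded_fun C f \<longleftrightarrow> f \<in> borel_measurable E \<and> (\<forall>x\<in>space E. \<bar>f x\<bar> \<le> C)"

lemma bounded_fun_measurable: "bounded_fun C f \<Longrightarrow> f \<in> borel_measurable E"
  by (simp add: bounded_fun_def)

lemma bounded_fun_nonneg: "bounded_fun C f \<Longrightarrow> 0 \<le> C"
  using space_E_nonempty unfolding bounded_fun_def by (metis abs_ge_zero equals0I order_trans)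

lemma integrable_bounded_fun:
  assumes "finite_measure \<nu>" "sets \<nu> = sets E" "bounded_fun C f"
  shows "integrable \<nu> f"
  using assms sets_eq_imp_space_eq[OF assms(2)] measurable_cong_sets[OF assms(2) refl, of borel]
  by (intro finite_measure.integrable_const_bound[OF assms(1), of _ C]) (auto simp: bounded_fun_def)

lemma integrable_kernel_bounded_fun:
  assumes "0 \<le> t" "x \<in> space E" "bounded_fun C f"
  shows "integrable (K t x) f"
  using kernel_props[OF assms(1,2)] assms(3)
  by (auto intro!: integrable_bounded_fun prob_space.finite_measure)

lemma bounded_fun_sg:
  assumes t: "0 \<le> t" and f: "bounded_fun C f"
  shows "bounded_fun C (sg t f)"
  unfolding bounded_fun_def
proof (intro conjI ballI)
  show "sg t f \<in> borel_measurable E" using f by (intro sg_measurable t bounded_fun_measurable)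
  fix x assume x: "x \<in> space E"
  interpret k: prob_space "K t x" by (rule kernel_props) fact+
  have "\<bar>sg t f x\<bar> \<le> (\<integral>y. \<bar>f y\<bar> \<partial>K t x)" unfolding semigroup_op_def by (rule integral_abs_bound)
  also have "\<dots> \<le> C"
    using f integrable_kernel_bounded_fun[OF t x f]
    by (intro k.integral_le_const) (auto simp: bounded_fun_def kernel_props[OF t x])
  finally show "\<bar>sg t f x\<bar> \<le> C" .
qed

lemma bounded_fun_diff:
  "bounded_fun C f \<Longrightarrow> bounded_fun D g \<Longrightarrow> bounded_fun (C + D) (\<lambda>x. f x - g x)"
  unfolding bounded_fun_def by (auto intro: order_trans[OF abs_triangle_ineq4] add_mono)

lemma bounded_fun_square: "bounded_fun C f \<Longrightarrow> bounded_fun (C\<^sup>2) (\<lambda>x. (f x)\<^sup>2)"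
  unfolding bounded_fun_def by (auto simp: abs_le_square_iff[symmetric] intro: order_trans)

lemma bounded_fun_abs: "bounded_fun C f \<Longrightarrow> bounded_fun C (\<lambda>x. \<bar>f x\<bar>)"
  unfolding bounded_fun_def by auto

lemma sg_0: "f \<in> borel_measurable E \<Longrightarrow> x \<in> space E \<Longrightarrow> sg 0 f x = f x"
  by (simp add: semigroup_op_def kernel_0 integral_return)

lemma sg_sg:
  assumes "0 \<le> s" "0 \<le> t" "x \<in> space E" "bounded_fun C f"
  shows "sg s (sg t f) x = sg (s + t) f x"
proof -
  have "(\<integral>y. sg t f y \<partial>K s x) = (\<integral>y. f y \<partial>(K s x \<bind> K t))"
    using assms kernel_props[of s x] prob_space_bind_kernel[of "K s x" t] sets_bind_kernel[of "K s x" t]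
    by (intro integral_sg integrable_bounded_fun[OF prob_space.finite_measure]) auto
  then show ?thesis unfolding semigroup_op_def using chapman_kolmogorov assms by simp
qed

lemma sg_diff:
  assumes "0 \<le> t" "x \<in> space E" "bounded_fun C f" "bounded_fun D g"
  shows "sg t (\<lambda>y. f y - g y) x = sg t f x - sg t g x"
  unfolding semigroup_op_def using assms by (intro Bochner_Integration.integral_diff) (auto intro: integrable_kernel_bounded_fun)

lemma sg_square_le:
  assumes "0 \<le> t" "x \<in> space E" "bounded_fun C f"
  shows "(sg t f x)\<^sup>2 \<le> sg t (\<lambda>y. (f y)\<^sup>2) x"
proof -
  interpret k: prob_space "K t x" by (rule kernel_props) fact+
  have i: "integrable (K t x) f" "integrable (K t x) (\<lambda>y. (f y)\<^sup>2)"
    using assms by (auto intro: integrable_kernel_bounded_fun bounded_fun_square)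
  have "0 \<le> k.variance f" by (rule Bochner_Integration.integral_nonneg_AE) simp
  then show ?thesis unfolding k.variance_eq[OF i] semigroup_op_def by simp
qed

subsection \<open>The law of the process\<close>

lemma sets_law: "sets (law M E X t) = sets E"
  by (simp add: law_def)

lemma prob_space_law: "0 \<le> t \<Longrightarrow> prob_space (law M E X t)"
  unfolding law_def by (intro prob_space_distr random_variable_X)

lemma law_bind_kernel:
  assumes s: "0 \<le> s" and t: "0 \<le> t"
  shows "law M E X s \<bind> K t = law M E X (s + t)"
proof (rule measure_eqI)
  show "sets (law M E X s \<bind> K t) = sets (law M E X (s + t))"
    by (simp add: sets_law sets_bind_kernel t)
  fix A assume "A \<in> sets (law M E X s \<bind> K t)"
  then have A[measurable]: "A \<in> sets E" by (simp add: sets_law sets_bind_kernel t)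
  note [measurable] = random_variable_X[OF s] random_variable_X[of "s + t"] kernel[OF t]
  let ?F = "natural_filtration M E X s"
  have "(\<Union>u\<in>{0..s}. {X u -` B \<inter> space M | B. B \<in> sets E}) \<subseteq> sets M"
    using random_variable_X by (auto intro: measurable_sets)
  then have "subalgebra M ?F"
    unfolding natural_filtration_def subalgebra_def
    by (auto simp: space_measure_of_conv sets_measure_of_conv sets.sigma_sets_subset dest: sets.sets_into_space intro!: sets.sigma_sets_subset[THEN subsetD])
  then interpret F: finite_measure_subalgebra M ?F by unfold_locales
  have st: "0 \<le> s + t" using s t by simp
  have int: "integrable M (\<lambda>\<omega>. indicator A (X (s + t) \<omega>) :: real)"
    using st by (intro integrable_const_bound[of _ 1]) (auto simp: indicator_def)
  have meas: "(\<lambda>x. measure (K t x) A) \<in> borel_measurable E" by measurable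
  have "measure (law M E X (s + t)) A = (\<integral>\<omega>. indicator A (X (s + t) \<omega>) \<partial>M)"
  proof -
    have "measure (law M E X (s + t)) A = (\<integral>x. indicator A x \<partial>law M E X (s + t))"
      by (simp add: sets_law)
    also have "\<dots> = (\<integral>\<omega>. indicator A (X (s + t) \<omega>) \<partial>M)"
      unfolding law_def using st by (intro integral_distr) auto
    finally show ?thesis .
  qed
  also have "\<dots> = (\<integral>\<omega>. real_cond_exp M ?F (\<lambda>\<omega>. indicator A (X (s + t) \<omega>)) \<omega> \<partial>M)"
    by (rule F.real_cond_exp_int(2)[symmetric, OF int])
  also have "\<dots> = (\<integral>\<omega>. measure (K t (X s \<omega>)) A \<partial>M)"
    using meas by (intro integral_cong_AE markov_property s t A) auto
  also have "\<dots> = (\<integral>x. measure (K t x) A \<partial>law M E X s)"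
    unfolding law_def using s meas by (intro integral_distr[symmetric]) auto
  also have "\<dots> = measure (law M E X s \<bind> K t) A"
  proof -
    interpret l: prob_space "law M E X s" by (rule prob_space_law[OF s])
    show ?thesis
      using kernel_nu[OF sets_law t] A by (subst l.measure_bind) auto
  qed
  finally have "measure (law M E X (s + t)) A = measure (law M E X s \<bind> K t) A" .
  then show "emeasure (law M E X s \<bind> K t) A = emeasure (law M E X (s + t)) A"
    using prob_space_law[OF s] prob_space_law[OF st] prob_space_bind_kernel[OF sets_law prob_space_law[OF s] t]
    by (simp add: finite_measure.emeasure_eq_measure prob_space.finite_measure)
qed

end

subsection \<open>The generator and the carre du champ\<close>

context markov_algebra_setting
begin

sublocale pi: prob_space \<pi>
  by (rule prob_space_invariant)

lemma space_pi: "space \<pi> = space E"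
  using sets_invariant by (rule sets_eq_imp_space_eq)

lemma measurable_pi_iff: "f \<in> borel_measurable \<pi> \<longleftrightarrow> f \<in> borel_measurable E"
  using measurable_cong_sets[OF sets_invariant refl] by blast

lemma integral_sg_pi:
  assumes "0 \<le> t" "integrable \<pi> f"
  shows "integrable \<pi> (sg t f)" "(\<integral>x. sg t f x \<partial>\<pi>) = (\<integral>x. f x \<partial>\<pi>)"
    "(\<integral>x. \<bar>sg t f x\<bar> \<partial>\<pi>) \<le> (\<integral>x. \<bar>f x\<bar> \<partial>\<pi>)"
  using integral_sg[OF sets_invariant assms(1), of f] integral_abs_sg_le[OF sets_invariant assms(1), of f] assms
  by (auto simp: invariant)

lemma integrable_pi_bounded: "bounded_fun C f \<Longrightarrow> integrable \<pi> f"
  using integrable_bounded_fun[OF pi.finite_measure_axioms sets_invariant] .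

lemma L2_integrable: "f \<in> L2 \<pi> \<Longrightarrow> integrable \<pi> f"
  unfolding L2_def by (auto intro: pi.square_integrable_imp_integrable)

lemma L2_bounded: "bounded_fun C f \<Longrightarrow> f \<in> L2 \<pi>"
  unfolding L2_def using integrable_pi_bounded[OF bounded_fun_square]
  by (auto simp: measurable_pi_iff bounded_fun_measurable)

lemma L2_diff:
  assumes "f \<in> L2 \<pi>" "g \<in> L2 \<pi>"
  shows "(\<lambda>x. f x - g x) \<in> L2 \<pi>"
proof -
  have "integrable \<pi> (\<lambda>x. 2 * (f x)\<^sup>2 + 2 * (g x)\<^sup>2)" using assms by (auto simp: L2_def)
  then have "integrable \<pi> (\<lambda>x. (f x - g x)\<^sup>2)"
  proof (rule Bochner_Integration.integrable_bound)
    show "(\<lambda>x. (f x - g x)\<^sup>2) \<in> borel_measurable \<pi>" using assms by (auto simp: L2_def)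
    have "(f x - g x)\<^sup>2 \<le> 2 * (f x)\<^sup>2 + 2 * (g x)\<^sup>2" for x
    proof -
      have "0 \<le> (f x + g x)\<^sup>2" by simp
      then show ?thesis by (simp add: power2_eq_square algebra_simps)
    qed
    then show "AE x in \<pi>. norm ((f x - g x)\<^sup>2) \<le> norm (2 * (f x)\<^sup>2 + 2 * (g x)\<^sup>2)"
      by (intro AE_I2) (simp add: abs_of_nonneg)
  qed
  then show ?thesis using assms by (auto simp: L2_def)
qed

lemma L2_cmult: "f \<in> L2 \<pi> \<Longrightarrow> (\<lambda>x. f x / c) \<in> L2 \<pi>"
  unfolding L2_def by (auto simp: power_divide)

lemma L2_sg:
  assumes t: "0 \<le> t" and f: "f \<in> L2 \<pi>"
  shows "sg t f \<in> L2 \<pi>"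
proof -
  have [measurable]: "f \<in> borel_measurable E" using f by (simp add: L2_def measurable_pi_iff)
  have m: "sg t f \<in> borel_measurable E" by (rule sg_measurable[OF t]) simp
  have "(\<integral>\<^sup>+x. ennreal ((sg t f x)\<^sup>2) \<partial>\<pi>) \<le> (\<integral>\<^sup>+x. \<integral>\<^sup>+y. ennreal ((f y)\<^sup>2) \<partial>K t x \<partial>\<pi>)"
    by (intro nn_integral_mono ennreal_sg_square_le[OF t]) (simp_all add: space_pi)
  also have "\<dots> = (\<integral>\<^sup>+x. ennreal ((f x)\<^sup>2) \<partial>\<pi>)"
    using nn_integral_bind_kernel[OF sets_invariant t, of "\<lambda>x. ennreal ((f x)\<^sup>2)"] by (simp add: invariant t)
  also have "\<dots> < \<infinity>" using f by (simp add: L2_def integrable_iff_bounded)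
  finally have "integrable \<pi> (\<lambda>x. (sg t f x)\<^sup>2)"
    using m by (simp add: integrable_iff_bounded measurable_pi_iff)
  then show ?thesis using m by (simp add: L2_def measurable_pi_iff)
qed

section \<open>Independence of representatives\<close>

lemma sg_cong_AE:
  assumes t: "0 \<le> t" and [measurable]: "f \<in> borel_measurable E" "g \<in> borel_measurable E"
    and eq: "AE x in \<pi>. f x = g x"
  shows "AE x in \<pi>. sg t f x = sg t g x"
proof -
  have "AE x in \<pi> \<bind> K t. f x = g x" by (subst invariant[OF t]) (rule eq)
  then have "AE x in \<pi>. AE y in K t x. f y = g y"
    by (subst (asm) AE_bind[OF kernel_nu[OF sets_invariant t]]) auto
  then show ?thesis
  proof (rule AE_mp, intro AE_I2 impI)
    fix x assume "x \<in> space \<pi>" and ae: "AE y in K t x. f y = g y"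
    then have s: "sets (K t x) = sets E" using kernel_props[OF t] by (simp add: space_pi)
    have "f \<in> borel_measurable (K t x)" "g \<in> borel_measurable (K t x)"
      by (simp_all add: measurable_cong_sets[OF s refl])
    then show "sg t f x = sg t g x"
      unfolding semigroup_op_def using ae by (rule integral_cong_AE)
  qed
qed

lemma has_generator_imp_cong:
  assumes f: "f \<in> borel_measurable E" and f': "f' \<in> borel_measurable E"
    and eq: "AE x in \<pi>. f x = f' x" and gen: "has_generator K \<pi> f g"
  shows "has_generator K \<pi> f' g"
proof -
  have L2: "f \<in> L2 \<pi>" "g \<in> L2 \<pi>" using gen by (auto simp: has_generator_def)
  have "integrable \<pi> (\<lambda>x. (f' x)\<^sup>2) \<longleftrightarrow> integrable \<pi> (\<lambda>x. (f x)\<^sup>2)"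
    using f f' eq by (intro integrable_cong_AE) (auto simp: measurable_pi_iff)
  with L2 f' have "f' \<in> L2 \<pi>" by (simp add: L2_def measurable_pi_iff)
  have "((\<lambda>t. \<integral>x. ((sg t f x - f x) / t - g x)\<^sup>2 \<partial>\<pi>) \<longlongrightarrow> 0) (at_right 0)"
    using gen by (simp add: has_generator_def)
  moreover have "\<forall>\<^sub>F t in at_right 0. (\<integral>x. ((sg t f x - f x) / t - g x)\<^sup>2 \<partial>\<pi>) = (\<integral>x. ((sg t f' x - f' x) / t - g x)\<^sup>2 \<partial>\<pi>)"
  proof -
    have "(\<integral>x. ((sg t f x - f x) / t - g x)\<^sup>2 \<partial>\<pi>) = (\<integral>x. ((sg t f' x - f' x) / t - g x)\<^sup>2 \<partial>\<pi>)" if t: "0 < t" for t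
    proof (rule integral_cong_AE)
      have [measurable]: "f \<in> borel_measurable \<pi>" "f' \<in> borel_measurable \<pi>" "g \<in> borel_measurable \<pi>"
          "sg t f \<in> borel_measurable \<pi>" "sg t f' \<in> borel_measurable \<pi>"
        using f f' L2 t by (auto simp: measurable_pi_iff L2_def)
      show "(\<lambda>x. ((sg t f x - f x) / t - g x)\<^sup>2) \<in> borel_measurable \<pi>"
           "(\<lambda>x. ((sg t f' x - f' x) / t - g x)\<^sup>2) \<in> borel_measurable \<pi>" by measurable
      have "AE x in \<pi>. sg t f x = sg t f' x" using t f f' eq by (intro sg_cong_AE) auto
      with eq show "AE x in \<pi>. ((sg t f x - f x) / t - g x)\<^sup>2 = ((sg t f' x - f' x) / t - g x)\<^sup>2"
        by eventually_elim simp
    qed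
    then show ?thesis by (rule eventually_mono[OF eventually_at_right_less])
  qed
  ultimately have "((\<lambda>t. \<integral>x. ((sg t f' x - f' x) / t - g x)\<^sup>2 \<partial>\<pi>) \<longlongrightarrow> 0) (at_right 0)"
    by (rule Lim_transform_eventually)
  with L2 \<open>f' \<in> L2 \<pi>\<close> show ?thesis by (simp add: has_generator_def)
qed

text \<open>The equality is literal and not merely almost everywhere: the predicates
  \<open>has_generator K \<pi> f\<close> and \<open>has_generator K \<pi> f'\<close> coincide, so
  the choice operator selects the same function.\<close>

lemma gen_cong:
  assumes "f \<in> borel_measurable E" "f' \<in> borel_measurable E" "AE x in \<pi>. f x = f' x"
  shows "gen K \<pi> f = gen K \<pi> f'"
proof -
  have "AE x in \<pi>. f' x = f x" using assms(3) by (rule AE_mp) auto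
  then have "has_generator K \<pi> f = has_generator K \<pi> f'"
    using has_generator_imp_cong assms by blast
  then show ?thesis by (simp add: gen_def)
qed

lemma Gamma_cong:
  assumes [measurable]: "f \<in> borel_measurable E" "f' \<in> borel_measurable E" and eq: "AE x in \<pi>. f x = f' x"
  shows "AE x in \<pi>. Gamma K \<pi> f x = Gamma K \<pi> f' x"
proof -
  have "AE x in \<pi>. (f x)\<^sup>2 = (f' x)\<^sup>2" using eq by eventually_elim simp
  then have sq: "gen K \<pi> (\<lambda>x. (f x)\<^sup>2) = gen K \<pi> (\<lambda>x. (f' x)\<^sup>2)" by (intro gen_cong) auto
  show ?thesis
    unfolding Gamma_def gen_cong[OF assms] sq using eq by eventually_elim simp
qed

lemma algebra_measurable: "f \<in> \<A> \<Longrightarrow> f \<in> borel_measurable E"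
  using algebra_bounded by (auto simp: L_infty_def measurable_pi_iff)

lemma algebra_square: "f \<in> \<A> \<Longrightarrow> (\<lambda>x. (f x)\<^sup>2) \<in> \<A>"
  using algebra_mult[of f f] by (simp add: power2_eq_square)

text \<open>Truncation at the essential bound changes \<open>f\<close> on a null set only, so
  saturation keeps the result in \<open>\<A>\<close>.\<close>

lemma algebra_bounded_representative:
  assumes f: "f \<in> \<A>"
  obtains C f' where "f' \<in> \<A>" "bounded_fun C f'" "AE x in \<pi>. f x = f' x"
proof -
  obtain C where C: "AE x in \<pi>. \<bar>f x\<bar> \<le> C" using f algebra_bounded by (auto simp: L_infty_def)
  have [measurable]: "f \<in> borel_measurable E" by (rule algebra_measurable[OF f])
  define f' where "f' x = max (- \<bar>C\<bar>) (min \<bar>C\<bar> (f x))" for x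
  have m[measurable]: "f' \<in> borel_measurable E" unfolding f'_def by measurable
  have eq: "AE x in \<pi>. f x = f' x" using C by eventually_elim (auto simp: f'_def)
  have "f' \<in> \<A>" by (rule algebra_saturated[OF f _ eq]) (simp add: measurable_pi_iff)
  moreover have "bounded_fun \<bar>C\<bar> f'" using m by (auto simp: bounded_fun_def f'_def)
  ultimately show thesis using eq that by blast
qed

section \<open>Short-time asymptotics on the domain of the generator\<close>

lemma has_generator_gen:
  assumes "f \<in> gen_dom K \<pi>"
  shows "has_generator K \<pi> f (gen K \<pi> f)"
  using assms unfolding gen_def gen_dom_def by (auto intro: someI[of "has_generator K \<pi> f"])

lemma gen_L2:
  assumes "f \<in> gen_dom K \<pi>"
  shows "f \<in> L2 \<pi>" "gen K \<pi> f \<in> L2 \<pi>"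
  using has_generator_gen[OF assms] by (auto simp: has_generator_def)

lemma gen_residual_L2:
  assumes "f \<in> gen_dom K \<pi>" "0 < t"
  shows "(\<lambda>x. (sg t f x - f x) / t - gen K \<pi> f x) \<in> L2 \<pi>"
  using gen_L2[OF assms(1)] assms(2) by (intro L2_diff L2_cmult L2_sg) auto

lemma gen_residual_tendsto_L2:
  assumes "f \<in> gen_dom K \<pi>"
  shows "((\<lambda>t. \<integral>x. ((sg t f x - f x) / t - gen K \<pi> f x)\<^sup>2 \<partial>\<pi>) \<longlongrightarrow> 0) (at_right 0)"
  using has_generator_gen[OF assms] by (simp add: has_generator_def)

lemma gen_residual_tendsto_L1:
  assumes "f \<in> gen_dom K \<pi>"
  shows "((\<lambda>t. \<integral>x. \<bar>(sg t f x - f x) / t - gen K \<pi> f x\<bar> \<partial>\<pi>) \<longlongrightarrow> 0) (at_right 0)"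
proof (rule tendsto_sandwich[OF _ _ tendsto_const])
  show "((\<lambda>t. sqrt (\<integral>x. ((sg t f x - f x) / t - gen K \<pi> f x)\<^sup>2 \<partial>\<pi>)) \<longlongrightarrow> 0) (at_right 0)"
    using tendsto_real_sqrt[OF gen_residual_tendsto_L2[OF assms]] by simp
  show "\<forall>\<^sub>F t in at_right 0. (\<integral>x. \<bar>(sg t f x - f x) / t - gen K \<pi> f x\<bar> \<partial>\<pi>)
      \<le> sqrt (\<integral>x. ((sg t f x - f x) / t - gen K \<pi> f x)\<^sup>2 \<partial>\<pi>)"
    using eventually_at_right_less[of "0::real"]
  proof eventually_elim
    case (elim t)
    then show ?case using gen_residual_L2[OF assms elim] unfolding L2_def by (intro pi.integral_abs_le_sqrt) auto
  qed
qed (auto intro!: always_eventually)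

text \<open>The increment \<open>sg t f - f\<close> is \<open>t\<close> times the sum of
  \<open>gen K \<pi> f\<close> and a residual tending to 0, so its L1 norm is of order
  \<open>t\<close>. The result is used both for \<open>f \<in> \<A>\<close> and for
  \<open>Gamma K \<pi> f\<close>.\<close>

lemma sg_tendsto_L1:
  assumes f: "f \<in> gen_dom K \<pi>"
  shows "((\<lambda>t. \<integral>x. \<bar>sg t f x - f x\<bar> \<partial>\<pi>) \<longlongrightarrow> 0) (at_right 0)"
proof (rule tendsto_sandwich[OF _ _ tendsto_const])
  let ?r = "\<lambda>t. \<integral>x. \<bar>(sg t f x - f x) / t - gen K \<pi> f x\<bar> \<partial>\<pi>"
  have "((\<lambda>t. t * (?r t + (\<integral>x. \<bar>gen K \<pi> f x\<bar> \<partial>\<pi>))) \<longlongrightarrow> 0 * (0 + (\<integral>x. \<bar>gen K \<pi> f x\<bar> \<partial>\<pi>))) (at_right 0)"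
    by (intro tendsto_intros gen_residual_tendsto_L1[OF f])
  then show "((\<lambda>t. t * (?r t + (\<integral>x. \<bar>gen K \<pi> f x\<bar> \<partial>\<pi>))) \<longlongrightarrow> 0) (at_right 0)" by simp
  show "\<forall>\<^sub>F t in at_right 0. (\<integral>x. \<bar>sg t f x - f x\<bar> \<partial>\<pi>) \<le> t * (?r t + (\<integral>x. \<bar>gen K \<pi> f x\<bar> \<partial>\<pi>))"
    using eventually_at_right_less[of "0::real"]
  proof eventually_elim
    case (elim t)
    note i = L2_integrable[OF gen_residual_L2[OF f elim]] L2_integrable[OF gen_L2(1)[OF f]]
      L2_integrable[OF gen_L2(2)[OF f]] L2_integrable[OF L2_sg[OF less_imp_le[OF elim] gen_L2(1)[OF f]]]
    have le: "\<bar>sg t f x - f x\<bar> \<le> t * (\<bar>(sg t f x - f x) / t - gen K \<pi> f x\<bar> + \<bar>gen K \<pi> f x\<bar>)" for x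
    proof -
      have "\<bar>sg t f x - f x\<bar> = t * \<bar>(sg t f x - f x) / t\<bar>" using elim by (simp add: abs_divide)
      also have "\<dots> \<le> t * (\<bar>(sg t f x - f x) / t - gen K \<pi> f x\<bar> + \<bar>gen K \<pi> f x\<bar>)"
        using elim by (intro mult_left_mono) auto
      finally show ?thesis .
    qed
    have "(\<integral>x. \<bar>sg t f x - f x\<bar> \<partial>\<pi>) \<le> (\<integral>x. t * (\<bar>(sg t f x - f x) / t - gen K \<pi> f x\<bar> + \<bar>gen K \<pi> f x\<bar>) \<partial>\<pi>)"
      using i by (intro integral_mono le) auto
    also have "\<dots> = t * (?r t + (\<integral>x. \<bar>gen K \<pi> f x\<bar> \<partial>\<pi>))" using i by simp
    finally show ?case .
  qed
qed (auto intro!: always_eventually)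

text \<open>For bounded \<open>f\<close>, the variance of \<open>f\<close> under
  \<open>K t x\<close>, that is, of \<open>f\<close> after time \<open>t\<close> when starting from
  \<open>x\<close>.\<close>

definition local_variance :: "real \<Rightarrow> ('a \<Rightarrow> real) \<Rightarrow> 'a \<Rightarrow> real" where
  "local_variance t f x = sg t (\<lambda>y. (f y)\<^sup>2) x - (sg t f x)\<^sup>2"

lemma bounded_fun_local_variance:
  "0 \<le> t \<Longrightarrow> bounded_fun C f \<Longrightarrow> bounded_fun (C\<^sup>2 + C\<^sup>2) (local_variance t f)"
  unfolding local_variance_def by (intro bounded_fun_diff bounded_fun_sg bounded_fun_square)

lemma local_variance_nonneg:
  "0 \<le> t \<Longrightarrow> x \<in> space E \<Longrightarrow> bounded_fun C f \<Longrightarrow> 0 \<le> local_variance t f x"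
  unfolding local_variance_def using sg_square_le[of t x C f] by simp

lemma integral_local_variance:
  assumes nu: "finite_measure \<nu>" "finite_measure (\<nu> \<bind> K t)" "sets \<nu> = sets E" and t: "0 \<le> t" and f: "bounded_fun C f"
  shows "(\<integral>x. local_variance t f x \<partial>\<nu>) = (\<integral>x. (f x)\<^sup>2 \<partial>(\<nu> \<bind> K t)) - (\<integral>x. (sg t f x)\<^sup>2 \<partial>\<nu>)"
proof -
  have "integrable (\<nu> \<bind> K t) (\<lambda>x. (f x)\<^sup>2)"
    by (rule integrable_bounded_fun[OF nu(2) sets_bind_kernel[OF nu(3) t] bounded_fun_square[OF f]])
  then have "(\<integral>x. sg t (\<lambda>y. (f y)\<^sup>2) x \<partial>\<nu>) = (\<integral>x. (f x)\<^sup>2 \<partial>(\<nu> \<bind> K t))"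
    by (rule integral_sg(2)[OF nu(3) t])
  moreover have "integrable \<nu> (sg t (\<lambda>y. (f y)\<^sup>2))" "integrable \<nu> (\<lambda>x. (sg t f x)\<^sup>2)"
    using f t by (auto intro!: integrable_bounded_fun[OF nu(1,3)] bounded_fun_sg bounded_fun_square)
  ultimately show ?thesis unfolding local_variance_def by simp
qed

lemma integrable_Gamma:
  assumes f: "f \<in> \<A>"
  shows "integrable \<pi> (Gamma K \<pi> f)"
proof -
  obtain C where C: "AE x in \<pi>. \<bar>f x\<bar> \<le> C" using f algebra_bounded by (auto simp: L_infty_def)
  have m: "f \<in> borel_measurable \<pi>" using algebra_measurable[OF f] by (simp add: measurable_pi_iff)
  have 1: "integrable \<pi> (gen K \<pi> f)" "integrable \<pi> (gen K \<pi> (\<lambda>x. (f x)\<^sup>2))"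
    using f algebra_square[OF f] algebra_domain by (auto intro!: L2_integrable gen_L2)
  have "integrable \<pi> (\<lambda>x. f x * gen K \<pi> f x)"
  proof (rule Bochner_Integration.integrable_bound[of _ "\<lambda>x. C * gen K \<pi> f x"])
    show "AE x in \<pi>. norm (f x * gen K \<pi> f x) \<le> norm (C * gen K \<pi> f x)"
      using C by eventually_elim (auto simp: abs_mult intro!: mult_right_mono)
  qed (use 1 m in auto)
  with 1 show ?thesis unfolding Gamma_def by simp
qed

text \<open>The generator is expanded to first order at \<open>f\<^sup>2\<close>, with residual
  \<open>z'\<close>, and at \<open>f\<close>, with residual \<open>z\<close>. The square of
  \<open>sg t f\<close> is handled as a difference of squares, whose factor
  \<open>sg t f + f\<close> is bounded; the only quadratic error is \<open>t\<close> times an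
  integrable quantity.\<close>

lemma local_variance_tendsto_Gamma:
  assumes f: "f \<in> \<A>" and C: "bounded_fun C f"
  shows "((\<lambda>t. \<integral>x. \<bar>local_variance t f x / t - 2 * Gamma K \<pi> f x\<bar> \<partial>\<pi>) \<longlongrightarrow> 0) (at_right 0)"
proof (rule tendsto_sandwich[OF _ _ tendsto_const])
  define Lf where "Lf = gen K \<pi> f"
  define L2f where "L2f = gen K \<pi> (\<lambda>x. (f x)\<^sup>2)"
  define z where "z t x = (sg t f x - f x) / t - Lf x" for t x
  define z' where "z' t x = (sg t (\<lambda>y. (f y)\<^sup>2) x - (f x)\<^sup>2) / t - L2f x" for t x
  have dom: "f \<in> gen_dom K \<pi>" "(\<lambda>x. (f x)\<^sup>2) \<in> gen_dom K \<pi>" using f algebra_square[OF f] algebra_domain by auto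
  let ?b = "\<lambda>t. (\<integral>x. \<bar>z' t x\<bar> \<partial>\<pi>) + 2 * C * (\<integral>x. \<bar>z t x\<bar> \<partial>\<pi>) + t * ((\<integral>x. (z t x)\<^sup>2 \<partial>\<pi>) + 2 * (\<integral>x. (Lf x)\<^sup>2 \<partial>\<pi>))"
  have "(?b \<longlongrightarrow> 0 + 2 * C * 0 + 0 * (0 + 2 * (\<integral>x. (Lf x)\<^sup>2 \<partial>\<pi>))) (at_right 0)"
    unfolding z_def z'_def Lf_def L2f_def
    by (intro tendsto_intros gen_residual_tendsto_L1 gen_residual_tendsto_L2 dom)
  then show "(?b \<longlongrightarrow> 0) (at_right 0)" by simp
  show "\<forall>\<^sub>F t in at_right 0. (\<integral>x. \<bar>local_variance t f x / t - 2 * Gamma K \<pi> f x\<bar> \<partial>\<pi>) \<le> ?b t"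
    using eventually_at_right_less[of "0::real"]
  proof eventually_elim
    case (elim t)
    have L2s: "z t \<in> L2 \<pi>" "z' t \<in> L2 \<pi>" "Lf \<in> L2 \<pi>"
      unfolding z_def z'_def Lf_def L2f_def using gen_residual_L2[OF dom(1) elim] gen_residual_L2[OF dom(2) elim] gen_L2(2)[OF dom(1)] by auto
    note i = this[THEN L2_integrable]
    have i2: "integrable \<pi> (\<lambda>x. (z t x)\<^sup>2)" "integrable \<pi> (\<lambda>x. (Lf x)\<^sup>2)" using L2s by (auto simp: L2_def)
    have le: "\<bar>local_variance t f x / t - 2 * Gamma K \<pi> f x\<bar> \<le> \<bar>z' t x\<bar> + 2 * C * \<bar>z t x\<bar> + t * ((z t x)\<^sup>2 + 2 * (Lf x)\<^sup>2)"
      if x: "x \<in> space \<pi>" for x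
    proof -
      have b: "\<bar>sg t f x + f x\<bar> \<le> 2 * C"
        using bounded_fun_sg[OF _ C, of t] C elim x unfolding bounded_fun_def space_pi by fastforce
      have S: "sg t f x = f x + t * (z t x + Lf x)" using elim by (simp add: z_def)
      have "local_variance t f x / t - 2 * Gamma K \<pi> f x
          = z' t x - ((sg t f x)\<^sup>2 - (f x)\<^sup>2) / t + 2 * f x * Lf x"
        using elim unfolding local_variance_def Gamma_def z'_def Lf_def L2f_def by (simp add: diff_divide_distrib)
      also have "((sg t f x)\<^sup>2 - (f x)\<^sup>2) / t = (sg t f x + f x) * (z t x + Lf x)"
        using elim by (simp add: z_def power2_eq_square field_simps)
      \<comment> \<open>The coefficient of \<open>Lf x\<close> is
        \<open>2 * f x - (sg t f x + f x) = - t * (z t x + Lf x)\<close>, so that term is of order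
        \<open>t\<close>.\<close>
      also have "z' t x - (sg t f x + f x) * (z t x + Lf x) + 2 * f x * Lf x
          = z' t x - (sg t f x + f x) * z t x - t * ((z t x) * Lf x + (Lf x)\<^sup>2)"
        unfolding S by (simp add: power2_eq_square algebra_simps)
      also have "\<bar>\<dots>\<bar> \<le> \<bar>z' t x\<bar> + \<bar>(sg t f x + f x) * z t x\<bar> + \<bar>t * ((z t x) * Lf x + (Lf x)\<^sup>2)\<bar>" by linarith
      also have "\<bar>(sg t f x + f x) * z t x\<bar> \<le> 2 * C * \<bar>z t x\<bar>"
        unfolding abs_mult by (rule mult_right_mono[OF b]) simp
      also have "\<bar>t * ((z t x) * Lf x + (Lf x)\<^sup>2)\<bar> \<le> t * ((z t x)\<^sup>2 + 2 * (Lf x)\<^sup>2)"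
      proof -
        have "0 \<le> (z t x + Lf x)\<^sup>2" "0 \<le> (z t x - Lf x)\<^sup>2" by simp_all
        then have "\<bar>z t x * Lf x\<bar> \<le> (z t x)\<^sup>2 + (Lf x)\<^sup>2"
          using zero_le_power2[of "z t x"] zero_le_power2[of "Lf x"]
          unfolding power2_sum power2_diff abs_le_iff by linarith
        then have "\<bar>(z t x) * Lf x + (Lf x)\<^sup>2\<bar> \<le> (z t x)\<^sup>2 + 2 * (Lf x)\<^sup>2"
          using zero_le_power2[of "Lf x"] by linarith
        then show ?thesis using elim unfolding abs_mult by (simp add: mult_left_mono)
      qed
      finally show ?thesis by simp
    qed
    have "(\<integral>x. \<bar>local_variance t f x / t - 2 * Gamma K \<pi> f x\<bar> \<partial>\<pi>)
        \<le> (\<integral>x. \<bar>z' t x\<bar> + 2 * C * \<bar>z t x\<bar> + t * ((z t x)\<^sup>2 + 2 * (Lf x)\<^sup>2) \<partial>\<pi>)"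
      using i i2 integrable_Gamma[OF f] integrable_pi_bounded[OF bounded_fun_local_variance[OF less_imp_le[OF elim] C]]
      by (intro integral_mono le) auto
    also have "\<dots> = ?b t" using i i2 by simp
    finally show ?case .
  qed
qed (auto intro!: always_eventually)

subsection \<open>Measures dominated by the invariant law\<close>

text \<open>Invariance of \<open>\<pi>\<close> makes this class stable under the kernels, and L1
  convergence under \<open>\<pi>\<close> controls integrals uniformly over it. This is what allows
  limits in which the measure varies along with the step, and it can fail for laws with unbounded
  density.\<close>

definition sub_pi :: "'a measure \<Rightarrow> bool" where
  "sub_pi \<nu> \<longleftrightarrow> sets \<nu> = sets E \<and> \<nu> \<le> \<pi>"

lemma sub_piD:
  assumes "sub_pi \<nu>"
  shows "sets \<nu> = sets E" "sets \<nu> = sets \<pi>" "\<nu> \<le> \<pi>" "finite_measure \<nu>"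
proof -
  show s: "sets \<nu> = sets E" "sets \<nu> = sets \<pi>" and le: "\<nu> \<le> \<pi>"
    using assms sets_invariant by (auto simp: sub_pi_def)
  show "finite_measure \<nu>"
  proof (rule finite_measureI)
    have "emeasure \<nu> (space \<nu>) \<le> emeasure \<pi> (space \<nu>)" by (rule le_measureD3[OF le s(2)])
    also have "\<dots> \<le> 1" by (rule pi.emeasure_le_1)
    finally show "emeasure \<nu> (space \<nu>) \<noteq> \<infinity>" by (auto simp: top_unique)
  qed
qed

lemma sub_pi_bind:
  assumes "sub_pi \<nu>" "0 \<le> t"
  shows "sub_pi (\<nu> \<bind> K t)"
  using bind_kernel_mono[OF sub_piD(1)[OF assms(1)] sets_invariant sub_piD(3)[OF assms(1)] assms(2)]
    sets_bind_kernel[OF sub_piD(1)[OF assms(1)] assms(2)]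
  by (simp add: sub_pi_def invariant assms(2))

lemma sub_pi_integrable: "sub_pi \<nu> \<Longrightarrow> integrable \<pi> f \<Longrightarrow> integrable \<nu> f"
  for f :: "'a \<Rightarrow> real"
  by (rule integrable_le_measure[OF sub_piD(2,3)])

lemma sub_pi_integral_abs_le:
  fixes f :: "'a \<Rightarrow> real"
  assumes "sub_pi \<nu>" "integrable \<pi> f"
  shows "\<bar>\<integral>x. f x \<partial>\<nu>\<bar> \<le> (\<integral>x. \<bar>f x\<bar> \<partial>\<pi>)"
proof -
  have "\<bar>\<integral>x. f x \<partial>\<nu>\<bar> \<le> (\<integral>x. \<bar>f x\<bar> \<partial>\<nu>)" by (rule integral_abs_bound)
  also have "\<dots> \<le> (\<integral>x. \<bar>f x\<bar> \<partial>\<pi>)"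
    using assms by (intro integral_le_measure sub_piD[OF assms(1)]) auto
  finally show ?thesis .
qed

text \<open>Up to the factor 2, \<open>Gamma\<close> is the short-time limit of local variances
  divided by \<open>t\<close>, which are nonnegative; the limit is tested against measures below
  \<open>\<pi>\<close>.\<close>

lemma Gamma_nonneg:
  assumes f: "f \<in> \<A>"
  shows "AE x in \<pi>. 0 \<le> Gamma K \<pi> f x"
proof -
  obtain C f' where f': "f' \<in> \<A>" "bounded_fun C f'" "AE x in \<pi>. f x = f' x"
    by (rule algebra_bounded_representative[OF f])
  have "AE x in \<pi>. 0 \<le> Gamma K \<pi> f' x"
  proof (rule AE_le_if_integral_le_le_measure)
    show "integrable \<pi> (Gamma K \<pi> f')" by (rule integrable_Gamma[OF f'(1)])
    fix \<nu> assume nu: "sets \<nu> = sets \<pi>" "\<nu> \<le> \<pi>"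
    then have s: "sub_pi \<nu>" by (simp add: sub_pi_def sets_invariant)
    have sp: "space \<nu> = space E" using sub_piD(1)[OF s] by (rule sets_eq_imp_space_eq)
    have "0 \<le> 2 * (\<integral>x. Gamma K \<pi> f' x \<partial>\<nu>) + (\<integral>x. \<bar>local_variance t f' x / t - 2 * Gamma K \<pi> f' x\<bar> \<partial>\<pi>)" if t: "0 < t" for t
    proof -
      have lv: "integrable \<pi> (local_variance t f')"
        using t by (intro integrable_pi_bounded[OF bounded_fun_local_variance[OF _ f'(2)]]) simp
      have "0 \<le> (\<integral>x. local_variance t f' x / t \<partial>\<nu>)"
        using t local_variance_nonneg[OF _ _ f'(2), of t] sp by (intro Bochner_Integration.integral_nonneg_AE AE_I2) auto
      also have "\<dots> = 2 * (\<integral>x. Gamma K \<pi> f' x \<partial>\<nu>) + (\<integral>x. local_variance t f' x / t - 2 * Gamma K \<pi> f' x \<partial>\<nu>)"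
        using sub_pi_integrable[OF s integrable_Gamma[OF f'(1)]] sub_pi_integrable[OF s lv] by simp
      also have "(\<integral>x. local_variance t f' x / t - 2 * Gamma K \<pi> f' x \<partial>\<nu>) \<le> (\<integral>x. \<bar>local_variance t f' x / t - 2 * Gamma K \<pi> f' x\<bar> \<partial>\<pi>)"
        using lv integrable_Gamma[OF f'(1)] by (intro order_trans[OF abs_ge_self sub_pi_integral_abs_le[OF s]]) auto
      finally show ?thesis by simp
    qed
    then have "\<forall>\<^sub>F t in at_right 0. 0 \<le> 2 * (\<integral>x. Gamma K \<pi> f' x \<partial>\<nu>) + (\<integral>x. \<bar>local_variance t f' x / t - 2 * Gamma K \<pi> f' x\<bar> \<partial>\<pi>)"
      by (rule eventually_mono[OF eventually_at_right_less])
    moreover have "((\<lambda>t. 2 * (\<integral>x. Gamma K \<pi> f' x \<partial>\<nu>) + (\<integral>x. \<bar>local_variance t f' x / t - 2 * Gamma K \<pi> f' x\<bar> \<partial>\<pi>))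
        \<longlongrightarrow> 2 * (\<integral>x. Gamma K \<pi> f' x \<partial>\<nu>) + 0) (at_right 0)"
      by (intro tendsto_intros local_variance_tendsto_Gamma[OF f'(1,2)])
    ultimately have "0 \<le> 2 * (\<integral>x. Gamma K \<pi> f' x \<partial>\<nu>) + 0"
      by (intro tendsto_lowerbound) (auto simp: trivial_limit_at_right_real)
    then show "(\<integral>x. 0 \<partial>\<nu>) \<le> (\<integral>x. Gamma K \<pi> f' x \<partial>\<nu>)" by simp
  qed simp
  moreover have "AE x in \<pi>. Gamma K \<pi> f x = Gamma K \<pi> f' x"
    using f f' by (intro Gamma_cong algebra_measurable) auto
  ultimately show ?thesis by eventually_elim simp
qed

end

subsection \<open>Local Poincare inequalities\<close>

context bakry_emery_setting
begin

text \<open>Only the left derivative of the flow is accessible: there the difference quotient involves a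
  fixed function, \<open>sg (s - u) f\<close>, whereas on the right this function varies with the step.\<close>

definition flow :: "'a measure \<Rightarrow> real \<Rightarrow> ('a \<Rightarrow> real) \<Rightarrow> real \<Rightarrow> real" where
  "flow \<nu> s f u = (\<integral>x. (sg (s - u) f x)\<^sup>2 \<partial>(\<nu> \<bind> K u))"

text \<open>With \<open>g = sg (s - v) f\<close>, the flow is the second moment of \<open>g\<close>
  at time \<open>v\<close> and, by the semigroup law, that of \<open>sg (v - u) g\<close> at time
  \<open>u\<close>. The loss of second moment under averaging is the local variance.\<close>

lemma flow_diff:
  assumes nu: "sub_pi \<nu>" and f: "bounded_fun C f" and u: "0 \<le> u" "u \<le> v" "v \<le> s"
  shows "flow \<nu> s f v - flow \<nu> s f u = (\<integral>x. local_variance (v - u) (sg (s - v) f) x \<partial>(\<nu> \<bind> K u))"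
proof -
  have s1: "sub_pi (\<nu> \<bind> K u)" using nu u by (intro sub_pi_bind) auto
  have b: "(\<nu> \<bind> K u) \<bind> K (v - u) = \<nu> \<bind> K v"
    using bind_kernel_bind[OF sub_piD(1)[OF nu], of u "v - u"] u by simp
  have s2: "sub_pi (\<nu> \<bind> K v)" using nu u by (intro sub_pi_bind) auto
  have "(\<integral>x. (sg (v - u) (sg (s - v) f) x)\<^sup>2 \<partial>(\<nu> \<bind> K u)) = flow \<nu> s f u"
    unfolding flow_def
  proof (rule Bochner_Integration.integral_cong[OF refl])
    fix x assume "x \<in> space (\<nu> \<bind> K u)"
    then have "x \<in> space E" using sets_eq_imp_space_eq[OF sub_piD(1)[OF s1]] by simp
    then show "(sg (v - u) (sg (s - v) f) x)\<^sup>2 = (sg (s - u) f x)\<^sup>2"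
      using sg_sg[OF _ _ _ f, of "v - u" "s - v" x] u by simp
  qed
  then show ?thesis
    using integral_local_variance[of "\<nu> \<bind> K u" "v - u" C "sg (s - v) f"] s1 s2 u bounded_fun_sg[OF _ f, of "s - v"]
    by (simp add: b sub_piD flow_def)
qed

lemma flow_0:
  assumes "sub_pi \<nu>"
  shows "flow \<nu> s f 0 = (\<integral>x. (sg s f x)\<^sup>2 \<partial>\<nu>)"
  unfolding flow_def using bind_kernel_0[OF sub_piD(1)[OF assms]] by simp

lemma flow_end:
  assumes nu: "sub_pi \<nu>" and f: "f \<in> borel_measurable E" and s: "0 \<le> s"
  shows "flow \<nu> s f s = (\<integral>x. (f x)\<^sup>2 \<partial>(\<nu> \<bind> K s))"
  unfolding flow_def
proof (rule Bochner_Integration.integral_cong[OF refl])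
  fix x assume "x \<in> space (\<nu> \<bind> K s)"
  then have "x \<in> space E" using sets_eq_imp_space_eq[OF sub_piD(1)[OF sub_pi_bind[OF nu s]]] by simp
  then show "(sg (s - s) f x)\<^sup>2 = (f x)\<^sup>2" using sg_0[OF f] by simp
qed

text \<open>The nonnegative increment grows when \<open>\<nu> \<bind> K u\<close> is replaced by
  \<open>\<pi>\<close>, where invariance turns it into the integral of a difference of squares.
  Since \<open>sg (s - v)\<close> commutes with \<open>sg (v - u)\<close> and contracts L1 of
  \<open>\<pi>\<close>, the final bound involves the times through \<open>v - u\<close> only, so
  continuity holds from both sides.\<close>

lemma flow_modulus:
  assumes nu: "sub_pi \<nu>" and f: "f \<in> \<A>" "bounded_fun C f" and u: "0 \<le> u" "u \<le> v" "v \<le> s"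
  shows "\<bar>flow \<nu> s f v - flow \<nu> s f u\<bar> \<le> 2 * C * (\<integral>x. \<bar>sg (v - u) f x - f x\<bar> \<partial>\<pi>)"
proof -
  define h where "h = v - u"
  define g where "g = sg (s - v) f"
  have h: "0 \<le> h" and sv: "0 \<le> s - v" using u by (auto simp: h_def)
  have g: "bounded_fun C g" unfolding g_def by (rule bounded_fun_sg[OF sv f(2)])
  have Pg: "bounded_fun C (sg h g)" by (rule bounded_fun_sg[OF h g])
  note lv = bounded_fun_local_variance[OF h g]
  have i: "integrable \<pi> (\<lambda>x. (g x)\<^sup>2)" "integrable \<pi> (\<lambda>x. (sg h g x)\<^sup>2)" "integrable \<pi> (\<lambda>x. \<bar>g x - sg h g x\<bar>)"
    using integrable_pi_bounded[OF bounded_fun_square[OF g]] integrable_pi_bounded[OF bounded_fun_square[OF Pg]]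
      integrable_pi_bounded[OF bounded_fun_diff[OF g Pg]] by auto
  have "\<bar>flow \<nu> s f v - flow \<nu> s f u\<bar> \<le> (\<integral>x. \<bar>local_variance h g x\<bar> \<partial>\<pi>)"
    unfolding flow_diff[OF nu f(2) u] h_def[symmetric] g_def[symmetric]
    using u by (intro sub_pi_integral_abs_le sub_pi_bind nu integrable_pi_bounded[OF lv]) auto
  also have "\<dots> = (\<integral>x. local_variance h g x \<partial>\<pi>)"
    using local_variance_nonneg[OF h _ g] by (intro Bochner_Integration.integral_cong) (auto simp: space_pi)
  also have "\<dots> = (\<integral>x. (g x)\<^sup>2 \<partial>\<pi>) - (\<integral>x. (sg h g x)\<^sup>2 \<partial>\<pi>)"
    using integral_local_variance[of \<pi> h C g] g h by (simp add: pi.finite_measure_axioms sets_invariant invariant)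
  also have "\<dots> = (\<integral>x. (g x)\<^sup>2 - (sg h g x)\<^sup>2 \<partial>\<pi>)" using i by simp
  also have "\<dots> \<le> (\<integral>x. 2 * C * \<bar>g x - sg h g x\<bar> \<partial>\<pi>)"
  proof (rule integral_mono)
    fix x assume "x \<in> space \<pi>"
    then have "\<bar>g x + sg h g x\<bar> \<le> 2 * C" using g Pg by (fastforce simp: bounded_fun_def space_pi)
    then have "\<bar>g x + sg h g x\<bar> * \<bar>g x - sg h g x\<bar> \<le> 2 * C * \<bar>g x - sg h g x\<bar>" by (rule mult_right_mono) simp
    then show "(g x)\<^sup>2 - (sg h g x)\<^sup>2 \<le> 2 * C * \<bar>g x - sg h g x\<bar>"
      unfolding power2_eq_square square_diff_square_factored abs_mult[symmetric] by linarith
  qed (use i in auto)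
  also have "\<dots> = 2 * C * (\<integral>x. \<bar>g x - sg h g x\<bar> \<partial>\<pi>)" by simp
  also have "(\<integral>x. \<bar>g x - sg h g x\<bar> \<partial>\<pi>) \<le> (\<integral>x. \<bar>sg h f x - f x\<bar> \<partial>\<pi>)"
  proof -
    have Pf: "bounded_fun C (sg h f)" by (rule bounded_fun_sg[OF h f(2)])
    have "(\<integral>x. \<bar>g x - sg h g x\<bar> \<partial>\<pi>) = (\<integral>x. \<bar>sg (s - v) (\<lambda>y. sg h f y - f y) x\<bar> \<partial>\<pi>)"
    proof (rule Bochner_Integration.integral_cong[OF refl])
      fix x assume "x \<in> space \<pi>"
      then have x: "x \<in> space E" by (simp add: space_pi)
      have "sg h g x = sg (s - v) (sg h f) x"
        using sg_sg[OF h sv x f(2)] sg_sg[OF sv h x f(2)] unfolding g_def by (simp add: add.commute)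
      then show "\<bar>g x - sg h g x\<bar> = \<bar>sg (s - v) (\<lambda>y. sg h f y - f y) x\<bar>"
        using sg_diff[OF sv x Pf f(2)] unfolding g_def by (simp add: abs_minus_commute)
    qed
    also have "\<dots> \<le> (\<integral>x. \<bar>sg h f x - f x\<bar> \<partial>\<pi>)"
      by (rule integral_sg_pi(3)[OF sv integrable_pi_bounded[OF bounded_fun_diff[OF Pf f(2)]]])
    finally show ?thesis .
  qed
  finally show ?thesis using bounded_fun_nonneg[OF f(2)] unfolding h_def by (simp add: mult_left_mono)
qed

lemma continuous_on_flow:
  assumes nu: "sub_pi \<nu>" and f: "f \<in> \<A>" "bounded_fun C f"
  shows "continuous_on {0..s} (flow \<nu> s f)"
  unfolding continuous_on_iff
proof (intro ballI allI impI)
  fix u e :: real assume u: "u \<in> {0..s}" and e: "0 < e"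
  have "((\<lambda>h. 2 * C * (\<integral>x. \<bar>sg h f x - f x\<bar> \<partial>\<pi>)) \<longlongrightarrow> 2 * C * 0) (at_right 0)"
    using f(1) algebra_domain by (intro tendsto_intros sg_tendsto_L1) auto
  then have "\<forall>\<^sub>F h in at_right 0. 2 * C * (\<integral>x. \<bar>sg h f x - f x\<bar> \<partial>\<pi>) < e"
    using e by (intro order_tendstoD(2)) auto
  then obtain d where d: "0 < d" "\<And>h. 0 < h \<Longrightarrow> h < d \<Longrightarrow> 2 * C * (\<integral>x. \<bar>sg h f x - f x\<bar> \<partial>\<pi>) < e"
    unfolding eventually_at_right_field by blast
  have "dist (flow \<nu> s f v) (flow \<nu> s f u) < e" if v: "v \<in> {0..s}" "dist v u < d" for v
  proof (cases "v = u")
    case False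
    have "\<bar>flow \<nu> s f v - flow \<nu> s f u\<bar> \<le> 2 * C * (\<integral>x. \<bar>sg \<bar>v - u\<bar> f x - f x\<bar> \<partial>\<pi>)"
    proof (cases "u \<le> v")
      case True
      then show ?thesis using flow_modulus[OF nu f, of u v s] u v by simp
    next
      case False
      then show ?thesis using flow_modulus[OF nu f, of v u s] u v by (simp add: abs_minus_commute)
    qed
    also have "\<dots> < e" using d(2)[of "\<bar>v - u\<bar>"] v False by (simp add: dist_real_def)
    finally show ?thesis by (simp add: dist_real_def)
  qed (use e in simp)
  then show "\<exists>d>0. \<forall>v\<in>{0..s}. dist v u < d \<longrightarrow> dist (flow \<nu> s f v) (flow \<nu> s f u) < e"
    using d(1) by blast
qed

text \<open>Over the interval from \<open>u - h\<close> to \<open>u\<close> the increment divided by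
  \<open>h\<close> is the integral of \<open>local_variance h g / h\<close> under
  \<open>\<nu> \<bind> K (u - h)\<close>, hence close to twice that of
  \<open>Gamma K \<pi> g\<close>. Moving the base measure to \<open>\<nu> \<bind> K u\<close> costs
  the L1 distance between \<open>Gamma K \<pi> g\<close> and its image under \<open>sg h\<close>,
  which vanishes because \<open>Gamma K \<pi> g\<close> lies in the domain of the generator.\<close>

lemma flow_left_derivative:
  assumes nu: "sub_pi \<nu>" and f: "f \<in> \<A>" "bounded_fun C f" and u: "0 < u" "u \<le> s"
  shows "((\<lambda>h. (flow \<nu> s f u - flow \<nu> s f (u - h)) / h)
    \<longlongrightarrow> 2 * (\<integral>x. Gamma K \<pi> (sg (s - u) f) x \<partial>(\<nu> \<bind> K u))) (at_right 0)"
proof -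
  define g where "g = sg (s - u) f"
  let ?G = "Gamma K \<pi> g"
  have su: "0 \<le> s - u" using u by simp
  have g: "g \<in> \<A>" "bounded_fun C g" unfolding g_def using su f by (auto intro: algebra_stable bounded_fun_sg)
  let ?b = "\<lambda>h. (\<integral>x. \<bar>local_variance h g x / h - 2 * ?G x\<bar> \<partial>\<pi>) + 2 * (\<integral>x. \<bar>sg h ?G x - ?G x\<bar> \<partial>\<pi>)"
  have "(?b \<longlongrightarrow> 0 + 2 * 0) (at_right 0)"
    by (intro tendsto_intros local_variance_tendsto_Gamma[OF g] sg_tendsto_L1[OF Gamma_domain[OF g(1)]])
  then have b: "(?b \<longlongrightarrow> 0) (at_right 0)" by simp
  have bound: "norm ((flow \<nu> s f u - flow \<nu> s f (u - h)) / h - 2 * (\<integral>x. ?G x \<partial>(\<nu> \<bind> K u))) \<le> ?b h"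
    if h: "0 < h" "h < u" for h
  proof -
    let ?\<nu> = "\<nu> \<bind> K (u - h)"
    have s1: "sub_pi ?\<nu>" using nu h by (intro sub_pi_bind) auto
    have s2: "sub_pi (\<nu> \<bind> K u)" using nu u by (intro sub_pi_bind) auto
    have b: "?\<nu> \<bind> K h = \<nu> \<bind> K u"
      using bind_kernel_bind[OF sub_piD(1)[OF nu], of "u - h" h] h by simp
    note iG = integrable_Gamma[OF g(1)]
    have lv: "integrable \<pi> (local_variance h g)"
      by (rule integrable_pi_bounded[OF bounded_fun_local_variance[OF less_imp_le[OF h(1)] g(2)]])
    have isG: "integrable \<pi> (sg h ?G)" by (rule integral_sg_pi(1)[OF less_imp_le[OF h(1)] iG])
    have d: "flow \<nu> s f u - flow \<nu> s f (u - h) = (\<integral>x. local_variance h g x \<partial>?\<nu>)"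
      using flow_diff[OF nu f(2), of "u - h" u s] h u by (simp add: g_def)
    have "(\<integral>x. ?G x \<partial>(\<nu> \<bind> K u)) = (\<integral>x. sg h ?G x \<partial>?\<nu>)"
      using integral_sg(2)[OF sub_piD(1)[OF s1], of h ?G] h sub_pi_integrable[OF s2 iG] by (simp add: b)
    then have "(flow \<nu> s f u - flow \<nu> s f (u - h)) / h - 2 * (\<integral>x. ?G x \<partial>(\<nu> \<bind> K u))
        = (\<integral>x. local_variance h g x / h - 2 * ?G x \<partial>?\<nu>) - 2 * (\<integral>x. sg h ?G x - ?G x \<partial>?\<nu>)"
      unfolding d using sub_pi_integrable[OF s1 lv] sub_pi_integrable[OF s1 iG] sub_pi_integrable[OF s1 isG]
      by simp
    moreover have "\<bar>\<integral>x. local_variance h g x / h - 2 * ?G x \<partial>?\<nu>\<bar> \<le> (\<integral>x. \<bar>local_variance h g x / h - 2 * ?G x\<bar> \<partial>\<pi>)"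
      by (rule sub_pi_integral_abs_le[OF s1]) (use lv iG in simp)
    moreover have "\<bar>\<integral>x. sg h ?G x - ?G x \<partial>?\<nu>\<bar> \<le> (\<integral>x. \<bar>sg h ?G x - ?G x\<bar> \<partial>\<pi>)"
      by (rule sub_pi_integral_abs_le[OF s1]) (use isG iG in simp)
    ultimately show ?thesis unfolding real_norm_def by linarith
  qed
  have "\<forall>\<^sub>F h in at_right 0. norm ((flow \<nu> s f u - flow \<nu> s f (u - h)) / h - 2 * (\<integral>x. ?G x \<partial>(\<nu> \<bind> K u))) \<le> ?b h"
    unfolding eventually_at_right_field using bound u by blast
  then have "((\<lambda>h. (flow \<nu> s f u - flow \<nu> s f (u - h)) / h - 2 * (\<integral>x. ?G x \<partial>(\<nu> \<bind> K u))) \<longlongrightarrow> 0) (at_right 0)"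
    by (rule Lim_null_comparison[OF _ b])
  then show ?thesis unfolding g_def by (rule LIM_zero_cancel)
qed

section \<open>Local Poincare inequality and its reverse under sub-commutation\<close>

context
  fixes \<kappa> :: real
  assumes kappa: "0 < \<kappa>" and commutation: "sub_commutation K \<pi> \<A> \<kappa>"
begin

lemma integral_Gamma_sg_le:
  assumes nu: "sub_pi \<nu>" and f: "f \<in> \<A>" and t: "0 \<le> t"
  shows "(\<integral>x. Gamma K \<pi> (sg t f) x \<partial>\<nu>) \<le> exp (- 2 * \<kappa> * t) * (\<integral>x. Gamma K \<pi> f x \<partial>(\<nu> \<bind> K t))"
proof -
  have "AE x in \<pi>. Gamma K \<pi> (sg t f) x \<le> exp (- 2 * \<kappa> * t) * sg t (Gamma K \<pi> f) x"
    using commutation f t by (auto simp: sub_commutation_def)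
  then have "AE x in \<nu>. Gamma K \<pi> (sg t f) x \<le> exp (- 2 * \<kappa> * t) * sg t (Gamma K \<pi> f) x"
    by (rule AE_le_measure[OF sub_piD(2,3)[OF nu]])
  then have "(\<integral>x. Gamma K \<pi> (sg t f) x \<partial>\<nu>) \<le> (\<integral>x. exp (- 2 * \<kappa> * t) * sg t (Gamma K \<pi> f) x \<partial>\<nu>)"
    using integral_sg_pi(1)[OF t integrable_Gamma[OF f]] integrable_Gamma[OF algebra_stable[OF t f]]
    by (intro integral_mono_AE sub_pi_integrable[OF nu]) auto
  also have "\<dots> = exp (- 2 * \<kappa> * t) * (\<integral>x. Gamma K \<pi> f x \<partial>(\<nu> \<bind> K t))"
    using integral_sg(2)[OF sub_piD(1)[OF nu] t sub_pi_integrable[OF sub_pi_bind[OF nu t] integrable_Gamma[OF f]]] by simp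
  finally show ?thesis .
qed

lemma integral_Gamma_nonneg: "sub_pi \<nu> \<Longrightarrow> f \<in> \<A> \<Longrightarrow> 0 \<le> (\<integral>x. Gamma K \<pi> f x \<partial>\<nu>)"
  using Gamma_nonneg[of f] AE_le_measure[OF sub_piD(2,3)]
  by (intro Bochner_Integration.integral_nonneg_AE) auto

text \<open>Sub-commutation over the remaining time \<open>s - u\<close> bounds the left derivative
  of the flow by \<open>2 * exp (- 2 * \<kappa> * (s - u)) * W\<close>.\<close>

lemma local_variance_le_integrated:
  assumes nu: "sub_pi \<nu>" and f: "f \<in> \<A>" "bounded_fun C f" and s: "0 \<le> s"
  shows "(\<integral>x. local_variance s f x \<partial>\<nu>) \<le> (\<integral>x. sg s (Gamma K \<pi> f) x / \<kappa> \<partial>\<nu>)"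
proof -
  define W where "W = (\<integral>x. Gamma K \<pi> f x \<partial>(\<nu> \<bind> K s))"
  have W: "0 \<le> W" unfolding W_def by (rule integral_Gamma_nonneg[OF sub_pi_bind[OF nu s] f(1)])
  \<comment> \<open>An antiderivative of that bound. Its value at 0 is nonnegative and dropped at
    the end, which gives up the factor \<open>1 - exp (- 2 * \<kappa> * s)\<close>.\<close>
  define A where "A u = exp (- 2 * \<kappa> * (s - u)) / \<kappa> * W" for u
  have dA: "(A has_real_derivative 2 * exp (- 2 * \<kappa> * (s - u)) * W) (at u)" for u
    unfolding A_def using kappa by (auto intro!: derivative_eq_intros)
  have "A 0 - flow \<nu> s f 0 \<le> A s - flow \<nu> s f s"
  proof (rule le_of_left_derivative_nonneg[OF s])
    show "continuous_on {0..s} (\<lambda>u. A u - flow \<nu> s f u)"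
      unfolding A_def using kappa by (intro continuous_intros continuous_on_flow[OF nu f]) auto
    fix u assume u: "0 < u" "u \<le> s"
    let ?F = "\<integral>x. Gamma K \<pi> (sg (s - u) f) x \<partial>(\<nu> \<bind> K u)"
    have "(\<nu> \<bind> K u) \<bind> K (s - u) = \<nu> \<bind> K s"
      using bind_kernel_bind[OF sub_piD(1)[OF nu], of u "s - u"] u by simp
    then have "?F \<le> exp (- 2 * \<kappa> * (s - u)) * W"
      using integral_Gamma_sg_le[OF sub_pi_bind[OF nu] f(1), of u "s - u"] u by (simp add: W_def)
    moreover have "((\<lambda>h. (A u - A (u - h)) / h - (flow \<nu> s f u - flow \<nu> s f (u - h)) / h)
        \<longlongrightarrow> 2 * exp (- 2 * \<kappa> * (s - u)) * W - 2 * ?F) (at_right 0)"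
      by (intro tendsto_diff left_difference_quotient_tendsto dA flow_left_derivative[OF nu f u])
    then have "((\<lambda>h. (A u - flow \<nu> s f u - (A (u - h) - flow \<nu> s f (u - h))) / h)
        \<longlongrightarrow> 2 * exp (- 2 * \<kappa> * (s - u)) * W - 2 * ?F) (at_right 0)"
      by (simp only: difference_quotient_diff)
    ultimately show "\<exists>l\<ge>0. ((\<lambda>h. (A u - flow \<nu> s f u - (A (u - h) - flow \<nu> s f (u - h))) / h) \<longlongrightarrow> l) (at_right 0)"
      by (intro exI[of _ "2 * exp (- 2 * \<kappa> * (s - u)) * W - 2 * ?F"]) simp
  qed
  moreover have "0 \<le> A 0" "A s = W / \<kappa>" using W kappa by (auto simp: A_def)
  moreover have "(\<integral>x. local_variance s f x \<partial>\<nu>) = flow \<nu> s f s - flow \<nu> s f 0"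
    using integral_local_variance[of \<nu> s C f] f s sub_pi_bind[OF nu s]
    by (simp add: flow_0[OF nu] flow_end[OF nu algebra_measurable s] sub_piD nu)
  moreover have "(\<integral>x. sg s (Gamma K \<pi> f) x / \<kappa> \<partial>\<nu>) = W / \<kappa>"
    unfolding W_def using integral_sg(2)[OF sub_piD(1)[OF nu] s sub_pi_integrable[OF sub_pi_bind[OF nu s] integrable_Gamma[OF f(1)]]] by simp
  ultimately show ?thesis by linarith
qed

text \<open>Sub-commutation over the elapsed time \<open>u\<close> bounds the left derivative of the
  flow below by \<open>2 * V\<close>, the exponential factor being at most 1. The resulting bound,
  linear in \<open>s\<close>, has the right first order at 0, which is enough for an iteration with
  small steps.\<close>

lemma local_variance_ge_integrated:
  assumes nu: "sub_pi \<nu>" and f: "f \<in> \<A>" "bounded_fun C f" and s: "0 \<le> s"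
  shows "(\<integral>x. 2 * s * Gamma K \<pi> (sg s f) x \<partial>\<nu>) \<le> (\<integral>x. local_variance s f x \<partial>\<nu>)"
proof -
  define V where "V = (\<integral>x. Gamma K \<pi> (sg s f) x \<partial>\<nu>)"
  have "flow \<nu> s f 0 - 2 * V * 0 \<le> flow \<nu> s f s - 2 * V * s"
  proof (rule le_of_left_derivative_nonneg[OF s])
    show "continuous_on {0..s} (\<lambda>u. flow \<nu> s f u - 2 * V * u)"
      by (intro continuous_intros continuous_on_flow[OF nu f])
    fix u assume u: "0 < u" "u \<le> s"
    let ?g = "sg (s - u) f"
    let ?F = "\<integral>x. Gamma K \<pi> ?g x \<partial>(\<nu> \<bind> K u)"
    have g: "?g \<in> \<A>" "bounded_fun C ?g" using u f by (auto intro: algebra_stable bounded_fun_sg)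
    have su: "sub_pi (\<nu> \<bind> K u)" using u by (intro sub_pi_bind nu) simp
    \<comment> \<open>The semigroup law identifies these functions on the space of \<open>E\<close>;
      \<open>Gamma\<close> of them is then compared almost everywhere, first for
      \<open>\<pi>\<close> and then for \<open>\<nu>\<close>.\<close>
    have "AE x in \<pi>. sg s f x = sg u ?g x"
      using sg_sg[OF _ _ _ f(2), of u "s - u"] u by (intro AE_I2) (simp add: space_pi)
    then have "AE x in \<pi>. Gamma K \<pi> (sg s f) x = Gamma K \<pi> (sg u ?g) x"
      using u f(1) g(1) s by (intro Gamma_cong algebra_measurable algebra_stable) auto
    then have "AE x in \<nu>. Gamma K \<pi> (sg s f) x = Gamma K \<pi> (sg u ?g) x"
      by (rule AE_le_measure[OF sub_piD(2,3)[OF nu]])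
    then have "V = (\<integral>x. Gamma K \<pi> (sg u ?g) x \<partial>\<nu>)"
      unfolding V_def using u f(1) g(1) s
      by (intro integral_cong_AE borel_measurable_integrable sub_pi_integrable[OF nu] integrable_Gamma algebra_stable) auto
    also have "\<dots> \<le> exp (- 2 * \<kappa> * u) * ?F" using u by (intro integral_Gamma_sg_le nu g) auto
    also have "\<dots> \<le> 1 * ?F" using kappa u by (intro mult_right_mono integral_Gamma_nonneg su g) auto
    finally have "V \<le> ?F" by simp
    moreover have "((\<lambda>h. (flow \<nu> s f u - flow \<nu> s f (u - h)) / h - (2 * V * u - 2 * V * (u - h)) / h)
        \<longlongrightarrow> 2 * ?F - 2 * V) (at_right 0)"
      by (intro tendsto_diff flow_left_derivative[OF nu f u] left_difference_quotient_tendsto)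
         (auto intro!: derivative_eq_intros)
    then have "((\<lambda>h. (flow \<nu> s f u - 2 * V * u - (flow \<nu> s f (u - h) - 2 * V * (u - h))) / h)
        \<longlongrightarrow> 2 * ?F - 2 * V) (at_right 0)"
      by (simp only: difference_quotient_diff)
    ultimately show "\<exists>l\<ge>0. ((\<lambda>h. (flow \<nu> s f u - 2 * V * u - (flow \<nu> s f (u - h) - 2 * V * (u - h))) / h) \<longlongrightarrow> l) (at_right 0)"
      by (intro exI[of _ "2 * ?F - 2 * V"]) simp
  qed
  moreover have "(\<integral>x. local_variance s f x \<partial>\<nu>) = flow \<nu> s f s - flow \<nu> s f 0"
    using integral_local_variance[of \<nu> s C f] f s sub_pi_bind[OF nu s]
    by (simp add: flow_0[OF nu] flow_end[OF nu algebra_measurable s] sub_piD nu)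
  ultimately show ?thesis by (simp add: V_def algebra_simps)
qed

lemma local_poincare:
  assumes f: "f \<in> \<A>" "bounded_fun C f" and s: "0 \<le> s"
  shows "AE x in \<pi>. local_variance s f x \<le> sg s (Gamma K \<pi> f) x / \<kappa>"
proof (rule AE_le_if_integral_le_le_measure)
  show "integrable \<pi> (local_variance s f)"
    by (rule integrable_pi_bounded[OF bounded_fun_local_variance[OF s f(2)]])
  show "integrable \<pi> (\<lambda>x. sg s (Gamma K \<pi> f) x / \<kappa>)"
    using integral_sg_pi(1)[OF s integrable_Gamma[OF f(1)]] by simp
  show "(\<integral>x. local_variance s f x \<partial>\<nu>) \<le> (\<integral>x. sg s (Gamma K \<pi> f) x / \<kappa> \<partial>\<nu>)"
    if "sets \<nu> = sets \<pi>" "\<nu> \<le> \<pi>" for \<nu>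
    using that by (intro local_variance_le_integrated[OF _ f s]) (simp add: sub_pi_def sets_invariant)
qed

lemma reverse_local_poincare:
  assumes f: "f \<in> \<A>" "bounded_fun C f" and s: "0 \<le> s"
  shows "AE x in \<pi>. 2 * s * Gamma K \<pi> (sg s f) x \<le> local_variance s f x"
proof (rule AE_le_if_integral_le_le_measure)
  show "integrable \<pi> (local_variance s f)"
    by (rule integrable_pi_bounded[OF bounded_fun_local_variance[OF s f(2)]])
  show "integrable \<pi> (\<lambda>x. 2 * s * Gamma K \<pi> (sg s f) x)"
    using integrable_Gamma[OF algebra_stable[OF s f(1)]] by simp
  show "(\<integral>x. 2 * s * Gamma K \<pi> (sg s f) x \<partial>\<nu>) \<le> (\<integral>x. local_variance s f x \<partial>\<nu>)"
    if "sets \<nu> = sets \<pi>" "\<nu> \<le> \<pi>" for \<nu>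
    using that by (intro local_variance_ge_integrated[OF _ f s]) (simp add: sub_pi_def sets_invariant)
qed

end

end

subsection \<open>The laws \<open>\<mu> t\<close> and the invariant law\<close>

context markov_algebra_setting
begin

abbreviation \<mu> :: "real \<Rightarrow> 'a measure" where
  "\<mu> t \<equiv> law M E X t"

abbreviation var :: "'a measure \<Rightarrow> ('a \<Rightarrow> real) \<Rightarrow> real" where
  "var \<nu> f \<equiv> prob_space.variance \<nu> f"

lemma AE_law: "0 < t \<Longrightarrow> AE x in \<pi>. P x \<Longrightarrow> AE x in \<mu> t. P x"
  using absolutely_continuous_AE[OF _ law_absolutely_continuous, of t P] by (simp add: sets_law sets_invariant)

lemma variance_bounded_fun:
  assumes "prob_space \<nu>" "sets \<nu> = sets E" "bounded_fun C f"
  shows "var \<nu> f = (\<integral>x. (f x)\<^sup>2 \<partial>\<nu>) - (\<integral>x. f x \<partial>\<nu>)\<^sup>2"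
  using integrable_bounded_fun[OF prob_space.finite_measure[OF assms(1)] assms(2) assms(3)]
    integrable_bounded_fun[OF prob_space.finite_measure[OF assms(1)] assms(2) bounded_fun_square[OF assms(3)]]
  by (rule prob_space.variance_eq[OF assms(1)])

lemma variance_diff_bounded_fun:
  assumes "prob_space \<nu>" "sets \<nu> = sets E" "bounded_fun C f" "bounded_fun C g"
  shows "\<bar>var \<nu> f - var \<nu> g\<bar> \<le> 4 * C * (\<integral>x. \<bar>f x - g x\<bar> \<partial>\<nu>)"
  using assms(3,4) sets_eq_imp_space_eq[OF assms(2)] measurable_cong_sets[OF assms(2) refl, of borel]
  by (intro prob_space.variance_diff_le[OF assms(1)]) (auto simp: bounded_fun_def)

text \<open>The law of total variance, conditioning on the state at time \<open>r\<close>.\<close>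

lemma variance_law_add:
  assumes r: "0 \<le> r" and h: "0 \<le> h" and f: "bounded_fun C f"
  shows "var (\<mu> (r + h)) f = var (\<mu> r) (sg h f) + (\<integral>x. local_variance h f x \<partial>\<mu> r)"
proof -
  have rh: "0 \<le> r + h" using r h by simp
  note fin = prob_space.finite_measure[OF prob_space_law]
  have "(\<integral>x. sg h f x \<partial>\<mu> r) = (\<integral>x. f x \<partial>\<mu> (r + h))"
    using integral_sg(2)[OF sets_law h, of r f] integrable_bounded_fun[OF fin[OF rh] sets_law f]
    by (simp add: law_bind_kernel[OF r h])
  then show ?thesis
    using integral_local_variance[OF fin[OF r] _ sets_law h f] fin[OF rh]
    unfolding variance_bounded_fun[OF prob_space_law[OF rh] sets_law f]
      variance_bounded_fun[OF prob_space_law[OF r] sets_law bounded_fun_sg[OF h f]]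
    by (simp add: law_bind_kernel[OF r h])
qed

lemma integral_abs_sg_law_le:
  assumes r: "0 \<le> r" and h: "0 \<le> h" and f: "bounded_fun C f"
  shows "(\<integral>x. \<bar>sg h f x\<bar> \<partial>\<mu> r) \<le> (\<integral>x. \<bar>f x\<bar> \<partial>\<mu> (r + h))"
  using integral_abs_sg_le[OF sets_law h, of r f] r h
    integrable_bounded_fun[OF prob_space.finite_measure[OF prob_space_law[of "r + h"]] sets_law f]
  by (simp add: law_bind_kernel[OF r h])

lemma tendsto_integral_law:
  assumes t: "0 < t" and w: "\<And>i. bounded_fun C (w i)" "\<And>i x. 0 \<le> w i x"
    and lim: "((\<lambda>i. \<integral>x. w i x \<partial>\<pi>) \<longlongrightarrow> 0) F"
  shows "((\<lambda>i. \<integral>x. w i x \<partial>\<mu> t) \<longlongrightarrow> 0) F"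
proof (rule tendsto_integral_absolutely_continuous[OF prob_space_invariant prob_space_law _ law_absolutely_continuous[OF t] _ _ lim])
  show "w i \<in> borel_measurable \<pi>" for i
    using bounded_fun_measurable[OF w(1)] by (simp add: measurable_pi_iff)
  show "0 \<le> w i x \<and> w i x \<le> C" if "x \<in> space \<pi>" for i x
    using w that unfolding bounded_fun_def space_pi by (metis abs_le_D1)
qed (use t in \<open>simp_all add: sets_law sets_invariant\<close>)

text \<open>Although \<open>t - r\<close> varies with \<open>r\<close>, the error made in replacing it by \<open>t\<close> is transported
  by the semigroup from \<open>\<mu> r\<close> to the fixed law \<open>\<mu> t\<close>, where it is small since \<open>\<mu> t\<close> is
  absolutely continuous.\<close>

lemma variance_sg_tendsto_0:
  assumes f: "f \<in> \<A>" "bounded_fun C f" and t: "0 < t"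
    and hyp: "\<forall>g\<in>\<A>. ((\<lambda>r. var (\<mu> r) g) \<longlongrightarrow> 0) (at_right 0)"
  shows "((\<lambda>r. var (\<mu> r) (sg (t - r) f)) \<longlongrightarrow> 0) (at_right 0)"
proof -
  have C: "0 \<le> C" by (rule bounded_fun_nonneg[OF f(2)])
  \<comment> \<open>The absolute value of \<open>r\<close> makes the family uniformly bounded for
    every real index, as the transfer to \<open>\<mu> t\<close> requires; near 0 from the right it
    changes nothing.\<close>
  let ?w = "\<lambda>r x. \<bar>sg \<bar>r\<bar> f x - f x\<bar>"
  have "((\<lambda>r. \<integral>x. \<bar>sg r f x - f x\<bar> \<partial>\<pi>) \<longlongrightarrow> 0) (at_right 0)"
    using f(1) algebra_domain by (intro sg_tendsto_L1) auto
  then have "((\<lambda>r. \<integral>x. ?w r x \<partial>\<pi>) \<longlongrightarrow> 0) (at_right 0)"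
    by (rule Lim_transform_eventually)
       (rule eventually_mono[OF eventually_at_right_less], simp)
  then have w: "((\<lambda>r. \<integral>x. ?w r x \<partial>\<mu> t) \<longlongrightarrow> 0) (at_right 0)"
    by (rule tendsto_integral_law[OF t, rotated 2])
       (auto intro!: bounded_fun_abs bounded_fun_diff bounded_fun_sg f)
  have "((\<lambda>r. var (\<mu> r) (sg t f)) \<longlongrightarrow> 0) (at_right 0)"
    using hyp algebra_stable[OF less_imp_le[OF t] f(1)] by blast
  then have "((\<lambda>r. var (\<mu> r) (sg t f) + 4 * C * (\<integral>x. ?w r x \<partial>\<mu> t)) \<longlongrightarrow> 0 + 4 * C * 0) (at_right 0)"
    by (intro tendsto_intros w)
  then have lim: "((\<lambda>r. var (\<mu> r) (sg t f) + 4 * C * (\<integral>x. ?w r x \<partial>\<mu> t)) \<longlongrightarrow> 0) (at_right 0)" by simp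
  have bound: "norm (var (\<mu> r) (sg (t - r) f)) \<le> var (\<mu> r) (sg t f) + 4 * C * (\<integral>x. ?w r x \<partial>\<mu> t)"
    if r: "0 < r" "r < t" for r
  proof -
    have tr: "0 \<le> t - r" "0 \<le> t" "0 \<le> r" using r by auto
    note p = prob_space_law[OF tr(3)]
    have v: "0 \<le> var (\<mu> r) (sg (t - r) f)" by (intro Bochner_Integration.integral_nonneg_AE) simp
    have "\<bar>var (\<mu> r) (sg (t - r) f) - var (\<mu> r) (sg t f)\<bar> \<le> 4 * C * (\<integral>x. \<bar>sg (t - r) f x - sg t f x\<bar> \<partial>\<mu> r)"
      by (rule variance_diff_bounded_fun[OF p sets_law bounded_fun_sg[OF tr(1) f(2)] bounded_fun_sg[OF tr(2) f(2)]])
    also have "(\<integral>x. \<bar>sg (t - r) f x - sg t f x\<bar> \<partial>\<mu> r) = (\<integral>x. \<bar>sg (t - r) (\<lambda>y. f y - sg r f y) x\<bar> \<partial>\<mu> r)"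
    proof (rule Bochner_Integration.integral_cong[OF refl])
      fix x assume "x \<in> space (\<mu> r)"
      then have x: "x \<in> space E" using sets_eq_imp_space_eq[OF sets_law] by blast
      show "\<bar>sg (t - r) f x - sg t f x\<bar> = \<bar>sg (t - r) (\<lambda>y. f y - sg r f y) x\<bar>"
        using sg_diff[OF tr(1) x f(2) bounded_fun_sg[OF tr(3) f(2)]] sg_sg[OF tr(1,3) x f(2)] by simp
    qed
    also have "\<dots> \<le> (\<integral>x. ?w r x \<partial>\<mu> t)"
      using integral_abs_sg_law_le[OF tr(3,1) bounded_fun_diff[OF f(2) bounded_fun_sg[OF tr(3) f(2)]]] r
      by (simp add: abs_minus_commute)
    finally show ?thesis using v C by (simp add: mult_left_mono)
  qed
  show ?thesis
  proof (rule Lim_null_comparison[OF _ lim])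
    show "\<forall>\<^sub>F r in at_right 0. norm (var (\<mu> r) (sg (t - r) f)) \<le> var (\<mu> r) (sg t f) + 4 * C * (\<integral>x. ?w r x \<partial>\<mu> t)"
      unfolding eventually_at_right_field using bound t by blast
  qed
qed

section \<open>Bounded approximation of indicators inside the algebra\<close>

lemma algebra_real_polynomial:
  fixes p :: "real \<Rightarrow> real"
  assumes "real_polynomial_function p" and f: "f \<in> \<A>"
  shows "(\<lambda>x. p (f x)) \<in> \<A>"
  using assms(1)
proof induction
  case (linear p)
  then obtain c where "p = (\<lambda>x. x * c)" by (auto simp: real_bounded_linear)
  then show ?case using algebra_mult[OF f algebra_const[of c]] by simp
next
  case (const c)
  show ?case by (rule algebra_const)
next
  case (add p q)
  then show ?case by (intro algebra_add)
next
  case (mult p q)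
  then show ?case by (intro algebra_mult)
qed

text \<open>Polynomials close to the truncation to \<open>[0, 1]\<close> keep the approximations uniformly bounded,
  as needed to pass from \<open>\<pi>\<close> to the laws \<open>\<mu> t\<close>, whose densities may be unbounded.\<close>

lemma algebra_approximates_indicator:
  assumes B: "B \<in> sets E" and e: "0 < e"
  obtains g where "g \<in> \<A>" "bounded_fun 2 g" "(\<integral>x. \<bar>g x - indicator B x\<bar> \<partial>\<pi>) \<le> e"
proof -
  \<comment> \<open>Two errors of size \<open>d\<close>, from density and from the polynomial, must
    sum to at most \<open>e\<close>; \<open>d \<le> 1\<close> makes 2 a uniform bound.\<close>
  define d where "d = min e 1 / 2"
  have d: "0 < d" "d \<le> 1" "2 * d \<le> e" using e by (auto simp: d_def)
  have iB: "bounded_fun 1 (indicator B :: 'a \<Rightarrow> real)"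
    using B by (auto simp: bounded_fun_def indicator_def)
  obtain f where f: "f \<in> \<A>" "(\<integral>x. (f x - indicator B x)\<^sup>2 \<partial>\<pi>) < d\<^sup>2"
    using algebra_dense[OF L2_bounded[OF iB], of "d\<^sup>2"] d by auto
  obtain C f' where f': "f' \<in> \<A>" "bounded_fun C f'" "AE x in \<pi>. f x = f' x"
    by (rule algebra_bounded_representative[OF f(1)])
  have mB: "(indicator B :: 'a \<Rightarrow> real) \<in> borel_measurable \<pi>"
    using bounded_fun_measurable[OF iB] by (simp add: measurable_pi_iff)
  have mf: "f \<in> borel_measurable \<pi>" "f' \<in> borel_measurable \<pi>"
    using f f' by (auto simp: measurable_pi_iff algebra_measurable)
  have i1: "integrable \<pi> (\<lambda>x. \<bar>f' x - indicator B x\<bar>)"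
    using integrable_pi_bounded[OF bounded_fun_diff[OF f'(2) iB]] by simp
  have "(\<integral>x. \<bar>f' x - indicator B x\<bar> \<partial>\<pi>) \<le> sqrt (\<integral>x. (f' x - indicator B x)\<^sup>2 \<partial>\<pi>)"
    using mB mf integrable_pi_bounded[OF bounded_fun_square[OF bounded_fun_diff[OF f'(2) iB]]]
    by (intro pi.integral_abs_le_sqrt) auto
  also have "(\<integral>x. (f' x - indicator B x)\<^sup>2 \<partial>\<pi>) = (\<integral>x. (f x - indicator B x)\<^sup>2 \<partial>\<pi>)"
    using mB mf f'(3) by (intro integral_cong_AE) auto
  also have "sqrt \<dots> \<le> d"
    using f(2) d by (intro real_le_lsqrt) (auto intro!: Bochner_Integration.integral_nonneg_AE)
  finally have fB: "(\<integral>x. \<bar>f' x - indicator B x\<bar> \<partial>\<pi>) \<le> d" .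
  define clip :: "real \<Rightarrow> real" where "clip y = max 0 (min 1 y)" for y
  obtain p where p: "real_polynomial_function p" "\<And>y. y \<in> {-C..C} \<Longrightarrow> \<bar>clip y - p y\<bar> < d"
  proof (rule Stone_Weierstrass_real_polynomial_function)
    show "continuous_on {-C..C} clip" unfolding clip_def by (intro continuous_intros)
  qed (use d in auto)
  define g where "g = (\<lambda>x. p (f' x))"
  have g: "g \<in> \<A>" unfolding g_def
    using algebra_real_polynomial[OF p(1) f'(1)] .
  have close: "\<bar>clip (f' x) - g x\<bar> \<le> d" if "x \<in> space E" for x
    using p(2)[of "f' x"] f'(2) that unfolding g_def bounded_fun_def by (auto simp: abs_le_iff minus_le_iff less_imp_le)
  have gb: "bounded_fun 2 g"
    unfolding bounded_fun_def
  proof (intro conjI ballI)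
    show "g \<in> borel_measurable E" by (rule algebra_measurable[OF g])
    fix x assume "x \<in> space E"
    from close[OF this] d show "\<bar>g x\<bar> \<le> 2" by (auto simp: clip_def)
  qed
  have "(\<integral>x. \<bar>g x - indicator B x\<bar> \<partial>\<pi>) \<le> (\<integral>x. d + \<bar>f' x - indicator B x\<bar> \<partial>\<pi>)"
  proof (rule integral_mono)
    show "integrable \<pi> (\<lambda>x. \<bar>g x - indicator B x\<bar>)"
      using integrable_pi_bounded[OF bounded_fun_diff[OF gb iB]] by simp
    show "\<bar>g x - indicator B x\<bar> \<le> d + \<bar>f' x - indicator B x\<bar>" if "x \<in> space \<pi>" for x
    proof -
      \<comment> \<open>Clipping is 1-Lipschitz and fixes the values 0 and 1 of the
        indicator.\<close>
      have "\<bar>clip (f' x) - indicator B x\<bar> \<le> \<bar>f' x - indicator B x\<bar>" by (auto simp: clip_def indicator_def)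
      then show ?thesis using close[of x] that unfolding space_pi by linarith
    qed
  qed (use i1 in simp)
  also have "\<dots> = d + (\<integral>x. \<bar>f' x - indicator B x\<bar> \<partial>\<pi>)" using i1 by (simp add: pi.prob_space)
  also have "\<dots> \<le> e" using fB d by simp
  finally show thesis using that g gb by blast
qed

section \<open>Total variation along the laws and the limit of large times\<close>

lemma tv_dist_law_antimono:
  assumes t: "0 \<le> t" and h: "0 \<le> h"
  shows "tv_dist (\<mu> (t + h)) \<pi> \<le> tv_dist (\<mu> t) \<pi>"
proof -
  have th: "0 \<le> t + h" using t h by simp
  have "\<bar>measure (\<mu> (t + h)) B - measure \<pi> B\<bar> \<le> tv_dist (\<mu> t) \<pi>" if B: "B \<in> sets E" for B
  proof -
    have iB: "bounded_fun 1 (indicator B :: 'a \<Rightarrow> real)"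
      using B by (auto simp: bounded_fun_def indicator_def)
    \<comment> \<open>Testing the later law on \<open>B\<close> amounts to testing the earlier one
      on a function with values in \<open>[0, 1]\<close>, and likewise for \<open>\<pi>\<close> by
      invariance.\<close>
    have "(\<integral>x. sg h (indicator B) x \<partial>\<mu> t) = measure (\<mu> (t + h)) B"
      using integral_sg(2)[OF sets_law h, of t "indicator B"] B
        integrable_bounded_fun[OF prob_space.finite_measure[OF prob_space_law[OF th]] sets_law iB]
      by (simp add: law_bind_kernel[OF t h] sets_law)
    moreover have "(\<integral>x. sg h (indicator B) x \<partial>\<pi>) = measure \<pi> B"
      using integral_sg_pi(2)[OF h integrable_pi_bounded[OF iB]] B by (simp add: sets_invariant)
    moreover have "\<bar>(\<integral>x. sg h (indicator B) x \<partial>\<mu> t) - (\<integral>x. sg h (indicator B) x \<partial>\<pi>)\<bar> \<le> tv_dist (\<mu> t) \<pi>"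
    proof (rule abs_integral_diff_le_tv_dist[OF prob_space_law[OF t] prob_space_invariant])
      show "sets \<pi> = sets (\<mu> t)" by (simp add: sets_law sets_invariant)
      show "sg h (indicator B) \<in> borel_measurable (\<mu> t)"
        using sg_measurable[OF h bounded_fun_measurable[OF iB]] measurable_cong_sets[OF sets_law refl] by blast
      fix x assume "x \<in> space (\<mu> t)"
      then have "x \<in> space E" using sets_eq_imp_space_eq[OF sets_law] by blast
      then have "\<bar>sg h (indicator B) x\<bar> \<le> 1" using bounded_fun_sg[OF h iB] by (auto simp: bounded_fun_def)
      moreover have "0 \<le> sg h (indicator B) x"
        unfolding semigroup_op_def by (intro Bochner_Integration.integral_nonneg_AE) simp
      ultimately show "0 \<le> sg h (indicator B) x \<and> sg h (indicator B) x \<le> 1" by simp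
    qed
    ultimately show ?thesis by simp
  qed
  then show ?thesis
    using tv_dist_le_iff[OF prob_space_law[OF th] prob_space_invariant] by (simp add: sets_law)
qed

lemma tendsto_integral_law_invariant:
  assumes f: "bounded_fun C f"
  shows "((\<lambda>t. \<integral>x. f x \<partial>\<mu> t) \<longlongrightarrow> (\<integral>x. f x \<partial>\<pi>)) at_top"
proof -
  have C: "0 \<le> C" by (rule bounded_fun_nonneg[OF f])
  \<comment> \<open>The bound in terms of total variation asks for a positive constant, and
    \<open>C\<close> may be 0; hence \<open>C + 1\<close>.\<close>
  have bound: "norm ((\<integral>x. f x \<partial>\<mu> t) - (\<integral>x. f x \<partial>\<pi>)) \<le> 2 * (C + 1) * tv_dist (\<mu> t) \<pi>" if t: "0 \<le> t" for t
    unfolding real_norm_def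
  proof (rule abs_integral_diff_le_tv_dist_bounded[OF prob_space_law[OF t] prob_space_invariant])
    show "sets \<pi> = sets (\<mu> t)" by (simp add: sets_law sets_invariant)
    show "f \<in> borel_measurable (\<mu> t)"
      using bounded_fun_measurable[OF f] measurable_cong_sets[OF sets_law refl] by blast
    fix x assume "x \<in> space (\<mu> t)"
    then have "x \<in> space E" using sets_eq_imp_space_eq[OF sets_law] by blast
    then show "\<bar>f x\<bar> \<le> C + 1" using f by (auto simp: bounded_fun_def intro: order_trans)
  qed (use C in simp)
  have "((\<lambda>t. (\<integral>x. f x \<partial>\<mu> t) - (\<integral>x. f x \<partial>\<pi>)) \<longlongrightarrow> 0) at_top"
  proof (rule Lim_null_comparison)
    show "\<forall>\<^sub>F t in at_top. norm ((\<integral>x. f x \<partial>\<mu> t) - (\<integral>x. f x \<partial>\<pi>)) \<le> 2 * (C + 1) * tv_dist (\<mu> t) \<pi>"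
      using eventually_ge_at_top[of 0] by eventually_elim (rule bound)
    show "((\<lambda>t. 2 * (C + 1) * tv_dist (\<mu> t) \<pi>) \<longlongrightarrow> 0) at_top"
      using tendsto_mult_left[OF law_tendsto_invariant, of "2 * (C + 1)"] by simp
  qed
  then show ?thesis by (rule LIM_zero_cancel)
qed

lemma tendsto_variance_law_invariant:
  assumes f: "bounded_fun C f"
  shows "((\<lambda>t. var (\<mu> t) f) \<longlongrightarrow> var \<pi> f) at_top"
proof -
  have "((\<lambda>t. (\<integral>x. (f x)\<^sup>2 \<partial>\<mu> t) - (\<integral>x. f x \<partial>\<mu> t)\<^sup>2) \<longlongrightarrow> (\<integral>x. (f x)\<^sup>2 \<partial>\<pi>) - (\<integral>x. f x \<partial>\<pi>)\<^sup>2) at_top"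
    by (intro tendsto_intros tendsto_integral_law_invariant[OF f] tendsto_integral_law_invariant[OF bounded_fun_square[OF f]])
  moreover have "\<forall>\<^sub>F t in at_top. (\<integral>x. (f x)\<^sup>2 \<partial>\<mu> t) - (\<integral>x. f x \<partial>\<mu> t)\<^sup>2 = var (\<mu> t) f"
    using eventually_ge_at_top[of 0]
    by eventually_elim (rule variance_bounded_fun[OF prob_space_law sets_law f, symmetric])
  ultimately show ?thesis
    unfolding variance_bounded_fun[OF prob_space_invariant sets_invariant f] by (rule Lim_transform_eventually)
qed

lemma variance_indicator_le:
  assumes nu: "prob_space \<nu>" "sets \<nu> = sets E" and B: "B \<in> sets E"
  shows "var \<nu> (indicator B) \<le> 1 / 4"
proof -
  have iB: "bounded_fun 1 (indicator B :: 'a \<Rightarrow> real)" using B by (auto simp: bounded_fun_def indicator_def)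
  have "var \<nu> (indicator B) = measure \<nu> B - (measure \<nu> B)\<^sup>2"
    unfolding variance_bounded_fun[OF nu iB]
    using B nu(2) by (simp add: power2_eq_square flip: indicator_inter_arith)
  also have "\<dots> \<le> 1 / 4"
    using zero_le_power2[of "measure \<nu> B - 1 / 2"] by (simp add: power2_diff power_divide)
  finally show ?thesis .
qed

end

subsection \<open>Variance decay and the mixing window\<close>

context bakry_emery_setting
begin

section \<open>Poincare inequality for the laws and decay of variance\<close>

context
  fixes \<kappa> :: real
  assumes kappa: "0 < \<kappa>" and commutation: "sub_commutation K \<pi> \<A> \<kappa>"
    and vanishing: "\<forall>g\<in>\<A>. ((\<lambda>r. var (\<mu> r) g) \<longlongrightarrow> 0) (at_right 0)"
begin

text \<open>The local inequality holds \<open>\<pi>\<close>-almost everywhere, so it is integrated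
  against \<open>\<mu> r\<close> with \<open>r > 0\<close>, where absolute continuity is available.
  The variance that total variance leaves at time \<open>r\<close> disappears as \<open>r\<close>
  tends to 0. An infinite right-hand side is the trivial case.\<close>

lemma poincare_law_bounded:
  assumes f: "f \<in> \<A>" "bounded_fun C f" and t: "0 < t"
  shows "ennreal (\<kappa> * var (\<mu> t) f) \<le> (\<integral>\<^sup>+x. ennreal (Gamma K \<pi> f x) \<partial>\<mu> t)"
proof (cases "\<integral>\<^sup>+x. ennreal (Gamma K \<pi> f x) \<partial>\<mu> t")
  case (real G)
  have le: "\<kappa> * var (\<mu> t) f - \<kappa> * var (\<mu> r) (sg (t - r) f) \<le> G" if r: "0 < r" "r < t" for r
  proof -
    have tr: "0 \<le> t - r" "0 \<le> r" using r by auto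
    have lv: "integrable (\<mu> r) (local_variance (t - r) f)"
      by (rule integrable_bounded_fun[OF prob_space.finite_measure[OF prob_space_law[OF tr(2)]] sets_law
            bounded_fun_local_variance[OF tr(1) f(2)]])
    have lv0: "0 \<le> local_variance (t - r) f x" if "x \<in> space (\<mu> r)" for x
      using local_variance_nonneg[OF tr(1) _ f(2)] that sets_eq_imp_space_eq[OF sets_law] by blast
    have mG: "Gamma K \<pi> f \<in> borel_measurable E"
      using borel_measurable_integrable[OF integrable_Gamma[OF f(1)]] by (simp add: measurable_pi_iff)
    have "ennreal (\<kappa> * (\<integral>x. local_variance (t - r) f x \<partial>\<mu> r)) = (\<integral>\<^sup>+x. ennreal (\<kappa> * local_variance (t - r) f x) \<partial>\<mu> r)"
      using lv lv0 kappa by (subst nn_integral_eq_integral) (auto intro!: AE_I2)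
    also have "\<dots> \<le> (\<integral>\<^sup>+x. ennreal (sg (t - r) (Gamma K \<pi> f) x) \<partial>\<mu> r)"
    proof (rule nn_integral_mono_AE)
      have "AE x in \<mu> r. local_variance (t - r) f x \<le> sg (t - r) (Gamma K \<pi> f) x / \<kappa>"
        by (rule AE_law[OF r(1) local_poincare[OF kappa commutation f tr(1)]])
      then show "AE x in \<mu> r. ennreal (\<kappa> * local_variance (t - r) f x) \<le> ennreal (sg (t - r) (Gamma K \<pi> f) x)"
        by eventually_elim (use kappa in \<open>auto intro!: ennreal_leI simp: field_simps\<close>)
    qed
    also have "\<dots> \<le> (\<integral>\<^sup>+x. \<integral>\<^sup>+y. ennreal (Gamma K \<pi> f y) \<partial>K (t - r) x \<partial>\<mu> r)"
      by (intro nn_integral_mono ennreal_sg_le)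
    also have "\<dots> = (\<integral>\<^sup>+x. ennreal (Gamma K \<pi> f x) \<partial>\<mu> t)"
      using nn_integral_bind_kernel[OF sets_law tr(1), of "\<lambda>x. ennreal (Gamma K \<pi> f x)" r] mG
      by (simp add: law_bind_kernel[OF tr(2,1)])
    finally have "\<kappa> * (\<integral>x. local_variance (t - r) f x \<partial>\<mu> r) \<le> G"
      using real by (simp add: ennreal_le_iff)
    then show ?thesis using variance_law_add[OF tr(2,1) f(2)] by (simp add: algebra_simps)
  qed
  have "((\<lambda>r. \<kappa> * var (\<mu> t) f - \<kappa> * var (\<mu> r) (sg (t - r) f)) \<longlongrightarrow> \<kappa> * var (\<mu> t) f - \<kappa> * 0) (at_right 0)"
    by (intro tendsto_intros variance_sg_tendsto_0[OF f t vanishing])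
  moreover have "\<forall>\<^sub>F r in at_right 0. \<kappa> * var (\<mu> t) f - \<kappa> * var (\<mu> r) (sg (t - r) f) \<le> G"
    unfolding eventually_at_right_field using le t by blast
  ultimately have "\<kappa> * var (\<mu> t) f - \<kappa> * 0 \<le> G"
    by (rule tendsto_upperbound) (simp add: trivial_limit_at_right_real)
  then show ?thesis using real by (simp add: ennreal_leI)
qed simp

lemma poincare_law:
  assumes f: "f \<in> \<A>" and t: "0 < t"
  shows "ennreal (\<kappa> * var (\<mu> t) f) \<le> (\<integral>\<^sup>+x. ennreal (Gamma K \<pi> f x) \<partial>\<mu> t)"
proof -
  obtain C f' where f': "f' \<in> \<A>" "bounded_fun C f'" and eq: "AE x in \<pi>. f x = f' x"
    by (rule algebra_bounded_representative[OF f])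
  have ae: "AE x in \<mu> t. f x = f' x" by (rule AE_law[OF t eq])
  have m: "f \<in> borel_measurable (\<mu> t)" "f' \<in> borel_measurable (\<mu> t)"
    using algebra_measurable[OF f] algebra_measurable[OF f'(1)] measurable_cong_sets[OF sets_law refl] by blast+
  have e: "(\<integral>x. f x \<partial>\<mu> t) = (\<integral>x. f' x \<partial>\<mu> t)" by (rule integral_cong_AE[OF m ae])
  have "var (\<mu> t) f = var (\<mu> t) f'"
    unfolding e using ae m by (intro integral_cong_AE) auto
  moreover have "(\<integral>\<^sup>+x. ennreal (Gamma K \<pi> f x) \<partial>\<mu> t) = (\<integral>\<^sup>+x. ennreal (Gamma K \<pi> f' x) \<partial>\<mu> t)"
  proof (rule nn_integral_cong_AE)
    have "AE x in \<mu> t. Gamma K \<pi> f x = Gamma K \<pi> f' x"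
      by (rule AE_law[OF t Gamma_cong[OF algebra_measurable[OF f] algebra_measurable[OF f'(1)] eq]])
    then show "AE x in \<mu> t. ennreal (Gamma K \<pi> f x) = ennreal (Gamma K \<pi> f' x)" by eventually_elim simp
  qed
  ultimately show ?thesis using poincare_law_bounded[OF f' t] by simp
qed

text \<open>The Poincare inequality at time \<open>r\<close> is applied to \<open>sg h f\<close>;
  the reverse local inequality bounds the resulting energy by the local variance, which is the gap
  between the two variances. The energy is kept in \<open>[0,\<infinity>]\<close> until this bound
  shows what is needed of it.\<close>

lemma variance_contraction_step:
  assumes f: "f \<in> \<A>" "bounded_fun C f" and r: "0 < r" and h: "0 \<le> h"
  shows "(1 + 2 * \<kappa> * h) * var (\<mu> r) (sg h f) \<le> var (\<mu> (r + h)) f"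
proof -
  have r0: "0 \<le> r" using r by simp
  have lv: "integrable (\<mu> r) (local_variance h f)"
    by (rule integrable_bounded_fun[OF prob_space.finite_measure[OF prob_space_law[OF r0]] sets_law
          bounded_fun_local_variance[OF h f(2)]])
  have lv0: "0 \<le> local_variance h f x" if "x \<in> space (\<mu> r)" for x
    using local_variance_nonneg[OF h _ f(2)] that sets_eq_imp_space_eq[OF sets_law] by blast
  have "Gamma K \<pi> (sg h f) \<in> borel_measurable E"
    using borel_measurable_integrable[OF integrable_Gamma[OF algebra_stable[OF h f(1)]]] by (simp add: measurable_pi_iff)
  then have mG: "Gamma K \<pi> (sg h f) \<in> borel_measurable (\<mu> r)"
    using measurable_cong_sets[OF sets_law refl] by blast
  have "ennreal (2 * h * (\<kappa> * var (\<mu> r) (sg h f))) = ennreal (2 * h) * ennreal (\<kappa> * var (\<mu> r) (sg h f))"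
    using h kappa by (intro ennreal_mult) (auto intro!: mult_nonneg_nonneg Bochner_Integration.integral_nonneg_AE)
  also have "\<dots> \<le> ennreal (2 * h) * (\<integral>\<^sup>+x. ennreal (Gamma K \<pi> (sg h f) x) \<partial>\<mu> r)"
    by (intro mult_left_mono poincare_law algebra_stable h f r) simp
  also have "\<dots> = (\<integral>\<^sup>+x. ennreal (2 * h) * ennreal (Gamma K \<pi> (sg h f) x) \<partial>\<mu> r)"
    using mG by (intro nn_integral_cmult[symmetric]) simp
  also have "\<dots> \<le> (\<integral>\<^sup>+x. ennreal (local_variance h f x) \<partial>\<mu> r)"
  proof (rule nn_integral_mono_AE)
    have "AE x in \<mu> r. 2 * h * Gamma K \<pi> (sg h f) x \<le> local_variance h f x"
      by (rule AE_law[OF r reverse_local_poincare[OF kappa commutation f h]])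
    then show "AE x in \<mu> r. ennreal (2 * h) * ennreal (Gamma K \<pi> (sg h f) x) \<le> ennreal (local_variance h f x)"
      by eventually_elim (use h in \<open>auto intro!: ennreal_leI simp: ennreal_mult'[symmetric]\<close>)
  qed
  also have "\<dots> = ennreal (\<integral>x. local_variance h f x \<partial>\<mu> r)"
    using lv lv0 by (intro nn_integral_eq_integral) (auto intro!: AE_I2)
  finally have "2 * h * (\<kappa> * var (\<mu> r) (sg h f)) \<le> (\<integral>x. local_variance h f x \<partial>\<mu> r)"
    using lv0 by (subst (asm) ennreal_le_iff) (auto intro!: Bochner_Integration.integral_nonneg_AE AE_I2)
  then show ?thesis using variance_law_add[OF r0 h f(2)] by (simp add: algebra_simps)
qed

text \<open>One step, applied to \<open>sg (real n * h) f\<close>, moves the start time from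
  \<open>r\<close> to \<open>r + h\<close>, so \<open>r\<close> has to vary in the
  induction.\<close>

lemma variance_contraction_iterate:
  assumes f: "f \<in> \<A>" "bounded_fun C f" and h: "0 \<le> h" and r: "0 < r"
  shows "(1 + 2 * \<kappa> * h) ^ n * var (\<mu> r) (sg (real n * h) f) \<le> var (\<mu> (r + real n * h)) f"
  using r
proof (induction n arbitrary: r)
  case 0
  \<comment> \<open>\<open>sg 0 f\<close> agrees with \<open>f\<close> on the space of
    \<open>E\<close> only; a contraction step of length 0 gives the base case directly.\<close>
  then show ?case using variance_contraction_step[OF f 0, of 0] by simp
next
  case (Suc n)
  have nh: "0 \<le> real n * h" using h by simp
  have g: "sg (real n * h) f \<in> \<A>" "bounded_fun C (sg (real n * h) f)"
    using algebra_stable[OF nh f(1)] bounded_fun_sg[OF nh f(2)] by auto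
  have *: "sg (real (Suc n) * h) f x = sg h (sg (real n * h) f) x" if "x \<in> space (\<mu> r)" for x
    using sg_sg[OF h nh _ f(2)] that sets_eq_imp_space_eq[OF sets_law, of r] by (simp add: algebra_simps)
  have e: "(\<integral>x. sg (real (Suc n) * h) f x \<partial>\<mu> r) = (\<integral>x. sg h (sg (real n * h) f) x \<partial>\<mu> r)"
    by (rule Bochner_Integration.integral_cong[OF refl *])
  have "var (\<mu> r) (sg (real (Suc n) * h) f) = var (\<mu> r) (sg h (sg (real n * h) f))"
    unfolding e by (rule Bochner_Integration.integral_cong[OF refl]) (simp only: *)
  then have "(1 + 2 * \<kappa> * h) ^ Suc n * var (\<mu> r) (sg (real (Suc n) * h) f)
      = (1 + 2 * \<kappa> * h) ^ n * ((1 + 2 * \<kappa> * h) * var (\<mu> r) (sg h (sg (real n * h) f)))"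
    by (simp only: power_Suc mult_ac)
  also have "\<dots> \<le> (1 + 2 * \<kappa> * h) ^ n * var (\<mu> (r + h)) (sg (real n * h) f)"
    using kappa h by (intro mult_left_mono variance_contraction_step[OF g Suc.prems h]) auto
  also have "\<dots> \<le> var (\<mu> (r + h + real n * h)) f"
    using Suc.prems h by (intro Suc.IH) simp
  finally show ?case by (simp add: algebra_simps)
qed

text \<open>Splitting \<open>s\<close> into \<open>n\<close> equal steps produces the factor
  \<open>(1 + 2 * \<kappa> * s / n) ^ n\<close>, which tends to the exponential.\<close>

lemma variance_decay_algebra:
  assumes f: "f \<in> \<A>" "bounded_fun C f" and r: "0 < r" and s: "0 \<le> s"
  shows "exp (2 * \<kappa> * s) * var (\<mu> r) (sg s f) \<le> var (\<mu> (r + s)) f"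
proof (rule LIMSEQ_le_const2)
  show "(\<lambda>n. (1 + 2 * \<kappa> * s / real n) ^ n * var (\<mu> r) (sg s f)) \<longlonglongrightarrow> exp (2 * \<kappa> * s) * var (\<mu> r) (sg s f)"
    by (intro tendsto_intros tendsto_exp_limit_sequentially)
  have "(1 + 2 * \<kappa> * s / real n) ^ n * var (\<mu> r) (sg s f) \<le> var (\<mu> (r + s)) f" if n: "1 \<le> n" for n
  proof -
    have ns: "real n * (s / real n) = s" using n by simp
    show ?thesis
      using variance_contraction_iterate[OF f _ r, of "s / real n" n] s unfolding ns by simp
  qed
  then show "\<exists>N. \<forall>n\<ge>N. (1 + 2 * \<kappa> * s / real n) ^ n * var (\<mu> r) (sg s f) \<le> var (\<mu> (r + s)) f" by blast
qed

text \<open>Approximants from the algebra, bounded by 2, converge in L1 of \<open>\<pi>\<close> and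
  hence of \<open>\<mu> (r + s)\<close>. The same null sequence controls both sides, since the error
  under \<open>\<mu> r\<close> after applying \<open>sg s\<close> is at most the error under
  \<open>\<mu> (r + s)\<close>.\<close>

lemma variance_decay_indicator:
  assumes B: "B \<in> sets E" and r: "0 < r" and s: "0 \<le> s"
  shows "exp (2 * \<kappa> * s) * var (\<mu> r) (sg s (indicator B)) \<le> var (\<mu> (r + s)) (indicator B)"
proof -
  have r0: "0 \<le> r" and rs: "0 < r + s" "0 \<le> r + s" using r s by auto
  have iB: "bounded_fun 2 (indicator B :: 'a \<Rightarrow> real)"
    using B by (auto simp: bounded_fun_def indicator_def)
  have "\<exists>g. g \<in> \<A> \<and> bounded_fun 2 g \<and> (\<integral>x. \<bar>g x - indicator B x\<bar> \<partial>\<pi>) \<le> inverse (real (Suc n))" for n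
    using algebra_approximates_indicator[OF B, of "inverse (real (Suc n))"] by (metis inverse_Suc)
  then obtain g where g: "\<And>n. g n \<in> \<A>" "\<And>n. bounded_fun 2 (g n)"
      "\<And>n. (\<integral>x. \<bar>g n x - indicator B x\<bar> \<partial>\<pi>) \<le> inverse (real (Suc n))"
    by metis
  have "(\<lambda>n. \<integral>x. \<bar>g n x - indicator B x\<bar> \<partial>\<pi>) \<longlonglongrightarrow> 0"
    by (rule tendsto_sandwich[OF _ _ tendsto_const LIMSEQ_inverse_real_of_nat])
       (auto intro!: always_eventually g(3) Bochner_Integration.integral_nonneg_AE simp del: of_nat_Suc)
  then have w: "(\<lambda>n. \<integral>x. \<bar>g n x - indicator B x\<bar> \<partial>\<mu> (r + s)) \<longlonglongrightarrow> 0"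
    by (rule tendsto_integral_law[OF rs(1) bounded_fun_abs[OF bounded_fun_diff[OF g(2) iB]] abs_ge_zero])
  have w8: "(\<lambda>n. 4 * 2 * (\<integral>x. \<bar>g n x - indicator B x\<bar> \<partial>\<mu> (r + s))) \<longlonglongrightarrow> 0"
    using tendsto_mult_left[OF w, of "4 * 2"] by simp
  have 1: "(\<lambda>n. var (\<mu> (r + s)) (g n)) \<longlonglongrightarrow> var (\<mu> (r + s)) (indicator B)"
  proof (rule LIM_zero_cancel, rule Lim_null_comparison[OF _ w8])
    show "\<forall>\<^sub>F n in sequentially. norm (var (\<mu> (r + s)) (g n) - var (\<mu> (r + s)) (indicator B))
        \<le> 4 * 2 * (\<integral>x. \<bar>g n x - indicator B x\<bar> \<partial>\<mu> (r + s))"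
      unfolding real_norm_def
      by (intro always_eventually allI variance_diff_bounded_fun[OF prob_space_law[OF rs(2)] sets_law g(2) iB])
  qed
  have 2: "(\<lambda>n. var (\<mu> r) (sg s (g n))) \<longlonglongrightarrow> var (\<mu> r) (sg s (indicator B))"
  proof (rule LIM_zero_cancel, rule Lim_null_comparison[OF _ w8], intro always_eventually allI)
    fix n
    have "(\<integral>x. \<bar>sg s (g n) x - sg s (indicator B) x\<bar> \<partial>\<mu> r) = (\<integral>x. \<bar>sg s (\<lambda>y. g n y - indicator B y) x\<bar> \<partial>\<mu> r)"
      using sg_diff[OF s _ g(2) iB] sets_eq_imp_space_eq[OF sets_law, of r]
      by (intro Bochner_Integration.integral_cong) auto
    also have "\<dots> \<le> (\<integral>x. \<bar>g n x - indicator B x\<bar> \<partial>\<mu> (r + s))"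
      by (rule integral_abs_sg_law_le[OF r0 s bounded_fun_diff[OF g(2) iB]])
    finally show "norm (var (\<mu> r) (sg s (g n)) - var (\<mu> r) (sg s (indicator B)))
        \<le> 4 * 2 * (\<integral>x. \<bar>g n x - indicator B x\<bar> \<partial>\<mu> (r + s))"
      using variance_diff_bounded_fun[OF prob_space_law[OF r0] sets_law bounded_fun_sg[OF s g(2)[of n]] bounded_fun_sg[OF s iB]]
      unfolding real_norm_def by linarith
  qed
  show ?thesis
    by (rule LIMSEQ_le[OF tendsto_mult_left[OF 2] 1]) (auto intro!: variance_decay_algebra[OF g(1,2) r s])
qed

text \<open>For bounded functions, convergence in total variation carries variances under the laws
  to variances under \<open>\<pi>\<close>, so the start time can be sent to infinity.\<close>

lemma variance_decay_indicator_invariant: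
  assumes B: "B \<in> sets E" and s: "0 \<le> s"
  shows "exp (2 * \<kappa> * s) * var \<pi> (sg s (indicator B)) \<le> var \<pi> (indicator B)"
proof (rule tendsto_le[OF trivial_limit_at_top_linorder])
  have iB: "bounded_fun 1 (indicator B :: 'a \<Rightarrow> real)"
    using B by (auto simp: bounded_fun_def indicator_def)
  show "((\<lambda>t. exp (2 * \<kappa> * s) * var (\<mu> t) (sg s (indicator B))) \<longlongrightarrow> exp (2 * \<kappa> * s) * var \<pi> (sg s (indicator B))) at_top"
    by (intro tendsto_mult_left tendsto_variance_law_invariant[OF bounded_fun_sg[OF s iB]])
  have "filterlim (\<lambda>t. s + t) at_top at_top"
    by (intro filterlim_tendsto_add_at_top[OF tendsto_const] filterlim_ident)
  then show "((\<lambda>t. var (\<mu> (s + t)) (indicator B)) \<longlongrightarrow> var \<pi> (indicator B)) at_top"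
    by (rule filterlim_compose[OF tendsto_variance_law_invariant[OF iB]])
  show "\<forall>\<^sub>F t in at_top. exp (2 * \<kappa> * s) * var (\<mu> t) (sg s (indicator B)) \<le> var (\<mu> (s + t)) (indicator B)"
    using eventually_gt_at_top[of 0]
  proof eventually_elim
    case (elim t)
    then show ?case using variance_decay_indicator[OF B elim s] by (simp only: add.commute)
  qed
qed

section \<open>The mixing window\<close>

lemma tv_dist_law_window:
  assumes e: "0 < e" "e < 1" and t: "0 < t" and tv: "tv_dist (\<mu> t) \<pi> \<le> 1 - e"
  shows "tv_dist (\<mu> (t + 3 / (2 * \<kappa>) * ln (1 / e))) \<pi> \<le> e"
proof -
  define s where "s = 3 / (2 * \<kappa>) * ln (1 / e)"
  have s: "0 \<le> s" unfolding s_def using kappa e by simp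
  have t0: "0 \<le> t" and ts: "0 \<le> t + s" using t s by auto
  have "exp (2 * \<kappa> * s) = exp (real 3 * ln (1 / e))" using kappa by (simp add: s_def)
  also have "\<dots> = 1 / e ^ 3"
    unfolding exp_of_nat_mult using e by (subst exp_ln) (auto simp: power_one_over)
  finally have exps: "exp (2 * \<kappa> * s) = 1 / e ^ 3" .
  \<comment> \<open>The constant 1/4 is the largest variance of an indicator.\<close>
  have decay: "v \<le> e ^ 3 / 4" if "exp (2 * \<kappa> * s) * v \<le> w" "w \<le> 1 / 4" for v w
  proof -
    have "v \<le> w * e ^ 3" using that(1) e unfolding exps by (simp add: field_simps)
    also have "\<dots> \<le> 1 / 4 * e ^ 3" using that(2) e by (intro mult_right_mono) auto
    finally show ?thesis by simp
  qed
  have "\<bar>measure (\<mu> (t + s)) B - measure \<pi> B\<bar> \<le> e" if B: "B \<in> sets E" for B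
  proof -
    let ?g = "sg s (indicator B)"
    have iB: "bounded_fun 1 (indicator B :: 'a \<Rightarrow> real)"
      using B by (auto simp: bounded_fun_def indicator_def)
    note g = bounded_fun_sg[OF s iB]
    have a: "(\<integral>x. ?g x \<partial>\<mu> t) = measure (\<mu> (t + s)) B"
      using integral_sg(2)[OF sets_law s, of t "indicator B"] B
        integrable_bounded_fun[OF prob_space.finite_measure[OF prob_space_law[OF ts]] sets_law iB]
      by (simp add: law_bind_kernel[OF t0 s] sets_law)
    have b: "(\<integral>x. ?g x \<partial>\<pi>) = measure \<pi> B"
      using integral_sg_pi(2)[OF s integrable_pi_bounded[OF iB]] B by (simp add: sets_invariant)
    have vm: "var (\<mu> t) ?g \<le> e ^ 3 / 4"
      by (rule decay[OF variance_decay_indicator[OF B t s] variance_indicator_le[OF prob_space_law[OF ts] sets_law B]])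
    have vp: "var \<pi> ?g \<le> e ^ 3 / 4"
      by (rule decay[OF variance_decay_indicator_invariant[OF B s] variance_indicator_le[OF prob_space_invariant sets_invariant B]])
    \<comment> \<open>The two measures of \<open>B\<close> are the means of \<open>?g\<close> under
      \<open>\<mu> t\<close> and \<open>\<pi>\<close>, so the squared deviations in the overlap
      bound are exactly the variances.\<close>
    have "e * (measure (\<mu> (t + s)) B - measure \<pi> B)\<^sup>2 \<le> 2 * var (\<mu> t) ?g + 2 * var \<pi> ?g"
      unfolding a b
    proof (rule square_diff_le_of_overlap[OF prob_space_law[OF t0] prob_space_invariant _ _ _ tv])
      show "sets \<pi> = sets (\<mu> t)" by (simp add: sets_law sets_invariant)
      show "?g \<in> borel_measurable (\<mu> t)"
        using bounded_fun_measurable[OF g] measurable_cong_sets[OF sets_law refl] by blast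
      show "\<bar>?g x\<bar> \<le> 1" if "x \<in> space (\<mu> t)" for x
        using g that sets_eq_imp_space_eq[OF sets_law, of t] by (auto simp: bounded_fun_def)
    qed
    \<comment> \<open>Each of the two terms is at most \<open>e ^ 3 / 2\<close>; one factor
      \<open>e\<close> then cancels against the overlap.\<close>
    also have "\<dots> \<le> e * e\<^sup>2" using vm vp by (simp add: power2_eq_square power3_eq_cube)
    finally have "(measure (\<mu> (t + s)) B - measure \<pi> B)\<^sup>2 \<le> e\<^sup>2" using e by simp
    then show ?thesis using e by (simp add: abs_le_square_iff[symmetric])
  qed
  then show ?thesis
    using tv_dist_le_iff[OF prob_space_law[OF ts] prob_space_invariant] by (simp add: sets_law s_def)
qed

lemma w_mix_le:
  assumes e: "0 < e" "e < 1"
  shows "w_mix M E X \<pi> e \<le> 3 / (2 * \<kappa>) * ln (1 / e)"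
proof -
  define s where "s = 3 / (2 * \<kappa>) * ln (1 / e)"
  define S where "S a = {t. 0 \<le> t \<and> tv_dist (\<mu> t) \<pi> \<le> a}" for a
  have s: "0 \<le> s" unfolding s_def using kappa e by simp
  have bdd: "bdd_below (S a)" for a unfolding S_def by (rule bdd_belowI[of _ 0]) simp
  \<comment> \<open>Convergence to \<open>\<pi>\<close> makes the set nonempty; the real infimum of
    an empty set would carry no information.\<close>
  have ne: "S (1 - e) \<noteq> {}"
  proof -
    have "\<forall>\<^sub>F t in at_top. tv_dist (\<mu> t) \<pi> < 1 - e"
      using law_tendsto_invariant e by (intro order_tendstoD(2)) auto
    then have "\<forall>\<^sub>F t in at_top. t \<in> S (1 - e)"
      using eventually_ge_at_top[of 0] by eventually_elim (simp add: S_def)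
    then show ?thesis using eventually_happens[of _ "at_top :: real filter"] by force
  qed
  have "Inf (S e) \<le> Inf (S (1 - e)) + s"
  proof (rule field_le_epsilon)
    fix d :: real assume d: "0 < d"
    obtain t where t: "t \<in> S (1 - e)" "t < Inf (S (1 - e)) + d / 2"
      using cInf_lessD[OF ne, of "Inf (S (1 - e)) + d / 2"] d by auto
    \<comment> \<open>The near-minimiser \<open>t\<close> may be 0, whereas the window estimate
      starts from a positive time. Waiting \<open>d / 2\<close> longer repairs this, and the
      distance does not increase meanwhile.\<close>
    have "tv_dist (\<mu> (t + d / 2)) \<pi> \<le> 1 - e"
      using tv_dist_law_antimono[of t "d / 2"] t d by (simp add: S_def)
    then have "tv_dist (\<mu> (t + d / 2 + s)) \<pi> \<le> e"
      using tv_dist_law_window[OF e, of "t + d / 2"] t d by (simp add: S_def s_def)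
    then have "t + d / 2 + s \<in> S e" using t d s by (simp add: S_def)
    then have "Inf (S e) \<le> t + d / 2 + s" by (rule cInf_lower[OF _ bdd])
    then show "Inf (S e) \<le> Inf (S (1 - e)) + s + d" using t by simp
  qed
  then show ?thesis unfolding w_mix_def t_mix_def S_def s_def by simp
qed

end

text \<open>\<open>\<kappa>\<close> itself competes in the supremum, which ranges over all reals.
  When \<open>\<kappa> \<le> 0\<close> it qualifies because the left-hand side is nonpositive and
  the energy is taken in \<open>[0,\<infinity>]\<close>.\<close>

lemma local_poincare_const_ge:
  assumes comm: "sub_commutation K \<pi> \<A> \<kappa>"
    and vanishing: "\<forall>g\<in>\<A>. ((\<lambda>r. var (\<mu> r) g) \<longlongrightarrow> 0) (at_right 0)"
  shows "ereal \<kappa> \<le> local_poincare_const M E X K \<pi> \<A>"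
  unfolding local_poincare_const_def poincare_const_def
proof (rule INF_greatest)
  fix t :: real assume t: "t \<in> {0<..}"
  have "ereal (\<kappa> * var (\<mu> t) f) \<le> enn2ereal (\<integral>\<^sup>+x. ennreal (Gamma K \<pi> f x) \<partial>\<mu> t)" if f: "f \<in> \<A>" for f
  proof (cases "0 < \<kappa>")
    case True
    have "ennreal (\<kappa> * var (\<mu> t) f) \<le> (\<integral>\<^sup>+x. ennreal (Gamma K \<pi> f x) \<partial>\<mu> t)"
      using t by (intro poincare_law[OF True comm vanishing f]) simp
    moreover have "0 \<le> \<kappa> * var (\<mu> t) f"
      using True by (intro mult_nonneg_nonneg Bochner_Integration.integral_nonneg_AE) auto
    ultimately show ?thesis by (simp add: less_eq_ennreal.rep_eq enn2ereal_ennreal)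
  next
    case False
    have "0 \<le> var (\<mu> t) f" by (intro Bochner_Integration.integral_nonneg_AE) simp
    then have "ereal (\<kappa> * var (\<mu> t) f) \<le> 0"
      using False by (simp add: mult_nonpos_nonneg)
    also have "0 \<le> enn2ereal (\<integral>\<^sup>+x. ennreal (Gamma K \<pi> f x) \<partial>\<mu> t)" by simp
    finally show ?thesis .
  qed
  then show "ereal \<kappa> \<le> Sup {ereal c | c. \<forall>f\<in>\<A>. ereal (c * var (\<mu> t) f) \<le> enn2ereal (\<integral>\<^sup>+x. ennreal (Gamma K \<pi> f x) \<partial>\<mu> t)}"
    by (intro Sup_upper CollectI exI[of _ \<kappa>] conjI refl ballI)
qed

end

theorem corollary1:
  fixes M :: "'w measure" and E :: "'a measure"
    and X :: "real \<Rightarrow> 'w \<Rightarrow> 'a" and K :: "real \<Rightarrow> 'a \<Rightarrow> 'a measure"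
    and \<pi> :: "'a measure" and \<A> :: "('a \<Rightarrow> real) set" and \<kappa> :: real
  assumes "bakry_emery_setting M E X K \<pi> \<A>"
    and "is_curvature K \<pi> \<A> \<kappa>"
    and "\<forall>f\<in>\<A>. ((\<lambda>t. prob_space.variance (law M E X t) f) \<longlongrightarrow> 0) (at_right 0)"
  shows "local_poincare_const M E X K \<pi> \<A> \<ge> ereal \<kappa> \<and>
    (\<kappa> > 0 \<longrightarrow> (\<forall>\<epsilon>\<in>{0<..<1/2}. w_mix M E X \<pi> \<epsilon> \<le> 3 / (2 * \<kappa>) * ln (1 / \<epsilon>)))"
proof -
  interpret bakry_emery_setting M E X K \<pi> \<A> by fact
  have comm: "sub_commutation K \<pi> \<A> \<kappa>"
    using assms(2) CD_iff_sub_commutation by (simp add: is_curvature_def)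
  show ?thesis
    using local_poincare_const_ge[OF comm assms(3)] w_mix_le[OF _ comm assms(3)] by auto
qed

end
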